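(* Let $G$ be a finite undirected graph without loops or parallel edges. Then $G$ is pure if and only if $G$ is outerplanar. Equivalently, for any orientation $\vec G$ of $G$, the graphical oriented matroid $\mathcal M_{\vec G}$ is pure if and only if $G$ is outerplanar.
   Context: Two total orientations $O_1,O_2$ of $G$ are $G$-separated if there is no cycle $C$ of $G$ that is a directed cycle in both $O_1$ and $O_2$ but with opposite directions. $G$ is pure if every collection of pairwise $G$-separated total orientations of $G$ that is maximal by inclusion has cardinality equal to the number of forests (acyclic edge subsets) of $G$. For a directed graph $\vec G$ on vertex set $[d]$, $\mathcal M_{\vec G}$ is the oriented matroid of linear dependencies of the vectors $e_i-e_j\in\mathbb R^d$ over the edges $i\to j$ (circuits = sign patterns of minimal linear dependencies). An oriented matroid $\mathcal M$ is pure if every $\mathcal M$-separated collection maximal by inclusion has maximum cardinality, where $I,J$ are $\mathcal M$-separated if no circuit $X$ satisfies $X^+\subseteq I\setminus J$, $X^-\subseteq J\setminus I$. A graph is outerplanar if it can be drawn in the plane without crossings with every vertex on the outer face (equivalently, it has no $K_4$ or $K_{2,3}$ minor). *)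

theory Defs
  imports Complex_Main
begin

section \<open>Finite simple graphs\<close>

text \<open>A finite undirected graph without loops or parallel edges: a finite vertex set V
  and a set E of 2-element subsets of V.\<close>
definition simple_graph :: "'a set \<Rightarrow> 'a set set \<Rightarrow> bool" where
  "simple_graph V E \<longleftrightarrow> finite V \<and> (\<forall>e\<in>E. e \<subseteq> V \<and> card e = 2)"

text \<open>A cycle of an (undirected) edge set E, given by a cyclic sequence of k \<ge> 3 distinct
  vertices, consecutive ones (cyclically) joined by an edge of E.\<close>
definition is_cycle :: "'a set set \<Rightarrow> 'a list \<Rightarrow> bool" where
  "is_cycle E vs \<longleftrightarrow> length vs \<ge> 3 \<and> distinct vs \<and>
     (\<forall>i < length vs. {vs ! i, vs ! ((i + 1) mod length vs)} \<in> E)"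

text \<open>Forests = acyclic edge subsets.\<close>
definition forest :: "'a set set \<Rightarrow> bool" where
  "forest F \<longleftrightarrow> \<not> (\<exists>vs. is_cycle F vs)"

definition forests :: "'a set set \<Rightarrow> 'a set set set" where
  "forests E = {F. F \<subseteq> E \<and> forest F}"

text \<open>A total orientation: a set of arcs choosing exactly one direction for every edge.\<close>
definition total_orientation :: "'a set \<Rightarrow> 'a set set \<Rightarrow> ('a \<times> 'a) set \<Rightarrow> bool" where
  "total_orientation V E D \<longleftrightarrow> D \<subseteq> {(u, v). {u, v} \<in> E} \<and>
     (\<forall>u v. {u, v} \<in> E \<longrightarrow> ((u, v) \<in> D \<longleftrightarrow> (v, u) \<notin> D))"

text \<open>The cycle vs is a directed cycle of D, traversed in the direction of vs.\<close>
definition directed_along :: "('a \<times> 'a) set \<Rightarrow> 'a list \<Rightarrow> bool" where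
  "directed_along D vs \<longleftrightarrow> (\<forall>i < length vs. (vs ! i, vs ! ((i + 1) mod length vs)) \<in> D)"

definition G_separated :: "'a set set \<Rightarrow> ('a \<times> 'a) set \<Rightarrow> ('a \<times> 'a) set \<Rightarrow> bool" where
  "G_separated E D1 D2 \<longleftrightarrow>
     \<not> (\<exists>vs. is_cycle E vs \<and> directed_along D1 vs \<and> directed_along D2 (rev vs))"

definition maximal_by_inclusion :: "('b set \<Rightarrow> bool) \<Rightarrow> 'b set \<Rightarrow> bool" where
  "maximal_by_inclusion P S \<longleftrightarrow> P S \<and> (\<forall>T. P T \<and> S \<subseteq> T \<longrightarrow> T = S)"

definition G_separated_collection ::
    "'a set \<Rightarrow> 'a set set \<Rightarrow> ('a \<times> 'a) set set \<Rightarrow> bool" where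
  "G_separated_collection V E S \<longleftrightarrow> (\<forall>D\<in>S. total_orientation V E D) \<and>
     (\<forall>D1\<in>S. \<forall>D2\<in>S. G_separated E D1 D2)"

definition graph_pure :: "'a set \<Rightarrow> 'a set set \<Rightarrow> bool" where
  "graph_pure V E \<longleftrightarrow> (\<forall>S. maximal_by_inclusion (G_separated_collection V E) S \<longrightarrow>
     card S = card (forests E))"

section \<open>Graphical oriented matroid of a directed graph\<close>

text \<open>The vector e_i - e_j in R^V associated with the arc i \<rightarrow> j.\<close>
definition arc_vec :: "'a \<times> 'a \<Rightarrow> 'a \<Rightarrow> real" where
  "arc_vec a v = (if v = fst a then 1 else 0) - (if v = snd a then 1 else 0)"

definition support :: "('a \<times> 'a) set \<Rightarrow> ('a \<times> 'a \<Rightarrow> real) \<Rightarrow> ('a \<times> 'a) set" where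
  "support A c = {a \<in> A. c a \<noteq> 0}"

text \<open>A (nontrivial) linear dependency of the vectors of the arcs in A.\<close>
definition lin_dependency :: "('a \<times> 'a) set \<Rightarrow> ('a \<times> 'a \<Rightarrow> real) \<Rightarrow> bool" where
  "lin_dependency A c \<longleftrightarrow> support A c \<noteq> {} \<and>
     (\<forall>v. (\<Sum>a\<in>A. c a * arc_vec a v) = 0)"

text \<open>Signed circuits (X+, X-) = sign patterns of minimal linear dependencies.\<close>
definition OM_circuit :: "('a \<times> 'a) set \<Rightarrow> ('a \<times> 'a) set \<times> ('a \<times> 'a) set \<Rightarrow> bool" where
  "OM_circuit A X \<longleftrightarrow> (\<exists>c. lin_dependency A c \<and>
     (\<forall>c'. lin_dependency A c' \<longrightarrow> \<not> support A c' \<subset> support A c) \<and>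
     fst X = {a \<in> A. c a > 0} \<and> snd X = {a \<in> A. c a < 0})"

definition OM_separated ::
    "('a \<times> 'a) set \<Rightarrow> ('a \<times> 'a) set \<Rightarrow> ('a \<times> 'a) set \<Rightarrow> bool" where
  "OM_separated A I J \<longleftrightarrow> \<not> (\<exists>X. OM_circuit A X \<and> fst X \<subseteq> I - J \<and> snd X \<subseteq> J - I)"

definition OM_separated_collection :: "('a \<times> 'a) set \<Rightarrow> ('a \<times> 'a) set set \<Rightarrow> bool" where
  "OM_separated_collection A S \<longleftrightarrow> (\<forall>I\<in>S. I \<subseteq> A) \<and>
     (\<forall>I\<in>S. \<forall>J\<in>S. OM_separated A I J)"

definition OM_pure :: "('a \<times> 'a) set \<Rightarrow> bool" where
  "OM_pure A \<longleftrightarrow> (\<forall>S. maximal_by_inclusion (OM_separated_collection A) S \<longrightarrow>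
     card S = Max (card ` {T. OM_separated_collection A T}))"

section \<open>Minors and outerplanarity\<close>

definition connected_in :: "'a set set \<Rightarrow> 'a set \<Rightarrow> bool" where
  "connected_in E S \<longleftrightarrow>
     (\<forall>u\<in>S. \<forall>v\<in>S. (u, v) \<in> ({(x, y). {x, y} \<in> E \<and> x \<in> S \<and> y \<in> S})\<^sup>*)"

text \<open>H = (VH, EH) is a minor of G = (V, E): there are nonempty, pairwise disjoint,
  connected branch sets B x \<subseteq> V (x \<in> VH) with an edge of G between B x and B y
  for every edge {x, y} of H.\<close>
definition has_minor :: "'a set \<Rightarrow> 'a set set \<Rightarrow> 'b set \<Rightarrow> 'b set set \<Rightarrow> bool" where
  "has_minor V E VH EH \<longleftrightarrow> (\<exists>B :: 'b \<Rightarrow> 'a set.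
     (\<forall>x\<in>VH. B x \<noteq> {} \<and> B x \<subseteq> V \<and> connected_in E (B x)) \<and>
     (\<forall>x\<in>VH. \<forall>y\<in>VH. x \<noteq> y \<longrightarrow> B x \<inter> B y = {}) \<and>
     (\<forall>x y. {x, y} \<in> EH \<longrightarrow> (\<exists>u\<in>B x. \<exists>v\<in>B y. {u, v} \<in> E)))"

definition K4_V :: "nat set" where "K4_V = {0, 1, 2, 3}"
definition K4_E :: "nat set set" where
  "K4_E = {{i, j} | i j. i \<in> K4_V \<and> j \<in> K4_V \<and> i \<noteq> j}"

definition K23_V :: "nat set" where "K23_V = {0, 1, 2, 3, 4}"
definition K23_E :: "nat set set" where
  "K23_E = {{i, j} | i j. i \<in> {0, 1} \<and> j \<in> {2, 3, 4}}"

text \<open>Outerplanar = no K4 minor and no K_{2,3} minor.\<close>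
definition outerplanar :: "'a set \<Rightarrow> 'a set set \<Rightarrow> bool" where
  "outerplanar V E \<longleftrightarrow> \<not> has_minor V E K4_V K4_E \<and> \<not> has_minor V E K23_V K23_E"

end

theory Submission
  imports Defs
begin

text \<open>
  Two total orientations are separated iff the arcs on which they differ, directed as in the first
  one, form an acyclic digraph. By deletion and contraction of an edge, a separated collection has
  at most as many members as there are forests, and equality is attained; so purity passes to minors.
  Neither \<open>K\<^sub>4\<close> nor \<open>K\<^sub>2\<^sub>,\<^sub>3\<close> is pure: for a collection of orientations that directs the cycles
  inconsistently, fewer orientations than forests are separated from all its members.

  Conversely, an outerplanar graph is a subgraph of a triangulated polygon, which is glued together
  from smaller ones along a triangle. For a polygon with distinguished side \<open>{v, u}\<close>, write
  \<open>I > J\<close> if the difference of \<open>I\<close> and \<open>J\<close> contains a directed path from \<open>v\<close> to \<open>u\<close>. On a separated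
  collection this is a strict partial order. A series composition turns it into the strict product;
  a new edge \<open>{v, u}\<close> cuts it along a maximal antichain, which is duplicated. Both
  operations preserve a partition into chains that meets every maximal antichain, with as many
  chains as there are forests that do not connect \<open>v\<close> and \<open>u\<close>.
\<close>

section \<open>Deletion and contraction\<close>

text \<open>Contraction creates loops and parallel elements, hence multigraphs with a fixed set of
  elements: contracting only relabels vertices. The size bound for a graph with one more element is
  the sum of the bounds for its deletion and its contraction, so a collection that reaches it must
  reach both of them; this is what carries purity to minors. For outerplanar graphs the obstacle is
  that purity alone is too weak for an induction. After adding a side, a maximal collection is made
  of two overlapping parts of an old one, and its size is the old size plus that of the overlap. The
  overlap can be any maximal antichain compatible with the collection, so these must all have one
  size, in a way that strict products inherit. Chains running from maximal to minimal elements
  ensure this: if a maximal antichain skipped a chain, some consecutive pair \<open>p > p'\<close>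
  on it would satisfy \<open>a > p'\<close> and \<open>p > b\<close> with \<open>a\<close>,
  \<open>b\<close> in the antichain, and the condition on consecutive pairs then gives
  \<open>a > b\<close>, a contradiction.\<close>

text \<open>A multigraph is a set \<open>A\<close> of elements with functions \<open>t\<close> and \<open>h\<close> giving their tail and head; an
  orientation is the set \<open>I \<subseteq> A\<close> of the elements that are traversed from tail to head. The arcs on
  which \<open>I\<close> and \<open>J\<close> differ, directed as in \<open>I\<close>, are \<open>darcs t h I J\<close>.\<close>

definition merge :: "'v \<Rightarrow> 'v \<Rightarrow> 'v \<Rightarrow> 'v" where
  "merge x y z = (if z = y then x else z)"

definition darcs :: "('b \<Rightarrow> 'v) \<Rightarrow> ('b \<Rightarrow> 'v) \<Rightarrow> 'b set \<Rightarrow> 'b set \<Rightarrow> ('v \<times> 'v) set" where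
  "darcs t h I J = (\<lambda>a. (t a, h a)) ` (I - J) \<union> (\<lambda>a. (h a, t a)) ` (J - I)"

abbreviation sep :: "('b \<Rightarrow> 'v) \<Rightarrow> ('b \<Rightarrow> 'v) \<Rightarrow> 'b set \<Rightarrow> 'b set \<Rightarrow> bool" where
  "sep t h I J \<equiv> acyclic (darcs t h I J)"

definition sepcoll :: "'b set \<Rightarrow> ('b \<Rightarrow> 'v) \<Rightarrow> ('b \<Rightarrow> 'v) \<Rightarrow> 'b set set \<Rightarrow> bool" where
  "sepcoll A t h S \<longleftrightarrow> S \<subseteq> Pow A \<and> (\<forall>I\<in>S. \<forall>J\<in>S. sep t h I J)"

text \<open>\<open>P\<close> and \<open>F - P\<close> differ on all of \<open>F\<close>, so
  \<open>darcs t h P (F - P)\<close> is \<open>F\<close> in the orientation given by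
  \<open>P\<close>: a forest is a set all of whose orientations are acyclic. The same facts on
  digraphs then serve for forests and for separation.\<close>

definition indep :: "('b \<Rightarrow> 'v) \<Rightarrow> ('b \<Rightarrow> 'v) \<Rightarrow> 'b set \<Rightarrow> bool" where
  "indep t h F \<longleftrightarrow> (\<forall>P\<subseteq>F. sep t h P (F - P))"

definition nind :: "'b set \<Rightarrow> ('b \<Rightarrow> 'v) \<Rightarrow> ('b \<Rightarrow> 'v) \<Rightarrow> nat" where
  "nind A t h = card {F. F \<subseteq> A \<and> indep t h F}"

definition mpure :: "'b set \<Rightarrow> ('b \<Rightarrow> 'v) \<Rightarrow> ('b \<Rightarrow> 'v) \<Rightarrow> bool" where
  "mpure A t h \<longleftrightarrow> (\<forall>S. maximal_by_inclusion (sepcoll A t h) S \<longrightarrow> card S = nind A t h)"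

lemma merge_same [simp]: "merge x x = id"
  by (auto simp: merge_def)

lemma map_prod_rtrancl: "(a, b) \<in> Q\<^sup>* \<Longrightarrow> (f a, f b) \<in> (map_prod f f ` Q)\<^sup>*"
  by (induction rule: rtrancl_induct) (force intro: rtrancl_into_rtrancl)+

lemma map_prod_trancl: "(a, b) \<in> Q\<^sup>+ \<Longrightarrow> (f a, f b) \<in> (map_prod f f ` Q)\<^sup>+"
  by (induction rule: trancl_induct) (force intro: trancl_into_trancl)+

lemma acyclic_map_prodD: "acyclic (map_prod f f ` Q) \<Longrightarrow> acyclic Q"
  unfolding acyclic_def using map_prod_trancl by fast

text \<open>A walk of the quotient lifts to a walk that may jump between \<open>x\<close> and
  \<open>y\<close>. Two jumps in the same direction shrink to one, two in opposite directions to
  none, so at most one jump remains.\<close>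

lemma merge_path_aux:
  assumes "(merge x y p, r) \<in> (map_prod (merge x y) (merge x y) ` Q)\<^sup>*" "merge x y q = r"
  shows "(p, q) \<in> Q\<^sup>* \<or> (p, x) \<in> Q\<^sup>* \<and> (y, q) \<in> Q\<^sup>* \<or> (p, y) \<in> Q\<^sup>* \<and> (x, q) \<in> Q\<^sup>*"
  using assms
proof (induction arbitrary: q rule: rtrancl_induct)
  case base
  then show ?case by (auto simp: merge_def split: if_splits)
next
  case (step r s)
  then obtain c d where cd: "(c, d) \<in> Q" "merge x y c = r" "merge x y d = s" by auto
  from step.IH[OF cd(2)] have
    IH: "(p, d) \<in> Q\<^sup>* \<or> (p, x) \<in> Q\<^sup>* \<and> (y, d) \<in> Q\<^sup>* \<or> (p, y) \<in> Q\<^sup>* \<and> (x, d) \<in> Q\<^sup>*"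
    using cd(1) by (meson rtrancl.rtrancl_into_rtrancl)
  have "q = d \<or> q = x \<and> d = y \<or> q = y \<and> d = x"
    using step.prems cd(3) by (auto simp: merge_def split: if_splits)
  then show ?case using IH by auto
qed

lemma merge_path:
  assumes "(merge x y p, merge x y q) \<in> (map_prod (merge x y) (merge x y) ` Q)\<^sup>*"
  shows "(p, q) \<in> Q\<^sup>* \<or> (p, x) \<in> Q\<^sup>* \<and> (y, q) \<in> Q\<^sup>* \<or> (p, y) \<in> Q\<^sup>* \<and> (x, q) \<in> Q\<^sup>*"
  using merge_path_aux[OF assms refl] .

text \<open>A cycle of the quotient lifts to a cycle, or to a path between \<open>x\<close> and
  \<open>y\<close> that one of the two arcs closes. Separation in a contraction thus means
  separation for both directions of the contracted element.\<close>

lemma acyclic_merge: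
  assumes "x \<noteq> y"
  shows "acyclic (map_prod (merge x y) (merge x y) ` Q) \<longleftrightarrow>
         acyclic (insert (x, y) Q) \<and> acyclic (insert (y, x) Q)"
proof
  let ?m = "merge x y"
  assume a: "acyclic (map_prod ?m ?m ` Q)"
  have "(x, y) \<notin> Q\<^sup>+" "(y, x) \<notin> Q\<^sup>+"
    using a map_prod_trancl[of x y Q ?m] map_prod_trancl[of y x Q ?m]
    by (auto simp: acyclic_def merge_def split: if_splits)
  then show "acyclic (insert (x, y) Q) \<and> acyclic (insert (y, x) Q)"
    using acyclic_map_prodD[OF a] assms by (auto simp: rtrancl_eq_or_trancl)
next
  let ?m = "merge x y"
  assume a: "acyclic (insert (x, y) Q) \<and> acyclic (insert (y, x) Q)"
  show "acyclic (map_prod ?m ?m ` Q)"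
  proof (rule ccontr)
    assume "\<not> acyclic (map_prod ?m ?m ` Q)"
    then obtain z where "(z, z) \<in> (map_prod ?m ?m ` Q)\<^sup>+" by (auto simp: acyclic_def)
    then obtain w where "(z, w) \<in> map_prod ?m ?m ` Q" "(w, z) \<in> (map_prod ?m ?m ` Q)\<^sup>*"
      by (meson tranclD)
    then obtain c d where cd: "(c, d) \<in> Q" "(?m d, ?m c) \<in> (map_prod ?m ?m ` Q)\<^sup>*" by auto
    from merge_path[OF cd(2)] show False
    proof (elim disjE conjE)
      assume "(d, c) \<in> Q\<^sup>*"
      then have "(d, d) \<in> Q\<^sup>+" using cd(1) by (meson rtrancl_into_trancl1)
      moreover have "acyclic Q" using a by simp
      ultimately show False by (auto simp: acyclic_def)
    next
      assume "(d, x) \<in> Q\<^sup>*" "(y, c) \<in> Q\<^sup>*"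
      then have "(y, x) \<in> Q\<^sup>*" using cd(1)
        by (meson rtrancl.rtrancl_into_rtrancl rtrancl_trans)
      then show False using a by auto
    next
      assume "(d, y) \<in> Q\<^sup>*" "(x, c) \<in> Q\<^sup>*"
      then have "(x, y) \<in> Q\<^sup>*" using cd(1)
        by (meson rtrancl.rtrancl_into_rtrancl rtrancl_trans)
      then show False using a by auto
    qed
  qed
qed

lemma darcs_comp: "darcs (m \<circ> t) (m \<circ> h) I J = map_prod m m ` darcs t h I J"
  by (auto simp: darcs_def image_Un image_image)

lemma darcs_converse: "darcs t h J I = (darcs t h I J)\<inverse>"
  by (auto simp: darcs_def)

lemma acyclic_darcs_sym: "sep t h I J \<longleftrightarrow> sep t h J I"
  by (metis acyclic_converse darcs_converse)

lemma darcs_self [simp]: "darcs t h I I = {}"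
  by (simp add: darcs_def)

lemma darcs_insert_both: "e \<notin> I \<Longrightarrow> e \<notin> J \<Longrightarrow>
    darcs t h (insert e I) (insert e J) = darcs t h I J"
  by (auto simp: darcs_def)

lemma darcs_insert_left: "e \<notin> I \<Longrightarrow> e \<notin> J \<Longrightarrow>
    darcs t h (insert e I) J = insert (t e, h e) (darcs t h I J)"
  by (auto simp: darcs_def)

lemma darcs_insert_right: "e \<notin> I \<Longrightarrow> e \<notin> J \<Longrightarrow>
    darcs t h I (insert e J) = insert (h e, t e) (darcs t h I J)"
  by (auto simp: darcs_def)

text \<open>Remove \<open>e\<close> from the members of \<open>S\<close> that contain it, and
  compare with the members that avoid it: \<open>del e S\<close> is the union of these two slices
  and \<open>con e S\<close> their intersection, so that the cardinalities add up.\<close>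

definition del :: "'b \<Rightarrow> 'b set set \<Rightarrow> 'b set set" where
  "del e S = {K. e \<notin> K \<and> (K \<in> S \<or> insert e K \<in> S)}"

definition con :: "'b \<Rightarrow> 'b set set \<Rightarrow> 'b set set" where
  "con e S = {K. e \<notin> K \<and> K \<in> S \<and> insert e K \<in> S}"

lemma card_del_con:
  assumes "finite S"
  shows "card S = card (del e S) + card (con e S)"
proof -
  let ?X = "{K. e \<notin> K \<and> K \<in> S}" and ?Y = "{K. e \<notin> K \<and> insert e K \<in> S}"
  have eqS: "S = ?X \<union> insert e ` ?Y"
  proof (intro equalityI subsetI)
    fix K assume K: "K \<in> S"
    show "K \<in> ?X \<union> insert e ` ?Y"
    proof (cases "e \<in> K")
      case True
      then have "K = insert e (K - {e})" by auto
      moreover have "K - {e} \<in> ?Y" using K True by (simp add: insert_absorb)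
      ultimately show ?thesis by blast
    qed (use K in auto)
  qed auto
  have inj: "inj_on (insert e) ?Y" by (auto intro!: inj_onI dest: insert_ident)
  have fX: "finite ?X" using assms by auto
  have fY: "finite ?Y"
    using inj by (rule inj_on_finite[where B = S]) (use assms in auto)
  have "card S = card ?X + card (insert e ` ?Y)"
    by (subst eqS, rule card_Un_disjoint) (use fX fY in auto)
  also have "\<dots> = card ?X + card ?Y" using inj by (simp add: card_image)
  also have "\<dots> = card (?X \<union> ?Y) + card (?X \<inter> ?Y)" using fX fY by (rule card_Un_Int)
  also have "?X \<union> ?Y = del e S" by (auto simp: del_def)
  also have "?X \<inter> ?Y = con e S" by (auto simp: con_def)
  finally show ?thesis .
qed

lemma sepcoll_finite: "finite A \<Longrightarrow> sepcoll A t h S \<Longrightarrow> finite S"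
  by (auto simp: sepcoll_def intro: finite_subset)

lemma sepcoll_mono: "sepcoll A t h S \<Longrightarrow> A \<subseteq> B \<Longrightarrow> sepcoll B t h S"
  by (auto simp: sepcoll_def)

lemma sepcoll_extend:
  assumes "finite A" "sepcoll A t h S"
  obtains T where "S \<subseteq> T" "maximal_by_inclusion (sepcoll A t h) T"
proof -
  have "finite {T. sepcoll A t h T \<and> S \<subseteq> T}"
    by (rule finite_subset[where B = "Pow (Pow A)"]) (use assms in \<open>auto simp: sepcoll_def\<close>)
  from finite_has_maximal2[OF this, of S] assms(2)
  obtain T where T: "sepcoll A t h T" "S \<subseteq> T"
    and max: "\<And>U. sepcoll A t h U \<Longrightarrow> S \<subseteq> U \<Longrightarrow> T \<subseteq> U \<Longrightarrow> T = U"
    by auto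
  have "maximal_by_inclusion (sepcoll A t h) T"
    unfolding maximal_by_inclusion_def using T max by (metis order_trans)
  with T(2) show ?thesis by (rule that)
qed

lemma maximal_sepcollI:
  assumes "sepcoll A t h S"
    and "\<And>K. K \<subseteq> A \<Longrightarrow> (\<And>I. I \<in> S \<Longrightarrow> sep t h K I) \<Longrightarrow> K \<in> S"
  shows "maximal_by_inclusion (sepcoll A t h) S"
  unfolding maximal_by_inclusion_def
proof (intro conjI allI impI assms(1))
  fix T assume T: "sepcoll A t h T \<and> S \<subseteq> T"
  have "K \<in> S" if "K \<in> T" for K
    by (rule assms(2)) (use T that in \<open>auto simp: sepcoll_def\<close>)
  then show "T = S" using T by auto
qed

lemma maximal_sepcollD:
  assumes "maximal_by_inclusion (sepcoll A t h) S" "K \<subseteq> A"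
    and "\<And>I. I \<in> S \<Longrightarrow> sep t h K I"
  shows "K \<in> S"
proof -
  have "sepcoll A t h (insert K S)"
    using assms acyclic_darcs_sym[of t h K]
    by (auto simp: sepcoll_def maximal_by_inclusion_def acyclic_def[of "{}"])
  then show ?thesis using assms(1) by (auto simp: maximal_by_inclusion_def)
qed

lemma sepcoll_del:
  assumes "sepcoll (insert e A) t h S"
  shows "sepcoll A t h (del e S)"
proof -
  have "sep t h K L" if "K \<in> del e S" "L \<in> del e S" for K L
  proof -
    have "\<exists>K'\<in>S. K = K' - {e}" if "K \<in> del e S" for K
      using that by (auto simp: del_def)
    with that obtain K' L' where *: "K' \<in> S" "L' \<in> S" "K = K' - {e}" "L = L' - {e}"
      by metis
    then have "darcs t h K L \<subseteq> darcs t h K' L'" by (auto simp: darcs_def)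
    moreover have "sep t h K' L'" using * assms by (auto simp: sepcoll_def)
    ultimately show ?thesis by (meson acyclic_subset)
  qed
  then show ?thesis using assms by (auto simp: sepcoll_def del_def)
qed

lemma sepcoll_con:
  assumes "sepcoll (insert e A) t h S" "t e \<noteq> h e"
  shows "sepcoll A (merge (t e) (h e) \<circ> t) (merge (t e) (h e) \<circ> h) (con e S)"
proof -
  have "sep (merge (t e) (h e) \<circ> t) (merge (t e) (h e) \<circ> h) K L"
    if "K \<in> con e S" "L \<in> con e S" for K L
    unfolding darcs_comp acyclic_merge[OF assms(2)]
    using that assms(1)
    by (auto simp: sepcoll_def con_def simp flip: darcs_insert_left darcs_insert_right
        simp del: acyclic_insert)
  then show ?thesis using assms by (auto simp: sepcoll_def con_def)
qed

lemma con_loop: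
  assumes "sepcoll (insert e A) t h S" "t e = h e"
  shows "con e S = {}"
proof -
  have False if "K \<in> con e S" for K
  proof -
    have "sep t h (insert e K) K" using that assms by (auto simp: sepcoll_def con_def)
    then show False using that assms(2) by (auto simp: con_def darcs_insert_left)
  qed
  then show ?thesis by blast
qed

lemma indep_mono: "indep t h F \<Longrightarrow> G \<subseteq> F \<Longrightarrow> indep t h G"
  unfolding indep_def
proof (intro allI impI)
  fix P assume a: "\<forall>P\<subseteq>F. sep t h P (F - P)" "G \<subseteq> F" "P \<subseteq> G"
  then have "sep t h P (F - P)" by auto
  moreover have "darcs t h P (G - P) \<subseteq> darcs t h P (F - P)" using a by (auto simp: darcs_def)
  ultimately show "sep t h P (G - P)" by (meson acyclic_subset)
qed

lemma indep_insert:
  assumes "e \<notin> F"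
  shows "indep t h (insert e F) \<longleftrightarrow>
    t e \<noteq> h e \<and> indep (merge (t e) (h e) \<circ> t) (merge (t e) (h e) \<circ> h) F"
proof -
  have split: "(\<forall>P\<subseteq>insert e F. Q P) \<longleftrightarrow> (\<forall>P\<subseteq>F. Q P \<and> Q (insert e P))" for Q
  proof safe
    fix P assume *: "\<forall>P\<subseteq>F. Q P \<and> Q (insert e P)" "P \<subseteq> insert e F"
    show "Q P"
    proof (cases "e \<in> P")
      case True
      then have "P = insert e (P - {e})" by auto
      then show ?thesis using * by (metis Diff_subset_conv insert_is_Un)
    qed (use * in auto)
  qed (use insert_mono in blast)+
  have "indep t h (insert e F) \<longleftrightarrow> (\<forall>P\<subseteq>F. acyclic (insert (t e, h e) (darcs t h P (F - P))) \<and>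
    acyclic (insert (h e, t e) (darcs t h P (F - P))))"
    unfolding indep_def split
  proof (intro all_cong1 imp_cong refl)
    fix P assume P: "P \<subseteq> F"
    have 1: "insert e F - P = insert e (F - P)" and 2: "insert e F - insert e P = F - P"
      using P assms by auto
    have 3: "e \<notin> P" "e \<notin> F - P" using P assms by auto
    show "(sep t h P (insert e F - P) \<and>
          sep t h (insert e P) (insert e F - insert e P)) =
         (acyclic (insert (t e, h e) (darcs t h P (F - P))) \<and>
          acyclic (insert (h e, t e) (darcs t h P (F - P))))"
      unfolding 1 2 darcs_insert_left[OF 3] darcs_insert_right[OF 3] by blast
  qed
  also have "\<dots> \<longleftrightarrow> t e \<noteq> h e \<and> indep (merge (t e) (h e) \<circ> t) (merge (t e) (h e) \<circ> h) F"
  proof (cases "t e = h e")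
    case False
    then show ?thesis unfolding indep_def darcs_comp acyclic_merge[OF False] by blast
  qed auto
  finally show ?thesis .
qed

lemma nind_split:
  assumes "finite A" "e \<notin> A"
  shows "nind (insert e A) t h = nind A t h + card {F. F \<subseteq> A \<and> indep t h (insert e F)}"
proof -
  let ?S = "{F. F \<subseteq> insert e A \<and> indep t h F}"
  have "?S \<subseteq> Pow (insert e A)" by auto
  then have fin: "finite ?S" using assms finite_subset by fastforce
  have d: "del e ?S = {F. F \<subseteq> A \<and> indep t h F}"
    using assms indep_mono[of t h] by (auto simp: del_def)
  have c: "con e ?S = {F. F \<subseteq> A \<and> indep t h (insert e F)}"
    using assms indep_mono[of t h] by (auto simp: con_def)
  show ?thesis using card_del_con[OF fin, of e] unfolding nind_def d c .
qed

text \<open>The recursion of the Tutte polynomial at the point (2, 1), where it counts forests. The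
  bound \<open>card_sepcoll_le\<close> follows the same recursion.\<close>

lemma nind_insert:
  assumes "finite A" "e \<notin> A" "t e \<noteq> h e"
  shows "nind (insert e A) t h =
    nind A t h + nind A (merge (t e) (h e) \<circ> t) (merge (t e) (h e) \<circ> h)"
proof -
  have "{F. F \<subseteq> A \<and> indep t h (insert e F)} =
        {F. F \<subseteq> A \<and> indep (merge (t e) (h e) \<circ> t) (merge (t e) (h e) \<circ> h) F}"
    using assms indep_insert[of e _ t h] by auto
  then show ?thesis using nind_split[OF assms(1,2), of t h] by (simp add: nind_def)
qed

lemma nind_insert_loop:
  assumes "finite A" "e \<notin> A" "t e = h e"
  shows "nind (insert e A) t h = nind A t h"
proof -
  have "{F. F \<subseteq> A \<and> indep t h (insert e F)} = {}"
    using assms indep_insert[of e _ t h] by auto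
  then show ?thesis unfolding nind_split[OF assms(1,2)] by (simp only: card.empty)
qed

lemma nind_empty [simp]: "nind {} t h = 1"
proof -
  have "{F. F \<subseteq> {} \<and> indep t h F} = {{}}" by (auto simp: indep_def acyclic_def)
  then show ?thesis by (simp add: nind_def)
qed

lemma card_sepcoll_le:
  assumes "finite A" "sepcoll A t h S"
  shows "card S \<le> nind A t h"
  using assms
proof (induction A arbitrary: t h S rule: finite_induct)
  case empty
  then have "S \<subseteq> {{}}" by (auto simp: sepcoll_def)
  then show ?case using card_mono[of "{{}}" S] by simp
next
  case (insert e A)
  note fin = sepcoll_finite[OF _ insert.prems]
  have *: "card S = card (del e S) + card (con e S)"
    using fin insert.hyps by (intro card_del_con) auto
  have d: "card (del e S) \<le> nind A t h"
    by (rule insert.IH) (rule sepcoll_del[OF insert.prems])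
  show ?case
  proof (cases "t e = h e")
    case True
    then show ?thesis using * d con_loop[OF insert.prems True] insert.hyps
      by (simp add: nind_insert_loop)
  next
    case False
    have "card (con e S) \<le> nind A (merge (t e) (h e) \<circ> t) (merge (t e) (h e) \<circ> h)"
      by (rule insert.IH) (rule sepcoll_con[OF insert.prems False])
    then show ?thesis using * d False insert.hyps by (simp add: nind_insert)
  qed
qed

text \<open>A maximal collection \<open>S\<close> of the smaller graph extends to a maximal
  \<open>T\<close>, and \<open>del e T\<close> equals \<open>S\<close> by maximality. By purity,
  \<open>card T\<close> is the sum of the bounds for \<open>del e T\<close> and
  \<open>con e T\<close>, so both are attained.\<close>

lemma mpure_delete:
  assumes "finite A" "e \<notin> A" "mpure (insert e A) t h"
  shows "mpure A t h"
  unfolding mpure_def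
proof (intro allI impI)
  fix S assume S: "maximal_by_inclusion (sepcoll A t h) S"
  then have sS: "sepcoll A t h S" by (simp add: maximal_by_inclusion_def)
  then have "sepcoll (insert e A) t h S" by (rule sepcoll_mono) auto
  then obtain T where T: "S \<subseteq> T" "maximal_by_inclusion (sepcoll (insert e A) t h) T"
    using assms(1) by (metis finite_insert sepcoll_extend)
  then have sT: "sepcoll (insert e A) t h T" by (simp add: maximal_by_inclusion_def)
  have finT: "finite T" using sT assms(1) by (metis finite_insert sepcoll_finite)
  have cT: "nind (insert e A) t h = card (del e T) + card (con e T)"
    using assms(3) T(2) card_del_con[OF finT, of e] by (simp add: mpure_def)
  have "S \<subseteq> del e T" using T(1) sS assms(2) by (auto simp: del_def sepcoll_def)
  then have "del e T = S" using S sepcoll_del[OF sT] by (auto simp: maximal_by_inclusion_def)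
  moreover have "card (del e T) = nind A t h"
  proof (cases "t e = h e")
    case True
    then show ?thesis using cT con_loop[OF sT True] assms by (simp add: nind_insert_loop)
  next
    case False
    then show ?thesis
      using cT card_sepcoll_le[OF assms(1) sepcoll_con[OF sT False]]
        card_sepcoll_le[OF assms(1) sepcoll_del[OF sT]] assms by (simp add: nind_insert)
  qed
  ultimately show "card S = nind A t h" by simp
qed

text \<open>As for deletion, but \<open>S\<close> is extended together with its copies containing
  \<open>e\<close>, so that \<open>con e T\<close> contains \<open>S\<close>.\<close>

lemma mpure_contract:
  assumes "finite A" "e \<notin> A" "mpure (insert e A) t h"
  shows "mpure A (merge (t e) (h e) \<circ> t) (merge (t e) (h e) \<circ> h)" (is "mpure A ?t ?h")
proof (cases "t e = h e")
  case True
  then show ?thesis using mpure_delete[OF assms] by simp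
next
  case False
  show ?thesis unfolding mpure_def
  proof (intro allI impI)
    fix S assume S: "maximal_by_inclusion (sepcoll A ?t ?h) S"
    then have sS: "sepcoll A ?t ?h S" by (simp add: maximal_by_inclusion_def)
    have eK: "e \<notin> K" if "K \<in> S" for K using sS that assms(2) by (auto simp: sepcoll_def)
    have ac: "acyclic (insert (t e, h e) (darcs t h K L)) \<and> acyclic (insert (h e, t e) (darcs t h K L))"
      if "K \<in> S" "L \<in> S" for K L
      using sS that unfolding sepcoll_def darcs_comp acyclic_merge[OF False] by blast
    have "sep t h I J" if "I \<in> S \<union> insert e ` S" "J \<in> S \<union> insert e ` S" for I J
      using that ac eK by (auto simp: darcs_insert_left darcs_insert_right darcs_insert_both)
    then have "sepcoll (insert e A) t h (S \<union> insert e ` S)"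
      using sS by (auto simp: sepcoll_def)
    then obtain T where T: "S \<union> insert e ` S \<subseteq> T"
        "maximal_by_inclusion (sepcoll (insert e A) t h) T"
      using assms(1) by (metis finite_insert sepcoll_extend)
    then have sT: "sepcoll (insert e A) t h T" by (simp add: maximal_by_inclusion_def)
    have finT: "finite T" using sT assms(1) by (metis finite_insert sepcoll_finite)
    have cT: "nind (insert e A) t h = card (del e T) + card (con e T)"
      using assms(3) T(2) card_del_con[OF finT, of e] by (simp add: mpure_def)
    have "S \<subseteq> con e T" using T(1) eK by (auto simp: con_def)
    then have "con e T = S" using S sepcoll_con[OF sT False] by (auto simp: maximal_by_inclusion_def)
    then show "card S = nind A ?t ?h"
      using cT card_sepcoll_le[OF assms(1) sepcoll_con[OF sT False]]
        card_sepcoll_le[OF assms(1) sepcoll_del[OF sT]] assms False by (simp add: nind_insert)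
  qed
qed

lemma mpure_subset:
  assumes "finite B" "mpure B t h" "A \<subseteq> B"
  shows "mpure A t h"
proof -
  have "mpure (B - C) t h" if "finite C" for C
    using that
  proof (induction C)
    case (insert c C)
    show ?case
    proof (cases "c \<in> B - C")
      case True
      then have "B - C = insert c (B - insert c C)" by auto
      then have "mpure (insert c (B - insert c C)) t h" using insert.IH by simp
      then show ?thesis by (rule mpure_delete[rotated -1]) (use assms(1) in auto)
    next
      case False
      then have "B - insert c C = B - C" by auto
      then show ?thesis using insert.IH by simp
    qed
  qed (use assms in simp)
  moreover have "A = B - (B - A)" using assms(3) by auto
  ultimately show ?thesis using assms(1) by (metis finite_Diff)
qed

section \<open>Collections of maximum size\<close>

text \<open>The orientations in which no cycle is directed along the forward direction of its
  largest element form a separated collection of maximum size.\<close>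

definition lexcoll :: "('b \<Rightarrow> nat) \<Rightarrow> 'b set \<Rightarrow> ('b \<Rightarrow> 'v) \<Rightarrow> ('b \<Rightarrow> 'v) \<Rightarrow> 'b set set" where
  "lexcoll f A t h = {I. I \<subseteq> A \<and> (\<forall>a\<in>I. (h a, t a) \<notin>
     (darcs t h (I \<inter> {b\<in>A. f b < f a}) ({b\<in>A. f b < f a} - I))\<^sup>*)}"

lemma merge_path_iff:
  "(merge x y p, merge x y q) \<in> (map_prod (merge x y) (merge x y) ` Q)\<^sup>* \<longleftrightarrow>
   (p, q) \<in> (insert (x, y) Q)\<^sup>* \<or> (p, q) \<in> (insert (y, x) Q)\<^sup>*"
proof
  let ?m = "merge x y"
  have xy: "?m x = ?m y" by (simp add: merge_def)
  assume "(p, q) \<in> (insert (x, y) Q)\<^sup>* \<or> (p, q) \<in> (insert (y, x) Q)\<^sup>*"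
  then consider "(p, q) \<in> Q\<^sup>*" | "(p, x) \<in> Q\<^sup>*" "(y, q) \<in> Q\<^sup>*" | "(p, y) \<in> Q\<^sup>*" "(x, q) \<in> Q\<^sup>*"
    by (auto simp: rtrancl_insert)
  then show "(?m p, ?m q) \<in> (map_prod ?m ?m ` Q)\<^sup>*"
    by cases (use map_prod_rtrancl[of _ _ Q ?m] xy in \<open>metis rtrancl_trans\<close>)+
qed (auto dest!: merge_path simp: rtrancl_insert)

lemma darcs_subset:
  "I - J \<subseteq> I' - J' \<Longrightarrow> J - I \<subseteq> J' - I' \<Longrightarrow> darcs t h I J \<subseteq> darcs t h I' J'"
  unfolding darcs_def by blast

text \<open>The induction removes the smallest element \<open>e\<close>. It contributes one arc to
  the condition of every other element, while its own condition only says that it is not a loop. So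
  \<open>del\<close> and \<open>con\<close> of the collection are the collections of the deletion
  and of the contraction.\<close>

lemma card_lexcoll:
  assumes "finite A" "inj_on f A"
  shows "card (lexcoll f A t h) = nind A t h"
  using assms
proof (induction "card A" arbitrary: A t h)
  case 0
  then have "lexcoll f A t h = {{}}" by (auto simp: lexcoll_def)
  then show ?case using 0 by simp
next
  case (Suc n)
  then have "A \<noteq> {}" by auto
  then obtain e where e: "e \<in> A" "\<And>a. a \<in> A \<Longrightarrow> f e \<le> f a"
    using Suc.prems(1) ex_min_if_finite[of "f ` A"] by (metis (no_types, lifting) image_iff
        finite_imageI image_is_empty linorder_not_less)
  define B where "B = A - {e}"
  have A: "A = insert e B" "e \<notin> B" "finite B" "inj_on f B" "n = card B"
    using e Suc by (auto simp: B_def insert_absorb inj_on_diff)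
  have fe: "f e < f a" if "a \<in> B" for a
    using that e Suc.prems(2) unfolding B_def by (metis DiffD1 DiffD2 inj_onD
        insertI1 le_neq_implies_less)
  define Q where "Q K a = darcs t h (K \<inter> {b\<in>B. f b < f a}) ({b\<in>B. f b < f a} - K)" for K a
  have low: "{b \<in> insert e B. f b < f a} = insert e {b\<in>B. f b < f a}" if "a \<in> B" for a
    using fe[OF that] by auto
  have lowe: "{b \<in> insert e B. f b < f e} = {}" using fe by force
  have mono: "Q K a \<subseteq> Q K b" if "f a < f b" for K a b
    unfolding Q_def using that by (intro darcs_subset) auto
  have mB: "K \<in> lexcoll f B t h \<longleftrightarrow> (\<forall>a\<in>K. (h a, t a) \<notin> (Q K a)\<^sup>*)" if "K \<subseteq> B" for K
    using that by (auto simp: lexcoll_def Q_def)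
  have mM: "K \<in> lexcoll f B (m \<circ> t) (m \<circ> h) \<longleftrightarrow>
      (\<forall>a\<in>K. (m (h a), m (t a)) \<notin> (map_prod m m ` Q K a)\<^sup>*)" if "K \<subseteq> B" for K m
    using that by (auto simp: lexcoll_def Q_def darcs_comp)
  have m1: "K \<in> lexcoll f A t h \<longleftrightarrow> (\<forall>a\<in>K. (h a, t a) \<notin> (insert (h e, t e) (Q K a))\<^sup>*)"
    if K: "K \<subseteq> B" for K
  proof -
    have "darcs t h (K \<inter> {b\<in>A. f b < f a}) ({b\<in>A. f b < f a} - K) = insert (h e, t e) (Q K a)"
      if "a \<in> K" for a
    proof -
      have "K \<inter> {b\<in>A. f b < f a} = K \<inter> {b\<in>B. f b < f a}"
        "{b\<in>A. f b < f a} - K = insert e ({b\<in>B. f b < f a} - K)"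
        using low[of a] K that A(1,2) by auto
      then show ?thesis using A(2) K by (simp add: Q_def darcs_insert_right)
    qed
    then show ?thesis using K A(1) by (auto simp: lexcoll_def)
  qed
  have m2: "insert e K \<in> lexcoll f A t h \<longleftrightarrow> t e \<noteq> h e \<and>
      (\<forall>a\<in>K. (h a, t a) \<notin> (insert (t e, h e) (Q K a))\<^sup>*)"
    if K: "K \<subseteq> B" for K
  proof -
    have "darcs t h (insert e K \<inter> {b\<in>A. f b < f a}) ({b\<in>A. f b < f a} - insert e K) =
        insert (t e, h e) (Q K a)" if "a \<in> K" for a
    proof -
      have "insert e K \<inter> {b\<in>A. f b < f a} = insert e (K \<inter> {b\<in>B. f b < f a})"
        "{b\<in>A. f b < f a} - insert e K = {b\<in>B. f b < f a} - K"
        using low[of a] K that A(1,2) by auto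
      then show ?thesis using A(2) K by (simp add: Q_def darcs_insert_left)
    qed
    moreover have "darcs t h (insert e K \<inter> {b\<in>A. f b < f e}) ({b\<in>A. f b < f e} - insert e K) = {}"
      unfolding lowe[folded A(1)] by (simp add: darcs_def)
    ultimately show ?thesis using K A(1) by (auto simp: lexcoll_def)
  qed
  have sub: "K \<subseteq> B" if "K \<in> lexcoll f A t h \<or> insert e K \<in> lexcoll f A t h" "e \<notin> K" for K
    using that A by (auto simp: lexcoll_def)
  \<comment> \<open>If neither direction of \<open>e\<close> is admissible, there are two forbidden
    cycles through \<open>e\<close> in opposite directions, with largest elements \<open>a\<close>
    and \<open>b\<close>. Joined without \<open>e\<close> they yield a forbidden cycle whose largest
    element is the later of the two.\<close>
  have key: "K \<in> lexcoll f A t h \<or> insert e K \<in> lexcoll f A t h"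
    if K: "K \<subseteq> B" "K \<in> lexcoll f B t h" for K
  proof (rule ccontr)
    assume neg: "\<not> ?thesis"
    have g: "(h a, t a) \<notin> (Q K a)\<^sup>*" if "a \<in> K" for a using K mB that by blast
    from neg obtain a where a: "a \<in> K" "(h a, t a) \<in> (insert (h e, t e) (Q K a))\<^sup>*"
      using m1[OF K(1)] by blast
    have a': "(h a, h e) \<in> (Q K a)\<^sup>*" "(t e, t a) \<in> (Q K a)\<^sup>*"
      using a(2) g[OF a(1)] by (auto simp: rtrancl_insert)
    then have "t e \<noteq> h e" using g[OF a(1)] by (metis rtrancl_trans)
    then obtain b where b: "b \<in> K" "(h b, t b) \<in> (insert (t e, h e) (Q K b))\<^sup>*"
      using m2[OF K(1)] neg by blast
    have b': "(h b, t e) \<in> (Q K b)\<^sup>*" "(h e, t b) \<in> (Q K b)\<^sup>*"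
      using b(2) g[OF b(1)] by (auto simp: rtrancl_insert)
    have arc: "(t x, h x) \<in> Q K y" if "x \<in> K" "f x < f y" for x y
      using that K(1) by (force simp: Q_def darcs_def)
    consider "f a < f b" | "f b < f a" | "a = b"
      using a(1) b(1) K(1) A(4) by (metis inj_onD linorder_neqE_nat subsetD)
    then show False
    proof cases
      case 1
      then have "(t e, t a) \<in> (Q K b)\<^sup>*" "(h a, h e) \<in> (Q K b)\<^sup>*"
        using a' mono[OF 1, of K] by (meson rtrancl_mono subsetD)+
      then show False using b' arc[OF a(1) 1] g[OF b(1)]
        by (meson rtrancl.rtrancl_into_rtrancl rtrancl_trans)
    next
      case 2
      then have "(h b, t e) \<in> (Q K a)\<^sup>*" "(h e, t b) \<in> (Q K a)\<^sup>*"
        using b' mono[OF 2, of K] by (meson rtrancl_mono subsetD)+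
      then show False using a' arc[OF b(1) 2] g[OF a(1)]
        by (meson rtrancl.rtrancl_into_rtrancl rtrancl_trans)
    next
      case 3
      then show False using a' b' g[OF a(1)] by (meson rtrancl_trans)
    qed
  qed
  have mono_ins: "(p, q) \<in> R\<^sup>* \<Longrightarrow> (p, q) \<in> (insert x R)\<^sup>*" for p q x and R :: "('c \<times> 'c) set"
    by (meson rtrancl_mono subsetD subset_insertI)
  have d: "del e (lexcoll f A t h) = lexcoll f B t h"
  proof (intro equalityI subsetI)
    fix K assume K: "K \<in> del e (lexcoll f A t h)"
    then have KB: "K \<subseteq> B" using sub by (auto simp: del_def)
    show "K \<in> lexcoll f B t h"
      unfolding mB[OF KB]
    proof (intro ballI notI)
      fix a assume a: "a \<in> K" "(h a, t a) \<in> (Q K a)\<^sup>*"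
      have "K \<notin> lexcoll f A t h" "insert e K \<notin> lexcoll f A t h"
        unfolding m1[OF KB] m2[OF KB] using a mono_ins[OF a(2)] by blast+
      then show False using K by (simp add: del_def)
    qed
  next
    fix K assume K: "K \<in> lexcoll f B t h"
    then have "K \<subseteq> B" by (simp add: lexcoll_def)
    then show "K \<in> del e (lexcoll f A t h)" using K key A(2) by (auto simp: del_def)
  qed
  have fin: "finite (lexcoll f A t h)"
    by (rule finite_subset[where B = "Pow A"]) (use Suc.prems in \<open>auto simp: lexcoll_def\<close>)
  have c0: "card (lexcoll f A t h) = nind B t h + card (con e (lexcoll f A t h))"
    using card_del_con[OF fin, of e] d Suc.hyps(1)[OF A(5,3,4)] by simp
  show ?case
  proof (cases "t e = h e")
    case True
    then have "con e (lexcoll f A t h) = {}" using m2 sub by (auto simp: con_def)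
    then show ?thesis using c0 A True by (simp add: nind_insert_loop)
  next
    case False
    let ?m = "merge (t e) (h e)"
    have "con e (lexcoll f A t h) = lexcoll f B (?m \<circ> t) (?m \<circ> h)"
    proof (intro equalityI subsetI)
      fix K assume K: "K \<in> con e (lexcoll f A t h)"
      then have KB: "K \<subseteq> B" using sub by (auto simp: con_def)
      show "K \<in> lexcoll f B (?m \<circ> t) (?m \<circ> h)"
        using K unfolding mM[OF KB] merge_path_iff by (simp add: con_def m1[OF KB] m2[OF KB])
    next
      fix K assume K: "K \<in> lexcoll f B (?m \<circ> t) (?m \<circ> h)"
      then have KB: "K \<subseteq> B" by (simp add: lexcoll_def)
      show "K \<in> con e (lexcoll f A t h)"
        using K A(2) KB False unfolding mM[OF KB] merge_path_iff
        by (auto simp add: con_def m1[OF KB] m2[OF KB])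
    qed
    then show ?thesis using c0 A False Suc.hyps(1)[OF A(5,3,4)] by (simp add: nind_insert)
  qed
qed

text \<open>On a cycle in the difference of \<open>I\<close> and \<open>J\<close>, the largest
  element is traversed forward by one of the two orientations, which its condition forbids. The
  induction adds the elements in increasing order.\<close>

lemma sepcoll_lexcoll:
  assumes "inj_on f A" "finite A"
  shows "sepcoll A t h (lexcoll f A t h)"
proof -
  have "sep t h I J" if I: "I \<in> lexcoll f A t h" and J: "J \<in> lexcoll f A t h" for I J
  proof -
    define B where "B n = {b\<in>A. f b < n}" for n
    have step: "sep t h (K \<inter> insert a (B (f a))) (L \<inter> insert a (B (f a)))"
      if "K \<in> lexcoll f A t h" "a \<in> K - L" "sep t h (K \<inter> B (f a)) (L \<inter> B (f a))"
      for K L a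
    proof -
      have "K \<inter> insert a (B (f a)) = insert a (K \<inter> B (f a))" "L \<inter> insert a (B (f a)) = L \<inter> B (f a)"
        using that(2) by auto
      moreover have "a \<notin> B (f a)" by (simp add: B_def)
      moreover have "(h a, t a) \<notin> (darcs t h (K \<inter> B (f a)) (L \<inter> B (f a)))\<^sup>*"
      proof -
        have "(h a, t a) \<notin> (darcs t h (K \<inter> B (f a)) (B (f a) - K))\<^sup>*"
          using that by (simp add: lexcoll_def B_def)
        moreover have "darcs t h (K \<inter> B (f a)) (L \<inter> B (f a)) \<subseteq> darcs t h (K \<inter> B (f a)) (B (f a) - K)"
          by (rule darcs_subset) auto
        ultimately show ?thesis by (meson rtrancl_mono subsetD)
      qed
      ultimately show ?thesis using that(3) by (auto simp: darcs_insert_left)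
    qed
    have "sep t h (I \<inter> B n) (J \<inter> B n)" for n
    proof (induction n)
      case 0
      then show ?case by (simp add: B_def acyclic_def)
    next
      case (Suc n)
      show ?case
      proof (cases "\<exists>a\<in>A. f a = n")
        case False
        then have "B (Suc n) = B n" using less_Suc_eq by (auto simp: B_def)
        then show ?thesis using Suc by simp
      next
        case True
        then obtain a where a: "a \<in> A" "f a = n" by blast
        have B: "B (Suc n) = insert a (B n)"
          using a assms(1) by (auto simp: B_def less_Suc_eq inj_on_def)
        consider "a \<in> I - J" | "a \<in> J - I" | "a \<in> I \<and> a \<in> J" | "a \<notin> I \<and> a \<notin> J" by blast
        then show ?thesis
        proof cases
          case 1
          then show ?thesis using step[OF I 1] Suc a B by simp
        next
          case 2
          then show ?thesis using step[OF J 2] Suc a B acyclic_darcs_sym by metis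
        next
          case 3
          then have "a \<notin> I \<inter> B n" "a \<notin> J \<inter> B n" using a by (auto simp: B_def)
          then show ?thesis using Suc 3 unfolding B by (simp add: darcs_insert_both)
        next
          case 4
          then show ?thesis using Suc unfolding B by simp
        qed
      qed
    qed
    from this[of "Suc (Max (f ` A))"]
    have "sep t h (I \<inter> B (Suc (Max (f ` A)))) (J \<inter> B (Suc (Max (f ` A))))" .
    moreover have "B (Suc (Max (f ` A))) = A" using assms(2) by (auto simp: B_def less_Suc_eq_le)
    ultimately show ?thesis using I J by (simp add: lexcoll_def Int_absorb2)
  qed
  then show ?thesis by (auto simp: sepcoll_def) (auto simp: lexcoll_def)
qed

text \<open>\<open>OM_pure\<close> compares with the largest separated collection,
  \<open>graph_pure\<close> with the number of forests. The two numbers agree because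
  \<open>lexcoll\<close> reaches the upper bound.\<close>

lemma max_card_sepcoll:
  assumes "finite A"
  shows "Max (card ` {T. sepcoll A t h T}) = nind A t h"
proof (rule Max_eqI)
  have "{T. sepcoll A t h T} \<subseteq> Pow (Pow A)" by (auto simp: sepcoll_def)
  then show "finite (card ` {T. sepcoll A t h T})"
    using assms by (meson finite_Pow_iff finite_imageI finite_subset)
  show "y \<le> nind A t h" if "y \<in> card ` {T. sepcoll A t h T}" for y
    using that card_sepcoll_le[OF assms] by auto
  obtain f :: "_ \<Rightarrow> nat" where "inj_on f A" using finite_imp_inj_to_nat_seg[OF assms] by blast
  then show "nind A t h \<in> card ` {T. sepcoll A t h T}"
    using assms card_lexcoll sepcoll_lexcoll by (metis imageI mem_Collect_eq)
qed

section \<open>Chain partitions\<close>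

text \<open>The condition on consecutive pairs makes cuts of \<open>P\<close> and strict products of relations inherit
  a partition into chains; see \<open>good_cover_cut\<close> and \<open>good_cover_prod\<close>.\<close>

definition good_cover :: "'p set \<Rightarrow> ('p \<Rightarrow> 'p \<Rightarrow> bool) \<Rightarrow> ('p \<times> 'p) set \<Rightarrow> bool" where
  "good_cover P R N \<longleftrightarrow> N \<subseteq> P \<times> P \<and> single_valued N \<and> single_valued (N\<inverse>) \<and>
     (\<forall>p p'. (p, p') \<in> N \<longrightarrow> R p p' \<and> (\<forall>a\<in>P. \<forall>b\<in>P. R a p' \<longrightarrow> R p b \<longrightarrow> R a b)) \<and>
     (\<forall>p\<in>P. p \<notin> Range N \<longrightarrow> (\<forall>a\<in>P. \<not> R a p)) \<and>
     (\<forall>p\<in>P. p \<notin> Domain N \<longrightarrow> (\<forall>b\<in>P. \<not> R p b))"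

lemma good_coverD:
  assumes "good_cover P R N"
  shows "(p, p') \<in> N \<Longrightarrow> p \<in> P" "(p, p') \<in> N \<Longrightarrow> p' \<in> P"
    "(p, p') \<in> N \<Longrightarrow> R p p'"
    "(p, p') \<in> N \<Longrightarrow> (q, p') \<in> N \<Longrightarrow> p = q" "(p, p') \<in> N \<Longrightarrow> (p, q') \<in> N \<Longrightarrow> p' = q'"
    "(p, p') \<in> N \<Longrightarrow> a \<in> P \<Longrightarrow> b \<in> P \<Longrightarrow> R a p' \<Longrightarrow> R p b \<Longrightarrow> R a b"
    "p \<in> P \<Longrightarrow> a \<in> P \<Longrightarrow> R a p \<Longrightarrow> \<exists>q. (q, p) \<in> N"
    "p \<in> P \<Longrightarrow> b \<in> P \<Longrightarrow> R p b \<Longrightarrow> \<exists>q. (p, q) \<in> N"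
proof -
  have 1: "N \<subseteq> P \<times> P" and 2: "single_valued N" "single_valued (N\<inverse>)"
    and 3: "\<forall>p p'. (p, p') \<in> N \<longrightarrow> R p p' \<and> (\<forall>a\<in>P. \<forall>b\<in>P. R a p' \<longrightarrow> R p b \<longrightarrow> R a b)"
    and 4: "\<forall>p\<in>P. p \<notin> Range N \<longrightarrow> (\<forall>a\<in>P. \<not> R a p)" "\<forall>p\<in>P. p \<notin> Domain N \<longrightarrow> (\<forall>b\<in>P. \<not> R p b)"
    using assms unfolding good_cover_def by fast+
  show "(p, p') \<in> N \<Longrightarrow> p \<in> P" "(p, p') \<in> N \<Longrightarrow> p' \<in> P" using 1 by auto
  show "(p, p') \<in> N \<Longrightarrow> R p p'" using 3 by simp
  show "(p, p') \<in> N \<Longrightarrow> (q, p') \<in> N \<Longrightarrow> p = q" "(p, p') \<in> N \<Longrightarrow> (p, q') \<in> N \<Longrightarrow> p' = q'"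
    using 2 by (auto dest: single_valuedD)
  show "(p, p') \<in> N \<Longrightarrow> a \<in> P \<Longrightarrow> b \<in> P \<Longrightarrow> R a p' \<Longrightarrow> R p b \<Longrightarrow> R a b"
    using 3 by simp
  show "p \<in> P \<Longrightarrow> a \<in> P \<Longrightarrow> R a p \<Longrightarrow> \<exists>q. (q, p) \<in> N" using 4(1) by (meson RangeE)
  show "p \<in> P \<Longrightarrow> b \<in> P \<Longrightarrow> R p b \<Longrightarrow> \<exists>q. (p, q) \<in> N" using 4(2) by (meson DomainE)
qed

lemma good_coverI:
  assumes "\<And>p p'. (p, p') \<in> N \<Longrightarrow> p \<in> P \<and> p' \<in> P \<and> R p p'"
    "\<And>p p' q. (p, p') \<in> N \<Longrightarrow> (q, p') \<in> N \<Longrightarrow> p = q"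
    "\<And>p p' q'. (p, p') \<in> N \<Longrightarrow> (p, q') \<in> N \<Longrightarrow> p' = q'"
    "\<And>p p' a b. (p, p') \<in> N \<Longrightarrow> a \<in> P \<Longrightarrow> b \<in> P \<Longrightarrow> R a p' \<Longrightarrow> R p b \<Longrightarrow> R a b"
    "\<And>p a. p \<in> P \<Longrightarrow> a \<in> P \<Longrightarrow> R a p \<Longrightarrow> \<exists>q. (q, p) \<in> N"
    "\<And>p b. p \<in> P \<Longrightarrow> b \<in> P \<Longrightarrow> R p b \<Longrightarrow> \<exists>q. (p, q) \<in> N"
  shows "good_cover P R N"
proof -
  have "N \<subseteq> P \<times> P" using assms(1) by auto
  moreover have "single_valued N" "single_valued (N\<inverse>)"
    using assms(2,3) by (auto intro!: single_valuedI)
  moreover have "p \<in> P \<longrightarrow> p \<notin> Range N \<longrightarrow> (\<forall>a\<in>P. \<not> R a p)" for p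
    using assms(5) by blast
  moreover have "p \<in> P \<longrightarrow> p \<notin> Domain N \<longrightarrow> (\<forall>a\<in>P. \<not> R p a)" for p
    using assms(6) by blast
  ultimately show ?thesis unfolding good_cover_def using assms(1,4) by simp
qed

lemma good_cover_transport:
  assumes N: "good_cover P R' N" and inj: "inj_on \<phi> P"
    and R: "\<And>x y. x \<in> P \<Longrightarrow> y \<in> P \<Longrightarrow> R (\<phi> x) (\<phi> y) \<longleftrightarrow> R' x y"
  shows "good_cover (\<phi> ` P) R (map_prod \<phi> \<phi> ` N)" "card (map_prod \<phi> \<phi> ` N) = card N"
proof -
  note D = good_coverD[OF N]
  have inj': "\<phi> x = \<phi> y \<Longrightarrow> x \<in> P \<Longrightarrow> y \<in> P \<Longrightarrow> x = y" for x y
    using inj by (auto simp: inj_on_def)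
  show "good_cover (\<phi> ` P) R (map_prod \<phi> \<phi> ` N)"
  proof (rule good_coverI)
    fix p p' assume "(p, p') \<in> map_prod \<phi> \<phi> ` N"
    then show "p \<in> \<phi> ` P \<and> p' \<in> \<phi> ` P \<and> R p p'" using D(1,2,3) R by auto
  next
    fix p p' q assume "(p, p') \<in> map_prod \<phi> \<phi> ` N" "(q, p') \<in> map_prod \<phi> \<phi> ` N"
    then obtain a b c d where *: "(a, b) \<in> N" "(c, d) \<in> N" "p = \<phi> a" "p' = \<phi> b" "q = \<phi> c" "p' = \<phi> d"
      by auto
    then have "b = d" using inj' D(2) by metis
    then show "p = q" using * D(4) by metis
  next
    fix p p' q assume "(p, p') \<in> map_prod \<phi> \<phi> ` N" "(p, q) \<in> map_prod \<phi> \<phi> ` N"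
    then obtain a b c d where *: "(a, b) \<in> N" "(c, d) \<in> N" "p = \<phi> a" "p' = \<phi> b" "p = \<phi> c" "q = \<phi> d"
      by auto
    then have "a = c" using inj' D(1) by metis
    then show "p' = q" using * D(5) by metis
  next
    fix p p' a b
    assume *: "(p, p') \<in> map_prod \<phi> \<phi> ` N" "a \<in> \<phi> ` P" "b \<in> \<phi> ` P" "R a p'" "R p b"
    then obtain q q' c d where "(q, q') \<in> N" "p = \<phi> q" "p' = \<phi> q'" "a = \<phi> c" "b = \<phi> d"
      "c \<in> P" "d \<in> P" by auto
    then show "R a b" using * D(1,2) D(6)[of q q' c d] R by auto
  next
    fix p a assume "p \<in> \<phi> ` P" "a \<in> \<phi> ` P" "R a p"
    then obtain x y where "p = \<phi> x" "a = \<phi> y" "x \<in> P" "y \<in> P" "R' y x" using R by auto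
    moreover then obtain q where "(q, x) \<in> N" using D(7) by metis
    ultimately have "(\<phi> q, p) \<in> map_prod \<phi> \<phi> ` N" by (metis map_prod_imageI)
    then show "\<exists>q. (q, p) \<in> map_prod \<phi> \<phi> ` N" ..
  next
    fix p b assume "p \<in> \<phi> ` P" "b \<in> \<phi> ` P" "R p b"
    then obtain x y where "p = \<phi> x" "b = \<phi> y" "x \<in> P" "y \<in> P" "R' x y" using R by auto
    moreover then obtain q where "(x, q) \<in> N" using D(8) by metis
    ultimately have "(p, \<phi> q) \<in> map_prod \<phi> \<phi> ` N" by (metis map_prod_imageI)
    then show "\<exists>q. (p, q) \<in> map_prod \<phi> \<phi> ` N" ..
  qed
  have "inj_on (map_prod \<phi> \<phi>) N"
  proof (rule inj_onI, clarify)
    fix a b c d assume "(a, b) \<in> N" "(c, d) \<in> N" "map_prod \<phi> \<phi> (a, b) = map_prod \<phi> \<phi> (c, d)"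
    then show "a = c \<and> b = d" using inj' D(1,2) by (metis Pair_inject map_prod_simp)
  qed
  then show "card (map_prod \<phi> \<phi> ` N) = card N" by (rule card_image)
qed

text \<open>An element is minimal or maximal in the strict product as soon as one of its components
  is, so the pairs that are consecutive in both components already form a cover.\<close>

lemma good_cover_prod:
  assumes "good_cover P R N" "good_cover P' R' N'"
  defines "N2 \<equiv> (\<lambda>((p, p'), (q, q')). ((p, q), (p', q'))) ` (N \<times> N')"
  shows "good_cover (P \<times> P') (\<lambda>x y. R (fst x) (fst y) \<and> R' (snd x) (snd y)) N2"
    "card N2 = card N * card N'"
proof -
  note D = good_coverD[OF assms(1)] and D' = good_coverD[OF assms(2)]
  have mem: "(x, y) \<in> N2 \<longleftrightarrow> (fst x, fst y) \<in> N \<and> (snd x, snd y) \<in> N'" for x y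
    unfolding N2_def by (cases x; cases y) (force simp: image_iff)
  show "good_cover (P \<times> P') (\<lambda>x y. R (fst x) (fst y) \<and> R' (snd x) (snd y)) N2"
  proof (rule good_coverI, goal_cases)
    case (1 p p')
    then show ?case using D(1-3) D'(1-3) by (auto simp: mem mem_Times_iff)
  next
    case (2 p p' q)
    then show ?case using D(4) D'(4) by (auto simp: mem intro!: prod_eqI)
  next
    case (3 p p' q)
    then show ?case using D(5) D'(5) by (auto simp: mem intro!: prod_eqI)
  next
    case (4 p p' a b)
    then show ?case using D(6) D'(6) by (auto simp: mem mem_Times_iff)
  next
    case (5 p a)
    then show ?case using D(7)[of "fst p" "fst a"] D'(7)[of "snd p" "snd a"]
      by (auto simp: mem mem_Times_iff)
  next
    case (6 p b)
    then show ?case using D(8)[of "fst p" "fst b"] D'(8)[of "snd p" "snd b"]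
      by (auto simp: mem mem_Times_iff)
  qed
  have "inj_on (\<lambda>((p, p'), (q, q')). ((p, q), (p', q'))) (N \<times> N')" by (auto simp: inj_on_def)
  then show "card N2 = card N * card N'" unfolding N2_def by (simp add: card_image card_cartesian_product)
qed

text \<open>The ordinal sum. \<open>Inl\<close> will mark the orientations that contain the new side
  from \<open>v\<close> to \<open>u\<close>, and \<open>Inr\<close> the others: between them that
  side alone is a path from \<open>v\<close> to \<open>u\<close>.\<close>

fun sum_rel :: "('p \<Rightarrow> 'p \<Rightarrow> bool) \<Rightarrow> 'p + 'p \<Rightarrow> 'p + 'p \<Rightarrow> bool" where
  "sum_rel R (Inl a) (Inl b) = R a b"
| "sum_rel R (Inr a) (Inr b) = R a b"
| "sum_rel R (Inl a) (Inr b) = True"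
| "sum_rel R (Inr a) (Inl b) = False"

text \<open>Every chain of the cover crosses from \<open>X\<close> to \<open>Y\<close> at exactly one element of \<open>X \<inter> Y\<close>, so
  that \<open>X \<inter> Y\<close> has as many elements as there are chains.\<close>

lemma good_cover_cut:
  assumes N: "good_cover P R N" and fin: "finite P"
    and tr: "\<And>a b c. a \<in> P \<Longrightarrow> b \<in> P \<Longrightarrow> c \<in> P \<Longrightarrow> R a b \<Longrightarrow> R b c \<Longrightarrow> R a c"
    and XY: "X \<union> Y = P"
    and cross: "\<And>x y. x \<in> X \<Longrightarrow> y \<in> Y \<Longrightarrow> \<not> R y x"
    and maxX: "\<And>p. p \<in> P \<Longrightarrow> p \<notin> X \<Longrightarrow> \<exists>y\<in>Y. R y p"
    and maxY: "\<And>p. p \<in> P \<Longrightarrow> p \<notin> Y \<Longrightarrow> \<exists>x\<in>X. R p x"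
  obtains N' where "good_cover (X <+> Y) (sum_rel R) N'" "card N' = card P"
    "card (X <+> Y) + card N = card P + card P"
proof -
  note D = good_coverD[OF N]
  have sub: "x \<in> X \<Longrightarrow> x \<in> P" "x \<in> Y \<Longrightarrow> x \<in> P" for x using XY by auto
  have upX: "p \<in> X" if pp: "(p, p') \<in> N" "p' \<in> X" for p p'
  proof (rule ccontr)
    assume "p \<notin> X"
    then obtain y where y: "y \<in> Y" "R y p" using maxX[of p] D(1) pp by blast
    have "R y p'" by (rule tr[of y p p']) (use y sub D(1-3)[OF pp(1)] in auto)
    then show False using cross pp(2) y(1) by blast
  qed
  have dnY: "p' \<in> Y" if pp: "(p, p') \<in> N" "p \<in> Y" for p p'
  proof (rule ccontr)
    assume "p' \<notin> Y"
    then obtain x where x: "x \<in> X" "R p' x" using maxY[of p'] D(2) pp by blast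
    have "R p x" by (rule tr[of p p' x]) (use x sub D(1-3)[OF pp(1)] in auto)
    then show False using cross pp(2) x(1) by blast
  qed
  \<comment> \<open>The condition on consecutive pairs enters here: the cut cannot pass between
    \<open>p\<close> and \<open>p'\<close> without meeting the chain.\<close>
  have alt: "p' \<in> X \<or> p \<in> Y" if pp: "(p, p') \<in> N" for p p'
  proof (rule ccontr)
    assume "\<not> (p' \<in> X \<or> p \<in> Y)"
    then obtain x y where "x \<in> X" "R p x" "y \<in> Y" "R y p'"
      using maxX[of p'] maxY[of p] D(1,2) pp by blast
    then show False using D(6)[OF pp, of y x] sub cross by blast
  qed
  have excl: "\<not> (p' \<in> X \<and> p \<in> Y)" if "(p, p') \<in> N" for p p'
    using cross D(3)[OF that] by blast
  define NX where "NX = {(p, p'). (p, p') \<in> N \<and> p' \<in> X}"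
  define NY where "NY = {(p, p'). (p, p') \<in> N \<and> p \<in> Y}"
  have finN: "finite N" using N fin by (auto simp: good_cover_def intro: finite_subset)
  have NU: "NX \<union> NY = N" "NX \<inter> NY = {}" using alt excl by (auto simp: NX_def NY_def)
  have finNX: "finite NX" "finite NY" using finN NU(1) by (metis finite_Un)+
  have cN: "card N = card NX + card NY"
    using card_Un_disjoint[OF finNX NU(2)] NU(1) by simp
  \<comment> \<open>Each element of \<open>X - Y\<close> is the upper element of exactly one pair in
    \<open>NX\<close>, each element of \<open>Y - X\<close> the lower element of exactly one pair in
    \<open>NY\<close>, and these are all pairs of the cover. Hence \<open>X \<inter> Y\<close> has
    \<open>card P - card N\<close> elements.\<close>
  have imX: "fst ` NX = X - Y"
  proof (intro equalityI subsetI)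
    fix p assume "p \<in> fst ` NX"
    then show "p \<in> X - Y" using upX excl by (auto simp: NX_def)
  next
    fix p assume p: "p \<in> X - Y"
    then obtain x where "x \<in> X" "R p x" using maxY[of p] sub by blast
    then obtain q where q: "(p, q) \<in> N" using D(8)[of p x] sub p by blast
    then have "(p, q) \<in> NX" using alt p by (auto simp: NX_def)
    then show "p \<in> fst ` NX" by force
  qed
  have imY: "snd ` NY = Y - X"
  proof (intro equalityI subsetI)
    fix p assume "p \<in> snd ` NY"
    then show "p \<in> Y - X" using dnY excl by (auto simp: NY_def)
  next
    fix p assume p: "p \<in> Y - X"
    then obtain y where "y \<in> Y" "R y p" using maxX[of p] sub by blast
    then obtain q where q: "(q, p) \<in> N" using D(7)[of p y] sub p by blast
    then have "(q, p) \<in> NY" using alt p by (auto simp: NY_def)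
    then show "p \<in> snd ` NY" by force
  qed
  have "inj_on fst NX" by (rule inj_onI) (use D(5) in \<open>auto simp: NX_def\<close>)
  then have cX: "card NX = card (X - Y)" using imX card_image by fastforce
  have "inj_on snd NY" by (rule inj_onI) (use D(4) in \<open>auto simp: NY_def\<close>)
  then have cY: "card NY = card (Y - X)" using imY card_image by fastforce
  have fXY: "finite X" "finite Y" using fin XY by auto
  have cPN: "card N + card (X \<inter> Y) = card P"
  proof -
    have "card P = card (X - Y) + card Y"
      unfolding XY[symmetric] using fXY by (metis Un_commute Un_Diff_cancel2 card_Un_disjoint
          finite_Diff Diff_disjoint inf_commute)
    moreover have "card Y = card (Y - X) + card (X \<inter> Y)"
      using fXY card_Diff_subset_Int[of Y X] card_mono[of Y "Y \<inter> X"] by (simp add: Int_commute)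
    ultimately show ?thesis using cN cX cY by simp
  qed
  \<comment> \<open>Making \<open>Inl z\<close> and \<open>Inr z\<close> consecutive joins the part
    of a chain in \<open>X\<close> to its part in \<open>Y\<close>.\<close>
  define N' where "N' = map_prod Inl Inl ` NX \<union> map_prod Inr Inr ` NY \<union> (\<lambda>z. (Inl z, Inr z)) ` (X \<inter> Y)"
  have card': "card N' = card P"
  proof -
    let ?X = "map_prod Inl Inl ` NX :: (('a + 'a) \<times> ('a + 'a)) set"
    let ?Y = "map_prod Inr Inr ` NY :: (('a + 'a) \<times> ('a + 'a)) set"
    let ?Z = "(\<lambda>z. (Inl z, Inr z)) ` (X \<inter> Y) :: (('a + 'a) \<times> ('a + 'a)) set"
    have "card N' = card (?X \<union> ?Y) + card ?Z"
      unfolding N'_def by (rule card_Un_disjoint) (use finNX fXY in auto)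
    also have "card (?X \<union> ?Y) = card ?X + card ?Y"
      by (rule card_Un_disjoint) (use finNX in auto)
    also have "card ?X = card NX" by (rule card_image) (auto simp: inj_on_def)
    also have "card ?Y = card NY" by (rule card_image) (auto simp: inj_on_def)
    also have "card ?Z = card (X \<inter> Y)" by (rule card_image) (auto simp: inj_on_def)
    finally show ?thesis using cN cPN by simp
  qed
  have cs: "card (X <+> Y) + card N = card P + card P"
    using cPN card_Un_Int[OF fXY] fXY XY by (simp add: card_Plus)
  have ll: "(Inl a, Inl b) \<in> N' \<longleftrightarrow> (a, b) \<in> N \<and> b \<in> X" for a b
    by (auto simp: N'_def NX_def)
  have rr: "(Inr a, Inr b) \<in> N' \<longleftrightarrow> (a, b) \<in> N \<and> a \<in> Y" for a b
    by (auto simp: N'_def NY_def)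
  have lr: "(Inl a, Inr b) \<in> N' \<longleftrightarrow> a = b \<and> a \<in> X \<and> a \<in> Y" for a b
    by (auto simp: N'_def)
  have rl: "(Inr a, Inl b) \<notin> N'" for a b
    by (auto simp: N'_def)
  note m = ll rr lr rl
  have "good_cover (X <+> Y) (sum_rel R) N'"
  proof (rule good_coverI, goal_cases)
    case (1 p p')
    then show ?case by (cases p; cases p') (use upX dnY D(3) in \<open>auto simp: m\<close>)
  next
    case (2 p p' q)
    then show ?case by (cases p; cases p'; cases q) (use D(4) excl in \<open>auto simp: m\<close>)
  next
    case (3 p p' q)
    then show ?case by (cases p; cases p'; cases q) (use D(5) excl in \<open>auto simp: m\<close>)
  next
    case (4 p p' a b)
    then show ?case
      by (cases p; cases p'; cases a; cases b) (use D(6) cross sub in \<open>auto simp: m\<close>)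
  next
    case (5 p a)
    show ?case
    proof (cases p)
      case (Inl x)
      then obtain x' where "a = Inl x'" "x' \<in> X" "R x' x" "x \<in> X" using 5 by (cases a) auto
      moreover then obtain q where "(q, x) \<in> N" using D(7)[of x x'] sub by blast
      ultimately show ?thesis using Inl ll by blast
    next
      case (Inr y)
      then have y: "y \<in> Y" using 5 by auto
      show ?thesis
      proof (cases "y \<in> X")
        case True
        then show ?thesis using m y Inr by blast
      next
        case False
        then have "y \<in> snd ` NY" using imY y by blast
        then obtain q where "(q, y) \<in> NY" by auto
        then show ?thesis using Inr rr unfolding NY_def by blast
      qed
    qed
  next
    case (6 p b)
    show ?case
    proof (cases p)
      case (Inr y)
      then obtain y' where "b = Inr y'" "y' \<in> Y" "R y y'" "y \<in> Y" using 6 by (cases b) auto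
      moreover then obtain q where "(y, q) \<in> N" using D(8)[of y y'] sub by blast
      ultimately show ?thesis using Inr rr by blast
    next
      case (Inl x)
      then have x: "x \<in> X" using 6 by auto
      show ?thesis
      proof (cases "x \<in> Y")
        case True
        then show ?thesis using m x Inl by blast
      next
        case False
        then have "x \<in> fst ` NX" using imX x by blast
        then obtain q where "(x, q) \<in> NX" by auto
        then show ?thesis using Inl ll unfolding NX_def by blast
      qed
    qed
  qed
  then show thesis using card' cs by (rule that)
qed

section \<open>Triangulated polygons\<close>

definition up :: "('b \<Rightarrow> 'v) \<Rightarrow> ('b \<Rightarrow> 'v) \<Rightarrow> 'v \<Rightarrow> 'v \<Rightarrow> 'b set \<Rightarrow> 'b set \<Rightarrow> bool" where
  "up t h v u I J \<longleftrightarrow> (v, u) \<in> (darcs t h I J)\<^sup>+"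

text \<open>Quantifying over orientations, as in \<open>indep\<close>, lets the facts on directed
  paths apply to undirected connectivity.\<close>

definition conn :: "('b \<Rightarrow> 'v) \<Rightarrow> ('b \<Rightarrow> 'v) \<Rightarrow> 'b set \<Rightarrow> 'v \<Rightarrow> 'v \<Rightarrow> bool" where
  "conn t h F v u \<longleftrightarrow> (\<exists>P\<subseteq>F. (v, u) \<in> (darcs t h P (F - P))\<^sup>+)"

definition kcon :: "'b set \<Rightarrow> ('b \<Rightarrow> 'v) \<Rightarrow> ('b \<Rightarrow> 'v) \<Rightarrow> 'v \<Rightarrow> 'v \<Rightarrow> nat" where
  "kcon A t h v u = card {F. F \<subseteq> A \<and> indep t h F \<and> conn t h F v u}"

text \<open>The number of pairs of the cover, \<open>kcon A t h v u\<close>, is the number of forests connecting \<open>v\<close> and \<open>u\<close>;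
  the remaining forests correspond to the chains.\<close>

definition strip :: "'b set \<Rightarrow> ('b \<Rightarrow> 'v) \<Rightarrow> ('b \<Rightarrow> 'v) \<Rightarrow> 'v \<Rightarrow> 'v \<Rightarrow> bool" where
  "strip A t h v u \<longleftrightarrow>
     (\<forall>I J K. I \<subseteq> A \<longrightarrow> J \<subseteq> A \<longrightarrow> K \<subseteq> A \<longrightarrow> sep t h I J \<longrightarrow> sep t h J K \<longrightarrow>
        sep t h I K \<longrightarrow> up t h v u I J \<longrightarrow> up t h v u J K \<longrightarrow> up t h v u I K) \<and>
     (\<forall>P. maximal_by_inclusion (sepcoll A t h) P \<longrightarrow> card P = nind A t h \<and>
        (\<exists>N. good_cover P (up t h v u) N \<and> card N = kcon A t h v u))"

text \<open>The separation hypotheses matter: an element flipped twice is absent from the difference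
  of \<open>I\<close> and \<open>K\<close>, so the two given paths cannot simply be joined.\<close>

lemma strip_trans:
  assumes "strip A t h v u" "I \<subseteq> A" "J \<subseteq> A" "K \<subseteq> A" "sep t h I J"
    "sep t h J K" "sep t h I K" "up t h v u I J" "up t h v u J K"
  shows "up t h v u I K"
  using assms unfolding strip_def by blast

lemma strip_max:
  assumes "strip A t h v u" "maximal_by_inclusion (sepcoll A t h) P"
  shows "card P = nind A t h" "\<exists>N. good_cover P (up t h v u) N \<and> card N = kcon A t h v u"
  using assms unfolding strip_def by blast+

lemma conn_sym: "conn t h F v u \<Longrightarrow> conn t h F u v"
proof -
  assume "conn t h F v u"
  then obtain P where P: "P \<subseteq> F" "(v, u) \<in> (darcs t h P (F - P))\<^sup>+" by (auto simp: conn_def)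
  then have "(u, v) \<in> (darcs t h (F - P) P)\<^sup>+"
    by (subst darcs_converse) (simp add: trancl_converse)
  moreover have "F - (F - P) = P" using P by auto
  ultimately show ?thesis unfolding conn_def by (metis Diff_subset)
qed

lemma indep_insert_conn:
  assumes "e \<notin> F"
  shows "indep t h (insert e F) \<longleftrightarrow> t e \<noteq> h e \<and> indep t h F \<and> \<not> conn t h F (t e) (h e)"
proof (cases "t e = h e")
  case False
  have "indep t h (insert e F) \<longleftrightarrow>
     (\<forall>P\<subseteq>F. sep t h P (F - P) \<and> (h e, t e) \<notin> (darcs t h P (F - P))\<^sup>* \<and>
       (t e, h e) \<notin> (darcs t h P (F - P))\<^sup>*)"
    using indep_insert[OF assms, of t h] False
    unfolding indep_def darcs_comp acyclic_merge[OF False] by auto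
  also have "\<dots> \<longleftrightarrow> indep t h F \<and> \<not> conn t h F (t e) (h e)"
    using False conn_sym[of t h F "h e" "t e"]
    unfolding indep_def conn_def by (auto simp: rtrancl_eq_or_trancl)
  finally show ?thesis using False by simp
qed (simp add: indep_insert[OF assms])

lemma finite_indep: "finite A \<Longrightarrow> finite {F. F \<subseteq> A \<and> Q F}"
  by (rule finite_subset[of _ "Pow A"]) auto

text \<open>A forest containing \<open>e\<close> is a forest of \<open>A\<close> that does not
  connect the ends of \<open>e\<close>, completed with \<open>e\<close>. For the second count, every
  forest of \<open>A\<close> is made connecting in one way: it is kept if it connects the ends of
  \<open>e\<close>, and completed with \<open>e\<close> otherwise.\<close>

lemma nind_edge:
  assumes "finite A" "e \<notin> A" "t e \<noteq> h e"
  shows "nind (insert e A) t h + kcon A t h (t e) (h e) = nind A t h + nind A t h"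
    and "kcon (insert e A) t h (t e) (h e) = nind A t h"
proof -
  have ii: "indep t h (insert e F) \<longleftrightarrow> indep t h F \<and> \<not> conn t h F (t e) (h e)" if "F \<subseteq> A" for F
    using indep_insert_conn[of e F t h] assms that by auto
  let ?C = "{F. F \<subseteq> A \<and> indep t h F \<and> conn t h F (t e) (h e)}"
  let ?D = "{F. F \<subseteq> A \<and> indep t h (insert e F)}"
  have eq: "{F. F \<subseteq> A \<and> indep t h F} = ?C \<union> ?D" using ii by blast
  have "card (?C \<union> ?D) = card ?C + card ?D"
    by (rule card_Un_disjoint) (use finite_indep[OF assms(1)] ii in auto)
  then have "nind A t h = kcon A t h (t e) (h e) + card ?D"
    unfolding nind_def kcon_def eq .
  then show "nind (insert e A) t h + kcon A t h (t e) (h e) = nind A t h + nind A t h"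
    using nind_split[OF assms(1,2), of t h] by simp
  have conn_e: "conn t h (insert e F) (t e) (h e)" for F
    unfolding conn_def using assms(3)
    by (intro exI[of _ "{e}"]) (auto simp: darcs_def)
  have "bij_betw (\<lambda>F. F - {e}) {F. F \<subseteq> insert e A \<and> indep t h F \<and> conn t h F (t e) (h e)}
     {F. F \<subseteq> A \<and> indep t h F}"
  proof (rule bij_betwI', goal_cases)
    case (1 F G)
    have no: False if "F - {e} = G - {e}" "e \<in> G" "e \<notin> F" "indep t h G" "conn t h F (t e) (h e)" for F G
    proof -
      have "insert e F = G" using that by auto
      then show False using that indep_insert_conn[of e F t h] by auto
    qed
    show ?case
    proof
      assume eq: "F - {e} = G - {e}"
      then have "e \<in> F \<longleftrightarrow> e \<in> G" using no[of F G] no[of G F] 1 by auto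
      then show "F = G" using eq by auto
    qed simp
  next
    case (2 F)
    then show ?case using indep_mono[of t h F "F - {e}"] by auto
  next
    case (3 F)
    show ?case
    proof (cases "conn t h F (t e) (h e)")
      case True
      then show ?thesis using 3 assms(2) by (intro bexI[of _ F]) auto
    next
      case False
      then have "indep t h (insert e F)" using 3 assms indep_insert_conn[of e F t h] by auto
      then show ?thesis using 3 assms(2) conn_e[of F] by (intro bexI[of _ "insert e F"]) auto
    qed
  qed
  then show "kcon (insert e A) t h (t e) (h e) = nind A t h"
    unfolding kcon_def nind_def by (rule bij_betw_same_card)
qed

lemma up_insert_cases:
  assumes "e \<notin> I" "e \<notin> J" "t e = v" "h e = u"
  shows "up t h v u (insert e I) (insert e J) \<longleftrightarrow> up t h v u I J"
    and "up t h v u (insert e I) J"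
    and "sep t h I (insert e J) \<Longrightarrow> \<not> up t h v u I (insert e J)"
proof -
  show "up t h v u (insert e I) (insert e J) \<longleftrightarrow> up t h v u I J"
    using assms by (simp add: up_def darcs_insert_both)
  show "up t h v u (insert e I) J"
    using assms by (auto simp: up_def darcs_insert_left)
  assume a: "sep t h I (insert e J)"
  show "\<not> up t h v u I (insert e J)"
  proof
    assume "up t h v u I (insert e J)"
    moreover have "(u, v) \<in> darcs t h I (insert e J)" using assms by (simp add: darcs_insert_right)
    ultimately show False using a unfolding up_def acyclic_def by (meson trancl.trancl_into_trancl)
  qed
qed

text \<open>\<open>insert e x\<close> and \<open>y\<close> are separated iff \<open>x\<close> and
  \<open>y\<close> are and \<open>y\<close> is not above \<open>x\<close>. Hence a maximal
  \<open>P\<close> yields sets \<open>X\<close> (members with \<open>e\<close>, which is removed)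
  and \<open>Y\<close> (members without \<open>e\<close>) whose union is maximal for
  \<open>A\<close> and whose overlap is a maximal antichain, as \<open>good_cover_cut\<close>
  requires.\<close>

lemma strip_edge:
  assumes A: "strip A t h v u" "finite A" and e: "e \<notin> A" "t e = v" "h e = u" "v \<noteq> u"
  shows "strip (insert e A) t h v u"
proof -
  note trA = strip_trans[OF A(1)] and maxA = strip_max[OF A(1)]
  note nind = nind_edge[where t = t and h = h, OF A(2) e(1), unfolded e(2,3), OF e(4)]
  have trI: "up t h v u I K" if *: "I \<subseteq> insert e A" "J \<subseteq> insert e A" "K \<subseteq> insert e A"
    "sep t h I J" "sep t h J K" "sep t h I K"
    "up t h v u I J" "up t h v u J K" for I J K
  proof -
    have 1: "False" if "e \<notin> I" "e \<in> J" "sep t h I J" "up t h v u I J" for I J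
      using up_insert_cases(3)[of e I "J - {e}" t v h u] that e by (simp add: insert_absorb)
    have red: "darcs t h I J = darcs t h (I - {e}) (J - {e})" if "e \<in> I \<longleftrightarrow> e \<in> J" for I J
      using that by (auto simp: darcs_def)
    \<comment> \<open>If \<open>e\<close> is not the same in all three orientations, it is either in
      \<open>I\<close> and not in \<open>K\<close>, hence a path by itself, or it closes a cycle
      with one of the two given paths.\<close>
    show ?thesis
    proof (cases "e \<in> I \<and> e \<notin> K")
      case True
      then show ?thesis using up_insert_cases(2)[of e "I - {e}" K t v h u] e by (simp add: insert_absorb)
    next
      case False
      then have eq: "e \<in> I \<longleftrightarrow> e \<in> J" "e \<in> J \<longleftrightarrow> e \<in> K" "e \<in> I \<longleftrightarrow> e \<in> K"
        using 1[of I J] 1[of J K] * by auto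
      have "up t h v u (I - {e}) (K - {e})"
        by (rule trA[of _ "J - {e}"]) (use * red[OF eq(1)] red[OF eq(2)] red[OF eq(3)] in \<open>auto simp: up_def\<close>)
      then show ?thesis using red[OF eq(3)] by (simp add: up_def)
    qed
  qed
  have "card P = nind (insert e A) t h \<and>
        (\<exists>N. good_cover P (up t h v u) N \<and> card N = kcon (insert e A) t h v u)"
    if P: "maximal_by_inclusion (sepcoll (insert e A) t h) P" for P
  proof -
    have sP: "sepcoll (insert e A) t h P" using P by (simp add: maximal_by_inclusion_def)
    define X where "X = {K. K \<subseteq> A \<and> insert e K \<in> P}"
    define Y where "Y = {K. K \<subseteq> A \<and> K \<in> P}"
    have eA: "e \<notin> K" if "K \<subseteq> A" for K using e(1) that by auto
    have acP: "sep t h K L" if "K \<in> P" "L \<in> P" for K L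
      using sP that by (auto simp: sepcoll_def)
    have XY: "X \<union> Y = del e P"
      using sP e(1) by (auto simp: X_def Y_def del_def sepcoll_def)
    have sXY: "sepcoll A t h (X \<union> Y)" unfolding XY by (rule sepcoll_del[OF sP])
    have ac: "sep t h K L" if "K \<in> X \<union> Y" "L \<in> X \<union> Y" for K L
      using sXY that by (auto simp: sepcoll_def)
    have sub: "K \<subseteq> A" if "K \<in> X \<union> Y" for K using that by (auto simp: X_def Y_def)
    \<comment> \<open>\<open>J\<close> is not assumed to be a member: it will also be an orientation
      separated from all of \<open>X \<union> Y\<close> that is yet to be shown to belong
      there.\<close>
    have tr: "up t h v u I K" if "I \<subseteq> A" "J \<subseteq> A" "K \<subseteq> A" "I \<in> X \<union> Y" "K \<in> X \<union> Y"
      "\<And>L. L \<in> X \<union> Y \<Longrightarrow> sep t h J L" "up t h v u I J" "up t h v u J K" for I J K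
      by (rule trA[of I J K]) (use that ac acyclic_darcs_sym[of t h J] in auto)
    have cross: "\<not> up t h v u y x" if "x \<in> X" "y \<in> Y" for x y
    proof -
      have "sep t h (insert e x) y" using that acP by (auto simp: X_def Y_def)
      then have "(u, v) \<notin> (darcs t h x y)\<^sup>*"
        using that eA e by (auto simp: X_def Y_def darcs_insert_left)
      then show ?thesis unfolding up_def using darcs_converse[of t h y x]
        by (metis converse_iff trancl_converse trancl_into_rtrancl)
    qed
    have outX: "\<exists>y\<in>Y. up t h v u y K"
      if K: "K \<subseteq> A" "\<And>I. I \<in> X \<union> Y \<Longrightarrow> sep t h K I" "K \<notin> X" for K
    proof (rule ccontr)
      assume neg: "\<not> ?thesis"
      have "insert e K \<in> P"
      proof (rule maximal_sepcollD[OF P])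
        show "insert e K \<subseteq> insert e A" using K by auto
        fix I assume I: "I \<in> P"
        show "sep t h (insert e K) I"
        proof (cases "e \<in> I")
          case True
          have "I - {e} \<in> X" using True I sP by (auto simp: X_def insert_absorb sepcoll_def)
          then have "sep t h K (I - {e})" using K by auto
          then show ?thesis
            using darcs_insert_both[of e K "I - {e}" t h] eA[OF K(1)] True by (simp add: insert_absorb)
        next
          case False
          then have "I \<in> Y" using I sP by (auto simp: Y_def sepcoll_def)
          then have "sep t h K I" "\<not> up t h v u I K" using K neg by auto
          moreover have "(u, v) \<notin> (darcs t h K I)\<^sup>*"
            using \<open>\<not> up t h v u I K\<close> e(4) darcs_converse[of t h I K]
            unfolding up_def rtrancl_eq_or_trancl by (auto simp: trancl_converse)
          ultimately show ?thesis using eA[OF K(1)] False e by (simp add: darcs_insert_left)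
        qed
      qed
      then show False using K by (simp add: X_def)
    qed
    have outY: "\<exists>x\<in>X. up t h v u K x"
      if K: "K \<subseteq> A" "\<And>I. I \<in> X \<union> Y \<Longrightarrow> sep t h K I" "K \<notin> Y" for K
    proof (rule ccontr)
      assume neg: "\<not> ?thesis"
      have "K \<in> P"
      proof (rule maximal_sepcollD[OF P])
        show "K \<subseteq> insert e A" using K by auto
        fix I assume I: "I \<in> P"
        show "sep t h K I"
        proof (cases "e \<in> I")
          case True
          have iX: "I - {e} \<in> X" using True I sP by (auto simp: X_def insert_absorb sepcoll_def)
          then have "sep t h K (I - {e})" using K by auto
          moreover have "(v, u) \<notin> (darcs t h K (I - {e}))\<^sup>*"
            using neg iX e(4) unfolding up_def rtrancl_eq_or_trancl by auto
          ultimately have "acyclic (insert (u, v) (darcs t h K (I - {e})))" by simp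
          then show ?thesis
            using darcs_insert_right[of e K "I - {e}" t h] eA[OF K(1)] True e by (simp add: insert_absorb)
        next
          case False
          then have "I \<in> Y" using I sP by (auto simp: Y_def sepcoll_def)
          then show ?thesis using K by auto
        qed
      qed
      then show False using K by (simp add: Y_def)
    qed
    \<comment> \<open>An orientation that could be added would lie below some \<open>y\<close> and
      above some \<open>x\<close>, so that \<open>y\<close> would be above \<open>x\<close>.\<close>
    have max: "maximal_by_inclusion (sepcoll A t h) (X \<union> Y)"
    proof (rule maximal_sepcollI[OF sXY], rule ccontr)
      fix K assume K: "K \<subseteq> A" "\<And>I. I \<in> X \<union> Y \<Longrightarrow> sep t h K I" "K \<notin> X \<union> Y"
      obtain y where y: "y \<in> Y" "up t h v u y K" using outX K by blast
      obtain x where x: "x \<in> X" "up t h v u K x" using outY K by blast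
      have "up t h v u y x" by (rule tr[of y K x]) (use x y K sub in auto)
      then show False using cross x y by blast
    qed
    from maxA[OF max] obtain N where N: "good_cover (X \<union> Y) (up t h v u) N" "card N = kcon A t h v u"
      and cXY: "card (X \<union> Y) = nind A t h" by blast
    have fin: "finite (X \<union> Y)" using sXY A(2) by (rule sepcoll_finite[rotated])
    obtain N' where N': "good_cover (X <+> Y) (sum_rel (up t h v u)) N'" "card N' = card (X \<union> Y)"
      "card (X <+> Y) + card N = card (X \<union> Y) + card (X \<union> Y)"
    proof (rule good_cover_cut[OF N(1) fin])
      show "up t h v u a c" if "a \<in> X \<union> Y" "b \<in> X \<union> Y" "c \<in> X \<union> Y" "up t h v u a b"
        "up t h v u b c" for a b c
        by (rule tr[of a b c]) (use that sub ac in auto)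
      show "\<exists>y\<in>Y. up t h v u y p" if "p \<in> X \<union> Y" "p \<notin> X" for p
        using outX[of p] that sub ac by blast
      show "\<exists>x\<in>X. up t h v u p x" if "p \<in> X \<union> Y" "p \<notin> Y" for p
        using outY[of p] that sub ac by blast
    qed (use cross in auto)
    define \<phi> where "\<phi> = case_sum (insert e) (\<lambda>K. K)"
    have im: "\<phi> ` (X <+> Y) = P"
    proof (intro equalityI subsetI)
      fix K assume "K \<in> \<phi> ` (X <+> Y)"
      then show "K \<in> P" by (auto simp: \<phi>_def X_def Y_def)
    next
      fix K assume K: "K \<in> P"
      show "K \<in> \<phi> ` (X <+> Y)"
      proof (cases "e \<in> K")
        case True
        then have "K - {e} \<in> X" using K sP by (auto simp: X_def insert_absorb sepcoll_def)
        moreover have "K = \<phi> (Inl (K - {e}))" using True by (auto simp: \<phi>_def)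
        ultimately show ?thesis by blast
      next
        case False
        then have "K \<in> Y" using K sP by (auto simp: Y_def sepcoll_def)
        moreover have "K = \<phi> (Inr K)" by (auto simp: \<phi>_def)
        ultimately show ?thesis by blast
      qed
    qed
    have inj: "inj_on \<phi> (X <+> Y)"
    proof (rule inj_onI)
      fix x y assume "x \<in> X <+> Y" "y \<in> X <+> Y" "\<phi> x = \<phi> y"
      then show "x = y"
        by (cases x; cases y) (use eA in \<open>auto simp: \<phi>_def X_def Y_def insert_ident\<close>)
    qed
    have R: "up t h v u (\<phi> x) (\<phi> y) \<longleftrightarrow> sum_rel (up t h v u) x y"
      if "x \<in> X <+> Y" "y \<in> X <+> Y" for x y
    proof (cases x; cases y)
      fix a b assume *: "x = Inl a" "y = Inl b"
      then show ?thesis using that eA[of a] eA[of b] up_insert_cases(1)[of e a b t v h u] e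
        by (auto simp: \<phi>_def X_def)
    next
      fix a b assume *: "x = Inl a" "y = Inr b"
      then show ?thesis using that eA[of a] eA[of b] up_insert_cases(2)[of e a b t v h u] e
        by (auto simp: \<phi>_def X_def Y_def)
    next
      fix a b assume *: "x = Inr a" "y = Inl b"
      then show ?thesis using that eA[of a] eA[of b] up_insert_cases(3)[of e a b t v h u] e acP
        by (auto simp: \<phi>_def X_def Y_def)
    qed (auto simp: \<phi>_def)
    have "good_cover P (up t h v u) (map_prod \<phi> \<phi> ` N')" "card (map_prod \<phi> \<phi> ` N') = card N'"
      using good_cover_transport[OF N'(1) inj, of "up t h v u"] R im by auto
    moreover have "card N' = kcon (insert e A) t h v u" using N'(2) cXY nind by simp
    moreover have "card P = card (X <+> Y)" using im inj card_image by metis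
    moreover have "card (X <+> Y) = nind (insert e A) t h" using N'(3) N(2) cXY nind(1) by simp
    ultimately show ?thesis by metis
  qed
  with trI show ?thesis unfolding strip_def by blast
qed

section \<open>Series composition at a cut vertex\<close>

lemma series_path:
  assumes Q: "Q \<subseteq> V \<times> V" "R \<subseteq> W \<times> W" "V \<inter> W = {m}" and v: "v \<in> V"
    and p: "(v, z) \<in> (Q \<union> R)\<^sup>*"
  shows "z \<in> V \<and> (v, z) \<in> Q\<^sup>* \<or> z \<in> W \<and> (v, m) \<in> Q\<^sup>* \<and> (m, z) \<in> R\<^sup>*"
  using p
proof (induction rule: rtrancl_induct)
  case (step y z)
  consider "(y, z) \<in> Q" | "(y, z) \<in> R" using step by blast
  then show ?case
  proof cases
    case 1
    then have yz: "y \<in> V" "z \<in> V" using Q by auto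
    have "(v, y) \<in> Q\<^sup>*" using step.IH
    proof
      assume "y \<in> W \<and> (v, m) \<in> Q\<^sup>* \<and> (m, y) \<in> R\<^sup>*"
      moreover then have "y = m" using yz Q(3) by auto
      ultimately show ?thesis by simp
    qed simp
    then show ?thesis using 1 yz by (meson rtrancl.rtrancl_into_rtrancl)
  next
    case 2
    then have yz: "y \<in> W" "z \<in> W" using Q by auto
    have "(v, m) \<in> Q\<^sup>* \<and> (m, y) \<in> R\<^sup>*" using step.IH
    proof
      assume "y \<in> V \<and> (v, y) \<in> Q\<^sup>*"
      moreover then have "y = m" using yz Q(3) by auto
      ultimately show ?thesis by simp
    qed simp
    then show ?thesis using 2 yz by (meson rtrancl.rtrancl_into_rtrancl)
  qed
qed (use v in simp)

lemma series_trancl: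
  assumes Q: "Q \<subseteq> V \<times> V" "R \<subseteq> W \<times> W" "V \<inter> W = {m}" and v: "v \<in> V" "v \<noteq> m" "u \<in> W" "u \<noteq> m"
  shows "(v, u) \<in> (Q \<union> R)\<^sup>+ \<longleftrightarrow> (v, m) \<in> Q\<^sup>+ \<and> (m, u) \<in> R\<^sup>+"
proof
  assume "(v, u) \<in> (Q \<union> R)\<^sup>+"
  then have "(v, m) \<in> Q\<^sup>*" "(m, u) \<in> R\<^sup>*"
    using series_path[OF Q v(1), of u] Q(3) v by (auto dest: trancl_into_rtrancl)
  then show "(v, m) \<in> Q\<^sup>+ \<and> (m, u) \<in> R\<^sup>+" using v by (auto simp: rtrancl_eq_or_trancl)
next
  assume "(v, m) \<in> Q\<^sup>+ \<and> (m, u) \<in> R\<^sup>+"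
  then have "(v, m) \<in> (Q \<union> R)\<^sup>+" "(m, u) \<in> (Q \<union> R)\<^sup>+"
    by (auto intro: trancl_mono)
  then show "(v, u) \<in> (Q \<union> R)\<^sup>+" by (rule trancl_trans)
qed

lemma series_acyclic_aux:
  assumes Q: "Q \<subseteq> V \<times> V" "R \<subseteq> W \<times> W" "V \<inter> W = {m}" and "acyclic Q" "(c, d) \<in> Q"
  shows "(d, c) \<notin> (Q \<union> R)\<^sup>*"
proof
  assume p: "(d, c) \<in> (Q \<union> R)\<^sup>*"
  have cd: "c \<in> V" "d \<in> V" using assms by auto
  have "(d, c) \<in> Q\<^sup>*"
    using series_path[OF Q cd(2) p]
  proof
    assume "c \<in> W \<and> (d, m) \<in> Q\<^sup>* \<and> (m, c) \<in> R\<^sup>*"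
    moreover then have "c = m" using cd Q(3) by auto
    ultimately show ?thesis by simp
  qed simp
  then show False using assms(4,5) by (meson acyclic_def rtrancl_into_trancl2)
qed

lemma series_acyclic:
  assumes Q: "Q \<subseteq> V \<times> V" "R \<subseteq> W \<times> W" "V \<inter> W = {m}"
  shows "acyclic (Q \<union> R) \<longleftrightarrow> acyclic Q \<and> acyclic R"
proof
  assume "acyclic (Q \<union> R)"
  then show "acyclic Q \<and> acyclic R" by (meson acyclic_subset sup_ge1 sup_ge2)
next
  assume a: "acyclic Q \<and> acyclic R"
  show "acyclic (Q \<union> R)"
  proof (rule ccontr)
    assume "\<not> acyclic (Q \<union> R)"
    then obtain z where "(z, z) \<in> (Q \<union> R)\<^sup>+" by (auto simp: acyclic_def)
    then obtain w where w: "(z, w) \<in> Q \<union> R" "(w, z) \<in> (Q \<union> R)\<^sup>*" by (meson tranclD)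
    have "W \<inter> V = {m}" using Q(3) by auto
    then show False
      using series_acyclic_aux[OF Q, of z w] series_acyclic_aux[of R W Q V m z w] Q a w
      by (auto simp: Un_commute)
  qed
qed

lemma bij_betw_Un_Pow:
  assumes "A \<inter> B = {}"
  shows "bij_betw (\<lambda>(F, G). F \<union> G) ({F. F \<subseteq> A \<and> X F} \<times> {G. G \<subseteq> B \<and> Y G})
    {F. F \<subseteq> A \<union> B \<and> X (F \<inter> A) \<and> Y (F \<inter> B)}"
proof -
  have *: "(F \<union> G) \<inter> A = F" "(F \<union> G) \<inter> B = G" if "F \<subseteq> A" "G \<subseteq> B" for F G
    using that assms by auto
  show ?thesis
    by (rule bij_betw_byWitness[where f' = "\<lambda>F. (F \<inter> A, F \<inter> B)"]) (use * in \<open>auto simp: Int_Un_distrib[symmetric]\<close>)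
qed

lemma card_Un_Pow:
  assumes "A \<inter> B = {}"
  shows "card {F. F \<subseteq> A \<union> B \<and> X (F \<inter> A) \<and> Y (F \<inter> B)} =
    card {F. F \<subseteq> A \<and> X F} * card {G. G \<subseteq> B \<and> Y G}"
  using bij_betw_same_card[OF bij_betw_Un_Pow[OF assms, of X Y]] by (simp add: card_cartesian_product)

text \<open>Differences split into their parts in \<open>V\<close> and in \<open>W\<close>, which
  meet only in \<open>m\<close>. So separation and forests factor, a maximal collection consists of
  all unions of a member of \<open>PA\<close> and a member of \<open>PB\<close>, and a path from
  \<open>v\<close> to \<open>u\<close> has to pass through \<open>m\<close>, which makes the order
  the strict product.\<close>

lemma strip_series:
  assumes A: "strip A t h v m" "finite A" "t ` A \<union> h ` A \<subseteq> V" "v \<in> V" "v \<noteq> m"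
    and B: "strip B t h m u" "finite B" "t ` B \<union> h ` B \<subseteq> W" "u \<in> W" "u \<noteq> m"
    and AB: "A \<inter> B = {}" "V \<inter> W = {m}"
  shows "strip (A \<union> B) t h v u"
proof -
  have sub: "darcs t h (I \<inter> A) (J \<inter> A) \<subseteq> V \<times> V" "darcs t h (I \<inter> B) (J \<inter> B) \<subseteq> W \<times> W" for I J
    using A(3) B(3) by (auto simp: darcs_def)
  have dec: "darcs t h I J = darcs t h (I \<inter> A) (J \<inter> A) \<union> darcs t h (I \<inter> B) (J \<inter> B)"
    if "I \<subseteq> A \<union> B" "J \<subseteq> A \<union> B" for I J
    using that AB(1) by (auto simp: darcs_def)
  have ac: "sep t h I J \<longleftrightarrow>
      sep t h (I \<inter> A) (J \<inter> A) \<and> sep t h (I \<inter> B) (J \<inter> B)"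
    if "I \<subseteq> A \<union> B" "J \<subseteq> A \<union> B" for I J
    unfolding dec[OF that] by (rule series_acyclic[OF sub AB(2)])
  have tc: "(v, u) \<in> (darcs t h I J)\<^sup>+ \<longleftrightarrow>
      (v, m) \<in> (darcs t h (I \<inter> A) (J \<inter> A))\<^sup>+ \<and> (m, u) \<in> (darcs t h (I \<inter> B) (J \<inter> B))\<^sup>+"
    if "I \<subseteq> A \<union> B" "J \<subseteq> A \<union> B" for I J
    unfolding dec[OF that] by (rule series_trancl[OF sub AB(2) A(4,5) B(4,5)])
  have up: "up t h v u I J \<longleftrightarrow> up t h v m (I \<inter> A) (J \<inter> A) \<and> up t h m u (I \<inter> B) (J \<inter> B)"
    if "I \<subseteq> A \<union> B" "J \<subseteq> A \<union> B" for I J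
    using tc[OF that] by (simp add: up_def)
  have Diff: "(F - P) \<inter> A = F \<inter> A - P \<inter> A" "(F - P) \<inter> B = F \<inter> B - P \<inter> B" for F P
    by auto
  have UnI: "\<exists>P\<subseteq>F. P \<inter> A = P1 \<and> P \<inter> B = P2" if "P1 \<subseteq> F \<inter> A" "P2 \<subseteq> F \<inter> B" for F P1 P2
    using that AB(1) by (intro exI[of _ "P1 \<union> P2"]) auto
  have indep: "indep t h F \<longleftrightarrow> indep t h (F \<inter> A) \<and> indep t h (F \<inter> B)" if F: "F \<subseteq> A \<union> B" for F
  proof -
    have "indep t h F \<longleftrightarrow> (\<forall>P\<subseteq>F. sep t h (P \<inter> A) (F \<inter> A - P \<inter> A) \<and>
        sep t h (P \<inter> B) (F \<inter> B - P \<inter> B))"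
      unfolding indep_def
    proof (intro all_cong1 imp_cong refl)
      fix P assume "P \<subseteq> F"
      then show "sep t h P (F - P) \<longleftrightarrow> sep t h (P \<inter> A) (F \<inter> A - P \<inter> A) \<and>
        sep t h (P \<inter> B) (F \<inter> B - P \<inter> B)"
        using ac[of P "F - P"] F unfolding Diff by blast
    qed
    also have "\<dots> \<longleftrightarrow> indep t h (F \<inter> A) \<and> indep t h (F \<inter> B)"
      unfolding indep_def by (metis UnI Int_lower1 Int_mono order_refl empty_subsetI)
    finally show ?thesis .
  qed
  have conn: "conn t h F v u \<longleftrightarrow> conn t h (F \<inter> A) v m \<and> conn t h (F \<inter> B) m u" if F: "F \<subseteq> A \<union> B" for F
  proof -
    have "conn t h F v u \<longleftrightarrow> (\<exists>P\<subseteq>F. (v, m) \<in> (darcs t h (P \<inter> A) (F \<inter> A - P \<inter> A))\<^sup>+ \<and>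
        (m, u) \<in> (darcs t h (P \<inter> B) (F \<inter> B - P \<inter> B))\<^sup>+)"
      unfolding conn_def
    proof (intro ex_cong1 conj_cong refl)
      fix P assume "P \<subseteq> F"
      then show "(v, u) \<in> (darcs t h P (F - P))\<^sup>+ \<longleftrightarrow> (v, m) \<in> (darcs t h (P \<inter> A) (F \<inter> A - P \<inter> A))\<^sup>+ \<and>
        (m, u) \<in> (darcs t h (P \<inter> B) (F \<inter> B - P \<inter> B))\<^sup>+"
        using tc[of P "F - P"] F unfolding Diff by blast
    qed
    also have "\<dots> \<longleftrightarrow> conn t h (F \<inter> A) v m \<and> conn t h (F \<inter> B) m u"
    proof
      assume "conn t h (F \<inter> A) v m \<and> conn t h (F \<inter> B) m u"
      then obtain P1 P2 where *: "P1 \<subseteq> F \<inter> A" "P2 \<subseteq> F \<inter> B"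
        "(v, m) \<in> (darcs t h P1 (F \<inter> A - P1))\<^sup>+" "(m, u) \<in> (darcs t h P2 (F \<inter> B - P2))\<^sup>+"
        unfolding conn_def by blast
      obtain P where "P \<subseteq> F" "P \<inter> A = P1" "P \<inter> B = P2" using UnI[OF *(1,2)] by blast
      then show "\<exists>P\<subseteq>F. (v, m) \<in> (darcs t h (P \<inter> A) (F \<inter> A - P \<inter> A))\<^sup>+ \<and>
        (m, u) \<in> (darcs t h (P \<inter> B) (F \<inter> B - P \<inter> B))\<^sup>+" using *(3,4) by blast
    next
      assume "\<exists>P\<subseteq>F. (v, m) \<in> (darcs t h (P \<inter> A) (F \<inter> A - P \<inter> A))\<^sup>+ \<and>
        (m, u) \<in> (darcs t h (P \<inter> B) (F \<inter> B - P \<inter> B))\<^sup>+"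
      then show "conn t h (F \<inter> A) v m \<and> conn t h (F \<inter> B) m u"
        unfolding conn_def by (meson Int_mono order_refl)
    qed
    finally show ?thesis .
  qed
  have nind: "nind (A \<union> B) t h = nind A t h * nind B t h"
  proof -
    have "{F. F \<subseteq> A \<union> B \<and> indep t h F} = {F. F \<subseteq> A \<union> B \<and> indep t h (F \<inter> A) \<and> indep t h (F \<inter> B)}"
      using indep by blast
    then show ?thesis
      unfolding nind_def using card_Un_Pow[OF AB(1), of "indep t h" "indep t h"] by simp
  qed
  have kcon: "kcon (A \<union> B) t h v u = kcon A t h v m * kcon B t h m u"
  proof -
    have "{F. F \<subseteq> A \<union> B \<and> indep t h F \<and> conn t h F v u} =
        {F. F \<subseteq> A \<union> B \<and> (indep t h (F \<inter> A) \<and> conn t h (F \<inter> A) v m) \<and>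
          (indep t h (F \<inter> B) \<and> conn t h (F \<inter> B) m u)}"
      using indep conn by blast
    then show ?thesis
      unfolding kcon_def
      using card_Un_Pow[OF AB(1), of "\<lambda>F. indep t h F \<and> conn t h F v m" "\<lambda>F. indep t h F \<and> conn t h F m u"]
      by simp
  qed
  note trA = strip_trans[OF A(1)] and trB = strip_trans[OF B(1)]
  note maxA = strip_max[OF A(1)] and maxB = strip_max[OF B(1)]
  have tr: "up t h v u I K" if *: "I \<subseteq> A \<union> B" "J \<subseteq> A \<union> B" "K \<subseteq> A \<union> B" "sep t h I J"
    "sep t h J K" "sep t h I K" "up t h v u I J" "up t h v u J K" for I J K
    using * trA[of "I \<inter> A" "J \<inter> A" "K \<inter> A"] trB[of "I \<inter> B" "J \<inter> B" "K \<inter> B"]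
    by (simp add: ac up)
  have "card P = nind (A \<union> B) t h \<and>
      (\<exists>N. good_cover P (up t h v u) N \<and> card N = kcon (A \<union> B) t h v u)"
    if P: "maximal_by_inclusion (sepcoll (A \<union> B) t h) P" for P
  proof -
    have sP: "sepcoll (A \<union> B) t h P" using P by (simp add: maximal_by_inclusion_def)
    then have subP: "I \<subseteq> A \<union> B" if "I \<in> P" for I using that by (auto simp: sepcoll_def)
    define PA where "PA = (\<lambda>I. I \<inter> A) ` P"
    define PB where "PB = (\<lambda>I. I \<inter> B) ` P"
    have UnA: "(I \<union> J) \<inter> A = I" "(I \<union> J) \<inter> B = J" if "I \<subseteq> A" "J \<subseteq> B" for I J
      using that AB(1) by auto
    have acP: "sep t h I J" if "I \<in> P" "J \<in> P" for I J
      using sP that by (auto simp: sepcoll_def)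
    have sA: "sepcoll A t h PA" and sB: "sepcoll B t h PB"
      using acP subP unfolding sepcoll_def PA_def PB_def by (auto simp: ac)
    have UnP: "I \<union> J \<in> P" if I: "I \<subseteq> A" "\<And>L. L \<in> PA \<Longrightarrow> sep t h I L"
      and J: "J \<subseteq> B" "\<And>L. L \<in> PB \<Longrightarrow> sep t h J L" for I J
    proof (rule maximal_sepcollD[OF P])
      show IJ: "I \<union> J \<subseteq> A \<union> B" using I J by auto
      fix L assume L: "L \<in> P"
      show "sep t h (I \<union> J) L"
        unfolding ac[OF IJ subP[OF L]] UnA[OF I(1) J(1)] using I J L by (auto simp: PA_def PB_def)
    qed
    have sA': "I \<subseteq> A" "\<And>L. L \<in> PA \<Longrightarrow> sep t h I L" if "I \<in> PA" for I
      using sA that by (auto simp: sepcoll_def)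
    have sB': "I \<subseteq> B" "\<And>L. L \<in> PB \<Longrightarrow> sep t h I L" if "I \<in> PB" for I
      using sB that by (auto simp: sepcoll_def)
    have "P \<noteq> {}" using maximal_sepcollD[OF P, of "{}"] by auto
    then obtain I0 where "I0 \<in> P" by auto
    then have I0: "I0 \<inter> A \<in> PA" "I0 \<inter> B \<in> PB" by (auto simp: PA_def PB_def)
    have maxPA: "maximal_by_inclusion (sepcoll A t h) PA"
    proof (rule maximal_sepcollI[OF sA])
      fix K assume K: "K \<subseteq> A" "\<And>I. I \<in> PA \<Longrightarrow> sep t h K I"
      have "K \<union> (I0 \<inter> B) \<in> P" using UnP[OF K sB'[OF I0(2)]] .
      then have "(K \<union> (I0 \<inter> B)) \<inter> A \<in> PA" unfolding PA_def by (rule imageI)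
      then show "K \<in> PA" using UnA[OF K(1), of "I0 \<inter> B"] by simp
    qed
    have maxPB: "maximal_by_inclusion (sepcoll B t h) PB"
    proof (rule maximal_sepcollI[OF sB])
      fix K assume K: "K \<subseteq> B" "\<And>I. I \<in> PB \<Longrightarrow> sep t h K I"
      have "(I0 \<inter> A) \<union> K \<in> P" using UnP[OF sA'[OF I0(1)] K] .
      then have "((I0 \<inter> A) \<union> K) \<inter> B \<in> PB" unfolding PB_def by (rule imageI)
      then show "K \<in> PB" using UnA[OF _ K(1), of "I0 \<inter> A"] by simp
    qed
    define \<phi> where "\<phi> = (\<lambda>(I, J). I \<union> J :: 'a set)"
    have im: "\<phi> ` (PA \<times> PB) = P"
    proof (intro equalityI subsetI)
      fix K assume "K \<in> \<phi> ` (PA \<times> PB)"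
      then obtain I J where "K = I \<union> J" "I \<in> PA" "J \<in> PB" by (auto simp: \<phi>_def)
      then show "K \<in> P" using UnP[OF sA' sB'] by blast
    next
      fix K assume K: "K \<in> P"
      then have "K = \<phi> (K \<inter> A, K \<inter> B)" using subP by (auto simp: \<phi>_def)
      moreover have "(K \<inter> A, K \<inter> B) \<in> PA \<times> PB" using K by (auto simp: PA_def PB_def)
      ultimately show "K \<in> \<phi> ` (PA \<times> PB)" by blast
    qed
    have inj: "inj_on \<phi> (PA \<times> PB)"
    proof (rule inj_onI, clarify)
      fix I J I' J' assume *: "I \<in> PA" "J \<in> PB" "I' \<in> PA" "J' \<in> PB" "\<phi> (I, J) = \<phi> (I', J')"
      then have "(I \<union> J) \<inter> A = (I' \<union> J') \<inter> A" "(I \<union> J) \<inter> B = (I' \<union> J') \<inter> B" by (auto simp: \<phi>_def)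
      then show "I = I' \<and> J = J'" using UnA * sA'(1) sB'(1) by metis
    qed
    obtain NA where NA: "good_cover PA (up t h v m) NA" "card NA = kcon A t h v m"
      using maxA(2)[OF maxPA] by blast
    obtain NB where NB: "good_cover PB (up t h m u) NB" "card NB = kcon B t h m u"
      using maxB(2)[OF maxPB] by blast
    have R: "up t h v u (\<phi> x) (\<phi> y) \<longleftrightarrow> up t h v m (fst x) (fst y) \<and> up t h m u (snd x) (snd y)"
      if "x \<in> PA \<times> PB" "y \<in> PA \<times> PB" for x y
    proof -
      obtain I J I' J' where xy: "x = (I, J)" "y = (I', J')" by fastforce
      then have s: "I \<subseteq> A" "J \<subseteq> B" "I' \<subseteq> A" "J' \<subseteq> B" using that sA'(1) sB'(1) by auto
      then have "I \<union> J \<subseteq> A \<union> B" "I' \<union> J' \<subseteq> A \<union> B" by auto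
      from up[OF this] show ?thesis unfolding xy \<phi>_def using UnA s by simp
    qed
    note prod = good_cover_prod[OF NA(1) NB(1)]
    note tp = good_cover_transport[OF prod(1) inj, of "up t h v u"]
    have "good_cover P (up t h v u) (map_prod \<phi> \<phi> ` (\<lambda>((p, p'), (q, q')). ((p, q), (p', q'))) ` (NA \<times> NB))"
      using tp(1) R im by simp
    moreover have "card (map_prod \<phi> \<phi> ` (\<lambda>((p, p'), (q, q')). ((p, q), (p', q'))) ` (NA \<times> NB)) =
        kcon (A \<union> B) t h v u"
      using tp(2) R prod(2) NA(2) NB(2) kcon by simp
    moreover have "card P = nind (A \<union> B) t h"
      using card_image[OF inj] im maxA(1)[OF maxPA] maxB(1)[OF maxPB] nind by (simp add: card_cartesian_product)
    ultimately show ?thesis by blast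
  qed
  with tr show ?thesis unfolding strip_def by blast
qed

lemma strip_empty:
  assumes "v \<noteq> u"
  shows "strip {} t h v u"
proof -
  have [simp]: "darcs t h {} {} = {}" by simp
  have "card P = nind {} t h \<and> (\<exists>N. good_cover P (up t h v u) N \<and> card N = kcon {} t h v u)"
    if P: "maximal_by_inclusion (sepcoll {} t h) P" for P
  proof -
    have "{} \<in> P" by (rule maximal_sepcollD[OF P]) (use P in \<open>auto simp: maximal_by_inclusion_def sepcoll_def\<close>)
    then have "P = {{}}" using P by (auto simp: maximal_by_inclusion_def sepcoll_def)
    moreover have "kcon {} t h v u = 0" by (simp add: kcon_def conn_def)
    moreover have "good_cover {{}} (up t h v u) {}" by (rule good_coverI) (auto simp: up_def)
    ultimately show ?thesis by auto
  qed
  then show ?thesis by (auto simp: strip_def up_def)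
qed

text \<open>Triangulations of the polygon with vertices \<open>i, \<dots>, j\<close>, with distinguished side \<open>{i, j}\<close>.\<close>

inductive tri :: "nat \<Rightarrow> nat \<Rightarrow> (nat \<times> nat) set \<Rightarrow> bool" where
  edge: "tri i (Suc i) {(i, Suc i)}"
| glue: "tri i m A \<Longrightarrow> tri m j B \<Longrightarrow> tri i j (insert (i, j) (A \<union> B))"

lemma tri_bounds: "tri i j A \<Longrightarrow> i < j \<and> finite A \<and> (\<forall>(a, b)\<in>A. i \<le> a \<and> a < b \<and> b \<le> j)"
  by (induction rule: tri.induct) force+

lemma strip_tri: "tri i j A \<Longrightarrow> strip A fst snd i j"
proof (induction rule: tri.induct)
  case (edge i)
  have "strip {} fst snd i (Suc i)" by (rule strip_empty) simp
  then show ?case using strip_edge[of "{}" fst snd i "Suc i" "(i, Suc i)"] by simp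
next
  case (glue i m A j B)
  have A: "i < m" "finite A" "\<forall>(a, b)\<in>A. i \<le> a \<and> a < b \<and> b \<le> m"
    and B: "m < j" "finite B" "\<forall>(a, b)\<in>B. m \<le> a \<and> a < b \<and> b \<le> j"
    using tri_bounds glue.hyps by auto
  have "strip (A \<union> B) fst snd i j"
  proof (rule strip_series[OF glue.IH(1) A(2) _ _ _ glue.IH(2) B(2)])
    show "fst ` A \<union> snd ` A \<subseteq> {i..m}" "fst ` B \<union> snd ` B \<subseteq> {m..j}" using A B by fastforce+
    show "A \<inter> B = {}" using A B by fastforce
  qed (use A B in auto)
  then show ?case
    by (rule strip_edge) (use A B in \<open>fastforce+\<close>)
qed

lemma mpure_tri: "tri i j A \<Longrightarrow> mpure A fst snd"
  using strip_tri unfolding strip_def mpure_def by blast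

text \<open>The triangle on the side \<open>{i, j}\<close> gets as its apex \<open>m\<close> the
  farthest neighbour of \<open>i\<close> before \<open>j\<close>: no arc from \<open>i\<close> ends
  strictly between \<open>m\<close> and \<open>j\<close>, and an arc that starts strictly between
  \<open>i\<close> and \<open>m\<close> and ends beyond \<open>m\<close> would cross
  \<open>{i, m}\<close>.\<close>

lemma noncrossing_tri:
  assumes nc: "\<And>a b c d. (a, b) \<in> R \<Longrightarrow> (c, d) \<in> R \<Longrightarrow> \<not> (a < c \<and> c < b \<and> b < d)"
    and "i < j"
  shows "\<exists>A. tri i j A \<and> {(a, b)\<in>R. i \<le> a \<and> a < b \<and> b \<le> j} \<subseteq> A"
  using assms(2)
proof (induction "j - i" arbitrary: i j rule: less_induct)
  case less
  show ?case
  proof (cases "j = Suc i")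
    case True
    then have "{(a, b)\<in>R. i \<le> a \<and> a < b \<and> b \<le> j} \<subseteq> {(i, Suc i)}" by auto
    then show ?thesis using tri.edge True by blast
  next
    case False
    \<comment> \<open>\<open>Suc i\<close> is the default apex. If it is chosen, no arc can start
      strictly between \<open>i\<close> and \<open>m\<close>, so that \<open>(i, m)\<close> need not
      be in \<open>R\<close>.\<close>
    define M where "M = {b. i < b \<and> b < j \<and> ((i, b) \<in> R \<or> b = Suc i)}"
    define m where "m = Max M"
    have M: "finite M" "Suc i \<in> M" using False less.prems by (auto simp: M_def)
    then have "m \<in> M" unfolding m_def by (metis Max_in empty_iff)
    then have m: "i < m" "m < j" "(i, m) \<in> R \<or> m = Suc i" by (auto simp: M_def)
    have mM: "b \<le> m" if "b \<in> M" for b using that M unfolding m_def by simp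
    have "m - i < j - i" "j - m < j - i" using m by arith+
    note IH = less.hyps[OF this(1) m(1)] less.hyps[OF this(2) m(2)]
    obtain A where A: "tri i m A" "{(a, b)\<in>R. i \<le> a \<and> a < b \<and> b \<le> m} \<subseteq> A"
      using IH(1) by blast
    obtain B where B: "tri m j B" "{(a, b)\<in>R. m \<le> a \<and> a < b \<and> b \<le> j} \<subseteq> B"
      using IH(2) by blast
    have "(a, b) \<in> insert (i, j) (A \<union> B)" if ab: "(a, b) \<in> R" "i \<le> a" "a < b" "b \<le> j" for a b
    proof (cases "b \<le> m \<or> m \<le> a")
      case True
      then show ?thesis using ab A B by auto
    next
      case False
      show ?thesis
      proof (cases "a = i")
        case True
        then have "b = j" using mM[of b] ab False m by (force simp: M_def)
        then show ?thesis using True by simp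
      next
        case aF: False
        then have "(i, m) \<in> R" using m ab False by auto
        then show ?thesis using nc[of i m a b] ab False aF by auto
      qed
    qed
    then have "{(a, b)\<in>R. i \<le> a \<and> a < b \<and> b \<le> j} \<subseteq> insert (i, j) (A \<union> B)" by auto
    then show ?thesis using tri.glue[OF A(1) B(1)] by blast
  qed
qed

section \<open>Graphs and graphical oriented matroids\<close>

lemma maximal_transport:
  assumes inj: "inj_on \<phi> X" and P: "\<And>S. P S \<longleftrightarrow> S \<subseteq> X \<and> Q (\<phi> ` S)" and Q: "\<And>T. Q T \<Longrightarrow> T \<subseteq> \<phi> ` X"
  shows "(\<forall>S. maximal_by_inclusion P S \<longrightarrow> card S = n) \<longleftrightarrow>
         (\<forall>T. maximal_by_inclusion Q T \<longrightarrow> card T = n)"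
proof -
  have max: "maximal_by_inclusion P S \<longleftrightarrow> maximal_by_inclusion Q (\<phi> ` S)" if S: "S \<subseteq> X" for S
  proof
    assume "maximal_by_inclusion P S"
    then have PS: "P S" and m: "\<And>T. P T \<Longrightarrow> S \<subseteq> T \<Longrightarrow> T = S"
      unfolding maximal_by_inclusion_def by iprover+
    have "T = \<phi> ` S" if T: "Q T" "\<phi> ` S \<subseteq> T" for T
    proof -
      obtain U where U: "U \<subseteq> X" "T = \<phi> ` U" using Q[OF T(1)] by (metis subset_imageE)
      have "P U" using P[of U] T(1) U by simp
      moreover have "S \<subseteq> U" using T(2) U S inj_on_image_mem_iff[OF inj] by blast
      ultimately show ?thesis using m[of U] U by simp
    qed
    moreover have "Q (\<phi> ` S)" using PS P[of S] by simp
    ultimately show "maximal_by_inclusion Q (\<phi> ` S)" unfolding maximal_by_inclusion_def by iprover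
  next
    assume "maximal_by_inclusion Q (\<phi> ` S)"
    then have QS: "Q (\<phi> ` S)" and m: "\<And>T. Q T \<Longrightarrow> \<phi> ` S \<subseteq> T \<Longrightarrow> T = \<phi> ` S"
      unfolding maximal_by_inclusion_def by iprover+
    have "U = S" if U: "P U" "S \<subseteq> U" for U
    proof -
      have UX: "U \<subseteq> X" "Q (\<phi> ` U)" using U P[of U] by simp_all
      then have "\<phi> ` U = \<phi> ` S" using m[of "\<phi> ` U"] U(2) by blast
      then show ?thesis using inj_on_image_eq_iff[OF inj UX(1) S] by simp
    qed
    moreover have "P S" using QS P[of S] S by simp
    ultimately show "maximal_by_inclusion P S" unfolding maximal_by_inclusion_def by iprover
  qed
  have c: "card (\<phi> ` S) = card S" if "S \<subseteq> X" for S
    using inj that by (meson card_image inj_on_subset)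
  show ?thesis
  proof (intro iffI allI impI)
    fix T assume a: "\<forall>S. maximal_by_inclusion P S \<longrightarrow> card S = n" and T: "maximal_by_inclusion Q T"
    then have "Q T" by (simp add: maximal_by_inclusion_def)
    then obtain U where U: "U \<subseteq> X" "T = \<phi> ` U" using Q[of T] by (metis subset_imageE)
    then have "maximal_by_inclusion P U" using max[OF U(1)] T by simp
    then show "card T = n" using a c[OF U(1)] U(2) by simp
  next
    fix S assume a: "\<forall>T. maximal_by_inclusion Q T \<longrightarrow> card T = n" and S: "maximal_by_inclusion P S"
    then have "P S" by (simp add: maximal_by_inclusion_def)
    then have SX: "S \<subseteq> X" using P[of S] by simp
    then have "maximal_by_inclusion Q (\<phi> ` S)" using max[OF SX] S by simp
    then show "card S = n" using a c[OF SX] by simp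
  qed
qed

lemma mpure_cong:
  assumes "\<And>I J. I \<subseteq> A \<Longrightarrow> J \<subseteq> A \<Longrightarrow> sep t h I J \<longleftrightarrow> sep t' h' I J"
  shows "mpure A t h \<longleftrightarrow> mpure A t' h'"
proof -
  have "sepcoll A t h S \<longleftrightarrow> sepcoll A t' h' S" for S
    unfolding sepcoll_def using assms by (auto simp: subset_iff)
  then have "sepcoll A t h = sepcoll A t' h'" by blast
  moreover have "indep t h F \<longleftrightarrow> indep t' h' F" if "F \<subseteq> A" for F
  proof -
    have "sep t h P (F - P) \<longleftrightarrow> sep t' h' P (F - P)" if "P \<subseteq> F" for P
      using that \<open>F \<subseteq> A\<close> by (intro assms) auto
    then show ?thesis by (simp add: indep_def)
  qed
  then have "{F. F \<subseteq> A \<and> indep t h F} = {F. F \<subseteq> A \<and> indep t' h' F}" by auto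
  then have "nind A t h = nind A t' h'" by (simp add: nind_def)
  ultimately show ?thesis by (simp add: mpure_def)
qed

lemma acyclic_map_prod_inj:
  assumes "inj_on s W" "Q \<subseteq> W \<times> W"
  shows "acyclic (map_prod s s ` Q) \<longleftrightarrow> acyclic Q"
proof
  assume "acyclic Q"
  moreover have "map_prod (inv_into W s) (inv_into W s) ` map_prod s s ` Q = Q"
    using assms by (force simp: image_image)
  ultimately show "acyclic (map_prod s s ` Q)" using acyclic_map_prodD by metis
qed (rule acyclic_map_prodD)

lemma mpure_vertices:
  assumes "inj_on s (t ` A \<union> h ` A)"
  shows "mpure A (s \<circ> t) (s \<circ> h) \<longleftrightarrow> mpure A t h"
proof (rule mpure_cong)
  fix I J assume "I \<subseteq> A" "J \<subseteq> A"
  then have "darcs t h I J \<subseteq> (t ` A \<union> h ` A) \<times> (t ` A \<union> h ` A)" by (auto simp: darcs_def)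
  then show "sep (s \<circ> t) (s \<circ> h) I J \<longleftrightarrow> sep t h I J"
    unfolding darcs_comp by (rule acyclic_map_prod_inj[OF assms])
qed

lemma mpure_image:
  assumes "inj_on p A"
  shows "mpure (p ` A) t h \<longleftrightarrow> mpure A (t \<circ> p) (h \<circ> p)"
proof -
  have d: "darcs t h (p ` I) (p ` J) = darcs (t \<circ> p) (h \<circ> p) I J" if "I \<subseteq> A" "J \<subseteq> A" for I J
  proof -
    have "p ` I - p ` J = p ` (I - J)" "p ` J - p ` I = p ` (J - I)"
      using assms that by (auto simp: inj_on_def)
    then show ?thesis by (simp add: darcs_def image_image)
  qed
  have inj: "inj_on (image p) (Pow A)" using assms by (rule inj_on_image_Pow)
  have ip: "image p ` Pow A = Pow (p ` A)" by (rule image_Pow_surj) simp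
  have ind: "indep t h (p ` F) \<longleftrightarrow> indep (t \<circ> p) (h \<circ> p) F" if F: "F \<subseteq> A" for F
  proof -
    have "p ` F - p ` P = p ` (F - P)" if "P \<subseteq> F" for P
      using assms that F by (auto simp: inj_on_def)
    then have *: "darcs t h (p ` P) (p ` F - p ` P) = darcs (t \<circ> p) (h \<circ> p) P (F - P)" if "P \<subseteq> F" for P
      using d[of P "F - P"] that order_trans[OF that F] order_trans[OF Diff_subset F] by simp
    show ?thesis
    proof
      assume i: "indep t h (p ` F)"
      have "sep t h (p ` P) (p ` F - p ` P)" if "P \<subseteq> F" for P
        using i image_mono[OF that] unfolding indep_def by iprover
      then show "indep (t \<circ> p) (h \<circ> p) F" using * by (simp add: indep_def)
    next
      assume i: "indep (t \<circ> p) (h \<circ> p) F"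
      have "sep t h P' (p ` F - P')" if P': "P' \<subseteq> p ` F" for P'
      proof -
        obtain P where "P \<subseteq> F" "P' = p ` P" using P' by (metis subset_imageE)
        then show ?thesis using i *[of P] by (simp add: indep_def)
      qed
      then show "indep t h (p ` F)" by (simp add: indep_def)
    qed
  qed
  have "bij_betw (image p) {F. F \<subseteq> A \<and> indep (t \<circ> p) (h \<circ> p) F} {F. F \<subseteq> p ` A \<and> indep t h F}"
  proof (rule bij_betw_imageI)
    show "inj_on ((`) p) {F. F \<subseteq> A \<and> indep (t \<circ> p) (h \<circ> p) F}"
      using inj by (rule inj_on_subset) auto
    show "(`) p ` {F. F \<subseteq> A \<and> indep (t \<circ> p) (h \<circ> p) F} = {F. F \<subseteq> p ` A \<and> indep t h F}"
      using ind by (auto simp: subset_image_iff)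
  qed
  then have n: "nind (p ` A) t h = nind A (t \<circ> p) (h \<circ> p)"
    unfolding nind_def by (simp only: bij_betw_same_card)
  have "sepcoll A (t \<circ> p) (h \<circ> p) S \<longleftrightarrow> S \<subseteq> Pow A \<and> sepcoll (p ` A) t h (image p ` S)" for S
  proof -
    have "(\<forall>I\<in>S. \<forall>J\<in>S. sep t h (p ` I) (p ` J)) \<longleftrightarrow>
        (\<forall>I\<in>S. \<forall>J\<in>S. sep (t \<circ> p) (h \<circ> p) I J)" if "S \<subseteq> Pow A"
    proof (intro ball_cong refl)
      fix I J assume "I \<in> S" "J \<in> S"
      then have "I \<subseteq> A" "J \<subseteq> A" using that by auto
      then show "sep t h (p ` I) (p ` J) \<longleftrightarrow> sep (t \<circ> p) (h \<circ> p) I J"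
        using d by simp
    qed
    moreover have "image p ` S \<subseteq> Pow (p ` A)" if "S \<subseteq> Pow A" using that ip by blast
    ultimately show ?thesis unfolding sepcoll_def by auto
  qed
  note tr = maximal_transport[OF inj this]
  have "T \<subseteq> image p ` Pow A" if "sepcoll (p ` A) t h T" for T
    using that ip by (simp add: sepcoll_def)
  from tr[OF this] show ?thesis unfolding mpure_def n by blast
qed

section \<open>Directed cycles as lists of vertices\<close>

lemma rtrancl_distinct_path:
  assumes "(x, y) \<in> r\<^sup>*"
  shows "\<exists>xs. xs \<noteq> [] \<and> hd xs = x \<and> last xs = y \<and> distinct xs \<and> successively (\<lambda>a b. (a, b) \<in> r) xs"
  using assms
proof (induction rule: rtrancl_induct)
  case base
  then show ?case by (intro exI[of _ "[x]"]) simp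
next
  case (step y z)
  then obtain xs where xs: "xs \<noteq> []" "hd xs = x" "last xs = y" "distinct xs"
    "successively (\<lambda>a b. (a, b) \<in> r) xs" by blast
  show ?case
  proof (cases "z \<in> set xs")
    case True
    then obtain us vs where "xs = us @ z # vs" by (meson split_list)
    then show ?thesis using xs
      by (intro exI[of _ "us @ [z]"]) (auto simp: successively_append_iff hd_append split: if_splits)
  next
    case False
    then show ?thesis using xs step(2)
      by (intro exI[of _ "xs @ [z]"]) (auto simp: successively_append_iff)
  qed
qed

lemma successively_rtrancl:
  "successively (\<lambda>a b. (a, b) \<in> r) (x # xs) \<Longrightarrow> (x, last (x # xs)) \<in> r\<^sup>*"
proof (induction xs arbitrary: x)
  case (Cons y ys)
  then have "(x, y) \<in> r" "(y, last (y # ys)) \<in> r\<^sup>*" by auto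
  then show ?case by (metis converse_rtrancl_into_rtrancl last_ConsR list.distinct(1))
qed simp

lemma directed_along_iff:
  assumes "vs \<noteq> []"
  shows "directed_along D vs \<longleftrightarrow> successively (\<lambda>a b. (a, b) \<in> D) vs \<and> (last vs, hd vs) \<in> D"
proof -
  have "directed_along D vs \<longleftrightarrow> (\<forall>i. Suc i < length vs \<longrightarrow> (vs ! i, vs ! Suc i) \<in> D) \<and>
      (vs ! (length vs - 1), vs ! 0) \<in> D" (is "?L \<longleftrightarrow> ?R")
  proof
    assume L: ?L
    have "(vs ! i, vs ! Suc i) \<in> D" if "Suc i < length vs" for i
      using L that unfolding directed_along_def by (metis Suc_eq_plus1 Suc_lessD mod_less)
    moreover have "(vs ! (length vs - 1), vs ! 0) \<in> D"
      using L assms unfolding directed_along_def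
      by (metis Suc_eq_plus1 Suc_pred' diff_less length_greater_0_conv mod_self zero_less_one)
    ultimately show ?R by blast
  next
    assume R: ?R
    show ?L unfolding directed_along_def
    proof (intro allI impI)
      fix i assume "i < length vs"
      then consider "Suc i < length vs" | "i = length vs - 1" "Suc i = length vs" by linarith
      then show "(vs ! i, vs ! ((i + 1) mod length vs)) \<in> D"
        by cases (use R in auto)
    qed
  qed
  then show ?thesis
    using assms by (simp add: successively_conv_nth last_conv_nth hd_conv_nth)
qed

lemma directed_along_rev: "vs \<noteq> [] \<Longrightarrow> directed_along D (rev vs) \<longleftrightarrow> directed_along (D\<inverse>) vs"
  by (auto simp: directed_along_iff hd_rev last_rev)

lemma is_cycle_iff:
  "is_cycle E vs \<longleftrightarrow> length vs \<ge> 3 \<and> distinct vs \<and> directed_along {(x, y). {x, y} \<in> E} vs"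
  by (auto simp: is_cycle_def directed_along_def)

lemma directed_along_mono: "directed_along C vs \<Longrightarrow> C \<subseteq> D \<Longrightarrow> directed_along D vs"
  by (auto simp: directed_along_def)

lemma directed_along_not_acyclic:
  assumes "vs \<noteq> []" "directed_along r vs"
  shows "\<not> acyclic r"
proof -
  obtain x xs where vs: "vs = x # xs" using assms(1) by (cases vs) auto
  have "(x, last vs) \<in> r\<^sup>*" "(last vs, x) \<in> r"
    using assms successively_rtrancl[of r x xs] by (auto simp: directed_along_iff vs)
  then show ?thesis by (meson acyclic_def rtrancl_into_trancl1)
qed

text \<open>A path without repetitions that is closed by one arc gives the list. Antisymmetry of
  \<open>r\<close> rules out lengths 1 and 2, which \<open>is_cycle\<close> does not admit.\<close>

lemma not_acyclic_cycle:
  assumes "\<not> acyclic r" "r \<subseteq> {(x, y). {x, y} \<in> E}" "\<And>x y. (x, y) \<in> r \<Longrightarrow> (y, x) \<notin> r"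
  shows "\<exists>vs. is_cycle E vs \<and> directed_along r vs"
proof -
  obtain z where "(z, z) \<in> r\<^sup>+" using assms(1) by (auto simp: acyclic_def)
  then obtain w where w: "(z, w) \<in> r" "(w, z) \<in> r\<^sup>*" by (meson tranclD)
  obtain vs where vs: "vs \<noteq> []" "hd vs = w" "last vs = z" "distinct vs"
    "successively (\<lambda>a b. (a, b) \<in> r) vs" using rtrancl_distinct_path[OF w(2)] by blast
  have d: "directed_along r vs" using vs w by (simp add: directed_along_iff)
  have "length vs \<ge> 3"
  proof (rule ccontr)
    assume "\<not> 3 \<le> length vs"
    moreover have "length vs > 0" using vs(1) by simp
    ultimately consider "length vs = 1" | "length vs = 2" by linarith
    then show False
    proof cases
      case 1
      then have "w = z" using vs by (auto simp: length_Suc_conv)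
      then show False using w assms(3) by blast
    next
      case 2
      then have "(w, z) \<in> r" using vs by (auto simp: length_Suc_conv numeral_2_eq_2)
      then show False using w assms(3) by blast
    qed
  qed
  moreover have "directed_along {(x, y). {x, y} \<in> E} vs" using d assms(2) by (rule directed_along_mono)
  ultimately show ?thesis using d vs(4) by (auto simp: is_cycle_iff)
qed

section \<open>Orientations as subsets of a reference orientation\<close>

context
  fixes V :: "'a set" and E :: "'a set set" and D :: "('a \<times> 'a) set"
  assumes G: "simple_graph V E" and D: "total_orientation V E D"
begin

lemma orientation_facts:
  assumes "total_orientation V E O1"
  shows "(x, y) \<in> O1 \<Longrightarrow> {x, y} \<in> E" "(x, y) \<in> O1 \<Longrightarrow> (y, x) \<notin> O1" "{x, y} \<in> E \<Longrightarrow> (x, y) \<notin> O1 \<Longrightarrow> (y, x) \<in> O1"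
proof -
  show e: "(x, y) \<in> O1 \<Longrightarrow> {x, y} \<in> E" for x y using assms by (auto simp: total_orientation_def)
  have "{x, y} \<in> E \<Longrightarrow> (x, y) \<in> O1 \<longleftrightarrow> (y, x) \<notin> O1" for x y
    using assms unfolding total_orientation_def by blast
  then show "(x, y) \<in> O1 \<Longrightarrow> (y, x) \<notin> O1" "{x, y} \<in> E \<Longrightarrow> (x, y) \<notin> O1 \<Longrightarrow> (y, x) \<in> O1"
    using e by blast+
qed

lemma orientation_cases:
  assumes "total_orientation V E O1"
  shows "{x, y} \<notin> E \<and> (x, y) \<notin> O1 \<and> (y, x) \<notin> O1 \<or>
    {x, y} \<in> E \<and> (x, y) \<in> O1 \<and> (y, x) \<notin> O1 \<or> {x, y} \<in> E \<and> (x, y) \<notin> O1 \<and> (y, x) \<in> O1"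
proof -
  have "{y, x} = {x, y}" by auto
  then show ?thesis
    using orientation_facts[OF assms, of x y] orientation_facts[OF assms, of y x] by metis
qed

lemma finite_orientation: "finite D"
proof (rule finite_subset)
  show "D \<subseteq> V \<times> V" using orientation_facts(1)[OF D] G by (fastforce simp: simple_graph_def)
  show "finite (V \<times> V)" using G by (auto simp: simple_graph_def)
qed

text \<open>An arc of \<open>O1 - O2\<close> that agrees with the reference orientation comes from
  an element of \<open>O1\<close> only, and one against it from an element of \<open>O2\<close>
  only.\<close>

lemma darcs_orientations:
  assumes "total_orientation V E O1" "total_orientation V E O2"
  shows "darcs fst snd (O1 \<inter> D) (O2 \<inter> D) = O1 - O2"
proof -
  have "darcs fst snd (O1 \<inter> D) (O2 \<inter> D) = (O1 \<inter> D - O2) \<union> (O2 \<inter> D - O1)\<inverse>"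
    by (force simp: darcs_def)
  also have "(x, y) \<in> \<dots> \<longleftrightarrow> (x, y) \<in> O1 - O2" for x y
    using orientation_cases[OF assms(1), of x y] orientation_cases[OF assms(2), of x y]
      orientation_cases[OF D, of x y] by auto
  then have "(O1 \<inter> D - O2) \<union> (O2 \<inter> D - O1)\<inverse> = O1 - O2" by auto
  finally show ?thesis .
qed

lemma G_separated_iff:
  assumes O: "total_orientation V E O1" "total_orientation V E O2"
  shows "G_separated E O1 O2 \<longleftrightarrow> acyclic (O1 - O2)"
proof
  assume s: "G_separated E O1 O2"
  show "acyclic (O1 - O2)"
  proof (rule ccontr)
    assume "\<not> acyclic (O1 - O2)"
    moreover have "O1 - O2 \<subseteq> {(x, y). {x, y} \<in> E}" using orientation_facts(1)[OF O(1)] by auto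
    ultimately obtain vs where vs: "is_cycle E vs" "directed_along (O1 - O2) vs"
      using not_acyclic_cycle[of "O1 - O2" E] orientation_facts(2)[OF O(1)] by (metis Diff_iff)
    \<comment> \<open>An arc of \<open>O1\<close> missing from \<open>O2\<close> is reversed there,
      so a cycle of such arcs is directed oppositely in the two orientations.\<close>
    have "O1 - O2 \<subseteq> O2\<inverse>" using orientation_facts(1)[OF O(1)] orientation_facts(3)[OF O(2)] by auto
    then have "directed_along O1 vs" "directed_along (O2\<inverse>) vs"
      using vs(2) directed_along_mono by blast+
    moreover have "vs \<noteq> []" using vs(1) by (auto simp: is_cycle_def)
    ultimately show False using s vs(1) by (auto simp: G_separated_def directed_along_rev)
  qed
next
  assume a: "acyclic (O1 - O2)"
  show "G_separated E O1 O2" unfolding G_separated_def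
  proof
    assume "\<exists>vs. is_cycle E vs \<and> directed_along O1 vs \<and> directed_along O2 (rev vs)"
    then obtain vs where vs: "is_cycle E vs" "directed_along O1 vs" "directed_along O2 (rev vs)" by blast
    have ne: "vs \<noteq> []" using vs(1) by (auto simp: is_cycle_def)
    have "directed_along (O1 - O2) vs"
      using vs(2,3) orientation_facts(2)[OF O(2)] ne
      by (auto simp: directed_along_rev) (auto simp: directed_along_def)
    then show False using a directed_along_not_acyclic[OF ne] by blast
  qed
qed

lemma orientations_bij:
  "bij_betw (\<lambda>O1. O1 \<inter> D) {O1. total_orientation V E O1} (Pow D)"
proof (rule bij_betw_byWitness[where f' = "\<lambda>I. I \<union> (D - I)\<inverse>"])
  show "\<forall>O1\<in>{O1. total_orientation V E O1}. O1 \<inter> D \<union> (D - O1 \<inter> D)\<inverse> = O1"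
  proof
    fix O1 assume "O1 \<in> {O1. total_orientation V E O1}"
    then have O1: "total_orientation V E O1" by simp
    show "O1 \<inter> D \<union> (D - O1 \<inter> D)\<inverse> = O1"
    proof -
      have "(x, y) \<in> O1 \<inter> D \<union> (D - O1 \<inter> D)\<inverse> \<longleftrightarrow> (x, y) \<in> O1" for x y
        using orientation_cases[OF O1, of x y] orientation_cases[OF D, of x y] by auto
      then show ?thesis by auto
    qed
  qed
  show "\<forall>I\<in>Pow D. (I \<union> (D - I)\<inverse>) \<inter> D = I"
    using orientation_facts(2)[OF D] by auto
  show "(\<lambda>I. I \<union> (D - I)\<inverse>) ` Pow D \<subseteq> {O1. total_orientation V E O1}"
  proof clarify
    fix I assume I: "I \<subseteq> D"
    have "I \<union> (D - I)\<inverse> \<subseteq> {(x, y). {x, y} \<in> E}"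
      using I orientation_facts(1)[OF D] by (force simp: insert_commute)
    moreover have "(x, y) \<in> I \<union> (D - I)\<inverse> \<longleftrightarrow> (y, x) \<notin> I \<union> (D - I)\<inverse>" if "{x, y} \<in> E" for x y
      using I orientation_cases[OF D, of x y] that by auto
    ultimately show "total_orientation V E (I \<union> (D - I)\<inverse>)"
      unfolding total_orientation_def by blast
  qed
qed auto

lemma forest_iff_indep:
  assumes F: "F \<subseteq> E"
  shows "forest F \<longleftrightarrow> indep fst snd {a\<in>D. {fst a, snd a} \<in> F}" (is "_ \<longleftrightarrow> indep _ _ ?F")
proof
  assume f: "forest F"
  show "indep fst snd ?F" unfolding indep_def
  proof (intro allI impI, rule ccontr)
    fix P assume P: "P \<subseteq> ?F" "\<not> sep fst snd P (?F - P)"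
    have d: "darcs fst snd P (?F - P) = P \<union> (?F - P)\<inverse>" using P(1) by (force simp: darcs_def)
    have "\<exists>vs. is_cycle F vs \<and> directed_along (darcs fst snd P (?F - P)) vs"
    proof (rule not_acyclic_cycle[OF P(2)])
      show "darcs fst snd P (?F - P) \<subseteq> {(x, y). {x, y} \<in> F}"
        unfolding d using P(1) by (force simp: insert_commute)
      show "(y, x) \<notin> darcs fst snd P (?F - P)" if "(x, y) \<in> darcs fst snd P (?F - P)" for x y
        using that P(1) orientation_facts(2)[OF D] unfolding d by blast
    qed
    then show False using f by (auto simp: forest_def)
  qed
next
  assume i: "indep fst snd ?F"
  show "forest F" unfolding forest_def
  proof
    assume "\<exists>vs. is_cycle F vs"
    then obtain vs where vs: "is_cycle F vs" by blast
    define r where "r = {(vs ! i, vs ! ((i + 1) mod length vs)) | i. i < length vs}"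
    have len: "length vs \<ge> 3" and dist: "distinct vs" using vs by (auto simp: is_cycle_def)
    have "directed_along r vs" by (auto simp: directed_along_def r_def)
    then have nac: "\<not> acyclic r" using len by (intro directed_along_not_acyclic) auto
    have rF: "{x, y} \<in> F" if "(x, y) \<in> r" for x y using vs that by (auto simp: r_def is_cycle_def)
    have anti: "(y, x) \<notin> r" if xy: "(x, y) \<in> r" for x y
    proof
      assume "(y, x) \<in> r"
      then obtain i j where ij: "i < length vs" "j < length vs" "x = vs ! i" "y = vs ! ((i + 1) mod length vs)"
        "y = vs ! j" "x = vs ! ((j + 1) mod length vs)" using xy unfolding r_def by blast
      \<comment> \<open>Two positions can be cyclic successors of each other only in a list of
        length at most 2.\<close>
      have "j = (i + 1) mod length vs" "i = (j + 1) mod length vs"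
        using ij len dist by (metis mod_less_divisor nth_eq_iff_index_eq less_le_trans zero_less_numeral)+
      then show False using ij(1,2) len by (auto simp: mod_Suc split: if_splits)
    qed
    \<comment> \<open>The orientation that follows the cycle: \<open>?P\<close> collects the
      elements whose reference direction agrees with the traversal.\<close>
    let ?P = "?F \<inter> r"
    have "r \<subseteq> darcs fst snd ?P (?F - ?P)"
    proof
      fix e assume e: "e \<in> r"
      obtain x y where xy: "e = (x, y)" by fastforce
      show "e \<in> darcs fst snd ?P (?F - ?P)"
      proof (cases "(x, y) \<in> D")
        case True
        then have "e \<in> ?P - (?F - ?P)" using e rF xy by auto
        then show ?thesis by (force simp: darcs_def)
      next
        case False
        then have "(y, x) \<in> D" using orientation_facts(3)[OF D, of x y] rF e xy F by auto
        then have "(y, x) \<in> ?F - ?P - ?P" using e rF[of x y] xy anti by (auto simp: insert_commute)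
        then show ?thesis unfolding darcs_def xy by force
      qed
    qed
    then have "\<not> sep fst snd ?P (?F - ?P)" using nac by (meson acyclic_subset)
    moreover have "sep fst snd ?P (?F - ?P)"
      using i[unfolded indep_def] by (rule allE[of _ ?P]) simp
    ultimately show False by simp
  qed
qed

lemma card_forests: "card (forests E) = nind D fst snd"
proof -
  have "bij_betw (\<lambda>F. {a\<in>D. {fst a, snd a} \<in> F}) (forests E) {I. I \<subseteq> D \<and> indep fst snd I}"
  proof (rule bij_betw_byWitness[where f' = "image (\<lambda>a. {fst a, snd a})"])
    have gF: "(\<lambda>a. {fst a, snd a}) ` {a\<in>D. {fst a, snd a} \<in> F} = F" if F: "F \<subseteq> E" for F
    proof (intro equalityI subsetI)
      fix e assume e: "e \<in> F"
      then have "card e = 2" using F G by (auto simp: simple_graph_def)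
      then obtain x y where xy: "e = {x, y}" by (auto simp: card_2_iff)
      then have "(x, y) \<in> D \<or> (y, x) \<in> D" using orientation_facts(3)[OF D, of x y] e F by auto
      then show "e \<in> (\<lambda>a. {fst a, snd a}) ` {a\<in>D. {fst a, snd a} \<in> F}"
        using e xy by (force simp: image_iff insert_commute)
    qed auto
    have gI: "{a\<in>D. {fst a, snd a} \<in> (\<lambda>a. {fst a, snd a}) ` I} = I" if I: "I \<subseteq> D" for I
    proof (intro equalityI subsetI)
      fix a assume a: "a \<in> {a\<in>D. {fst a, snd a} \<in> (\<lambda>a. {fst a, snd a}) ` I}"
      then obtain b where b: "b \<in> I" "{fst a, snd a} = {fst b, snd b}" by auto
      then have "a = b \<or> a = (snd b, fst b)" by (cases a; cases b) (auto simp: doubleton_eq_iff)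
      then show "a \<in> I" using a b I orientation_facts(2)[OF D, of "fst b" "snd b"] by auto
    qed (use I in auto)
    show "\<forall>F\<in>forests E. (\<lambda>a. {fst a, snd a}) ` {a\<in>D. {fst a, snd a} \<in> F} = F"
      using gF by (auto simp: forests_def)
    show "\<forall>I\<in>{I. I \<subseteq> D \<and> indep fst snd I}. {a\<in>D. {fst a, snd a} \<in> (\<lambda>a. {fst a, snd a}) ` I} = I"
      using gI by blast
    show "(\<lambda>F. {a\<in>D. {fst a, snd a} \<in> F}) ` forests E \<subseteq> {I. I \<subseteq> D \<and> indep fst snd I}"
      using forest_iff_indep by (auto simp: forests_def)
    show "(\<lambda>I. (\<lambda>a. {fst a, snd a}) ` I) ` {I. I \<subseteq> D \<and> indep fst snd I} \<subseteq> forests E"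
    proof clarify
      fix I assume I: "I \<subseteq> D" "indep fst snd I"
      have sub: "(\<lambda>a. {fst a, snd a}) ` I \<subseteq> E" using I orientation_facts(1)[OF D] by auto
      then show "(\<lambda>a. {fst a, snd a}) ` I \<in> forests E"
        using forest_iff_indep[OF sub] gI[OF I(1)] I(2) by (simp add: forests_def)
    qed
  qed
  then show ?thesis unfolding nind_def by (rule bij_betw_same_card)
qed

lemma graph_pure_iff: "graph_pure V E \<longleftrightarrow> mpure D fst snd"
proof -
  note bij = orientations_bij
  have "G_separated_collection V E S \<longleftrightarrow>
      S \<subseteq> {O1. total_orientation V E O1} \<and> sepcoll D fst snd ((\<lambda>O1. O1 \<inter> D) ` S)" for S
  proof -
    have "(\<forall>O1\<in>S. \<forall>O2\<in>S. G_separated E O1 O2) \<longleftrightarrow>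
       (\<forall>O1\<in>S. \<forall>O2\<in>S. sep fst snd (O1 \<inter> D) (O2 \<inter> D))"
      if "S \<subseteq> {O1. total_orientation V E O1}"
    proof (intro ball_cong refl)
      fix O1 O2 assume "O1 \<in> S" "O2 \<in> S"
      then have O: "total_orientation V E O1" "total_orientation V E O2" using that by auto
      show "G_separated E O1 O2 \<longleftrightarrow> sep fst snd (O1 \<inter> D) (O2 \<inter> D)"
        unfolding G_separated_iff[OF O] darcs_orientations[OF O] ..
    qed
    moreover have "(\<lambda>O1. O1 \<inter> D) ` S \<subseteq> Pow D" by auto
    ultimately show ?thesis unfolding G_separated_collection_def sepcoll_def by auto
  qed
  note tr = maximal_transport[OF bij_betw_imp_inj_on[OF bij] this]
  have "T \<subseteq> (\<lambda>O1. O1 \<inter> D) ` {O1. total_orientation V E O1}" if "sepcoll D fst snd T" for T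
    using that bij_betw_imp_surj_on[OF bij] by (simp add: sepcoll_def)
  from tr[OF this] show ?thesis unfolding graph_pure_def mpure_def card_forests by blast
qed

end

section \<open>Signed circuits and directed cycles\<close>

lemma lin_dependency_combine:
  assumes "\<And>v. (\<Sum>a\<in>A. c a * arc_vec a v) = f v" "\<And>v. (\<Sum>a\<in>A. d a * arc_vec a v) = g v"
  shows "(\<Sum>a\<in>A. (c a + k * d a) * arc_vec a v) = f v + k * g v"
proof -
  have "(\<Sum>a\<in>A. (c a + k * d a) * arc_vec a v) =
      (\<Sum>a\<in>A. c a * arc_vec a v) + k * (\<Sum>a\<in>A. d a * arc_vec a v)"
    by (simp add: sum.distrib sum_distrib_left algebra_simps)
  then show ?thesis using assms by simp
qed

text \<open>The signed vectors along a walk telescope to the difference of its ends. They cannot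
  cancel, since elements of \<open>I - J\<close> only receive positive contributions and those of
  \<open>J - I\<close> negative ones; so the support is nonempty even for a closed walk.\<close>

lemma walk_dependency:
  assumes "finite A" "I \<subseteq> A" "J \<subseteq> A" "(x, y) \<in> (darcs fst snd I J)\<^sup>+"
  shows "\<exists>c. (\<forall>a\<in>A. (c a > 0 \<longrightarrow> a \<in> I - J) \<and> (c a < 0 \<longrightarrow> a \<in> J - I)) \<and> support A c \<noteq> {} \<and>
    (\<forall>v. (\<Sum>a\<in>A. c a * arc_vec a v) = (if v = x then 1 else 0) - (if v = y then 1 else 0))"
proof -
  define conf where "conf c \<longleftrightarrow> (\<forall>a\<in>A. (c a > 0 \<longrightarrow> a \<in> I - J) \<and> (c a < 0 \<longrightarrow> a \<in> J - I))" for c :: "'a \<times> 'a \<Rightarrow> real"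
  have extend: "\<exists>c'. conf c' \<and> support A c' \<noteq> {} \<and>
      (\<forall>v. (\<Sum>a\<in>A. c' a * arc_vec a v) = f v + ((if v = y then 1 else 0) - (if v = z then 1 else 0)))"
    if arc: "(y, z) \<in> darcs fst snd I J" and c: "conf c"
      "\<And>v. (\<Sum>a\<in>A. c a * arc_vec a v) = f v" for c f y z
  proof -
    obtain a k where a: "a \<in> A" and k: "k = 1 \<and> a \<in> I - J \<and> a = (y, z) \<or> k = -1 \<and> a \<in> J - I \<and> a = (z, y)"
      and "k = (1 :: real) \<or> k = -1"
      using arc assms(2,3) by (force simp: darcs_def)
    let ?u = "\<lambda>b. if b = a then 1 else 0 :: real"
    have "(\<Sum>b\<in>A. ?u b * arc_vec b v) = (\<Sum>b\<in>A. if a = b then arc_vec b v else 0)" for v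
      by (rule sum.cong) auto
    then have u: "(\<Sum>b\<in>A. ?u b * arc_vec b v) = arc_vec a v" for v
      using a assms(1) by simp
    let ?c = "\<lambda>b. c b + k * ?u b"
    have "(\<Sum>b\<in>A. ?c b * arc_vec b v) = f v + ((if v = y then 1 else 0) - (if v = z then 1 else 0))" for v
      using lin_dependency_combine[OF c(2) u, of k v] k by (auto simp: arc_vec_def)
    moreover have "conf ?c"
      using c(1) k unfolding conf_def by (auto split: if_splits; force)
    moreover have "?c a \<noteq> 0"
    proof
      assume "?c a = 0"
      then have "c a = -k" by simp
      then show False using c(1) k a unfolding conf_def by force
    qed
    then have "a \<in> support A ?c" using a by (simp add: support_def)
    then have "support A ?c \<noteq> {}" by blast
    ultimately show ?thesis by blast
  qed
  have "\<exists>c. conf c \<and> support A c \<noteq> {} \<and>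
    (\<forall>v. (\<Sum>a\<in>A. c a * arc_vec a v) = (if v = x then 1 else 0) - (if v = y then 1 else 0))"
    using assms(4)
  proof (induction rule: trancl_induct)
    case (base y)
    show ?case using extend[OF base, of "\<lambda>_. 0" "\<lambda>_. 0"] by (simp add: conf_def)
  next
    case (step y z)
    then obtain c where c: "conf c" and
      eq: "\<And>v. (\<Sum>a\<in>A. c a * arc_vec a v) = (if v = x then 1 else 0) - (if v = y then 1 else 0)"
      by blast
    show ?case using extend[OF step(2) c eq] by (simp add: algebra_simps)
  qed
  then show ?thesis unfolding conf_def .
qed

text \<open>A conformal dependency of minimal support is minimal among all dependencies: any dependency
  with smaller support could be subtracted with the largest multiple that keeps all signs.\<close>

lemma conformal_circuit:
  assumes "finite A" "I \<subseteq> A" "J \<subseteq> A" "\<not> sep fst snd I J"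
  shows "\<not> OM_separated A I J"
proof -
  define conf where "conf c \<longleftrightarrow> lin_dependency A c \<and>
    (\<forall>a\<in>A. (c a > 0 \<longrightarrow> a \<in> I - J) \<and> (c a < 0 \<longrightarrow> a \<in> J - I))" for c
  obtain x where x: "(x, x) \<in> (darcs fst snd I J)\<^sup>+" using assms(4) by (auto simp: acyclic_def)
  have "\<exists>c. conf c" using walk_dependency[OF assms(1-3) x] by (auto simp: conf_def lin_dependency_def)
  then obtain d where d: "conf d" and dmin: "\<And>c. conf c \<Longrightarrow> card (support A d) \<le> card (support A c)"
    using ex_has_least_nat[of conf _ "\<lambda>c. card (support A c)"] by blast
  have fin: "finite (support A c)" for c using assms(1) by (simp add: support_def)
  have "\<not> support A c \<subset> support A d" if c: "lin_dependency A c" for c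
  proof
    assume sub: "support A c \<subset> support A d"
    obtain b where b: "b \<in> support A c" using c by (auto simp: lin_dependency_def)
    \<comment> \<open>This sign makes \<open>e\<close> agree with \<open>d\<close> at
      \<open>b\<close>, so that at least one element bounds the multiple of \<open>e\<close> that
      can be subtracted.\<close>
    define s where "s = sgn (c b * d b)"
    define e where "e a = s * c a" for a
    have "c b \<noteq> 0" "d b \<noteq> 0" using b sub by (auto simp: support_def)
    then have s0: "s = 1 \<or> s = -1" and eb: "e b * d b > 0"
      unfolding s_def e_def by (auto simp: sgn_if zero_less_mult_iff mult_less_0_iff not_less)
    have sup_e: "support A e = support A c" using s0 by (auto simp: support_def e_def)
    \<comment> \<open>The smallest ratio over the elements where \<open>e\<close> and
      \<open>d\<close> agree in sign is the largest multiple of \<open>e\<close> that keeps all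
      signs; an element \<open>m\<close> attaining it leaves the support.\<close>
    define Q where "Q = (\<lambda>a. d a / e a) ` {a \<in> support A c. e a * d a > 0}"
    define l where "l = Min Q"
    have "d b / e b \<in> Q" unfolding Q_def using b eb by blast
    then have Q: "finite Q" "Q \<noteq> {}" using fin by (auto simp: Q_def)
    then have "l \<in> Q" unfolding l_def by (rule Min_in)
    then obtain m where m: "m \<in> support A c" "e m * d m > 0" "l = d m / e m" by (auto simp: Q_def)
    have l0: "l > 0" using m(2) unfolding m(3) by (auto simp: zero_less_divide_iff zero_less_mult_iff)
    have le: "l \<le> d a / e a" if "a \<in> support A c" "e a * d a > 0" for a
      unfolding l_def using Q that by (intro Min_le) (auto simp: Q_def)
    define d' where "d' a = d a + (- l * s) * c a" for a
    have d'e: "d' a = d a - l * e a" for a by (simp add: d'_def e_def)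
    have out: "e a = 0" if "a \<in> A" "a \<notin> support A c" for a using that by (auto simp: support_def e_def)
    have zero: "d' a = 0" if "a \<in> A" "d a = 0" for a
    proof -
      have "a \<notin> support A c" using sub that by (auto simp: support_def)
      then show ?thesis using that out d'e by simp
    qed
    have sign: "d' a * d a \<ge> 0" if a: "a \<in> A" for a
    proof (cases "e a * d a > 0")
      case True
      then have "a \<in> support A c" using a out by fastforce
      then have "l \<le> d a / e a" using le True by simp
      then have "l * (e a * d a) \<le> d a / e a * (e a * d a)" using True by (intro mult_right_mono) auto
      also have "\<dots> = d a * d a" using True by auto
      finally show ?thesis by (simp add: d'e algebra_simps)
    next
      case False
      then have "l * (e a * d a) \<le> 0" using l0 mult_nonneg_nonpos[of l "e a * d a"] by linarith
      also have "0 \<le> d a * d a" by simp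
      finally show ?thesis by (simp add: d'e algebra_simps)
    qed
    have "d' m = 0" using m by (auto simp: d'e)
    moreover have "m \<in> support A d" using m sub by auto
    ultimately have "support A d' \<subset> support A d" using zero by (auto simp: support_def)
    then have less: "card (support A d') < card (support A d)" using fin by (simp add: psubset_card_mono)
    \<comment> \<open>An element outside the support of \<open>c\<close> keeps its coefficient, so
      \<open>d'\<close> is a nontrivial dependency.\<close>
    obtain z where z: "z \<in> support A d" "z \<notin> support A c" using sub by auto
    then have "z \<in> support A d'" using out by (auto simp: support_def d'e)
    moreover have "(\<Sum>a\<in>A. d' a * arc_vec a v) = 0" for v
      unfolding d'_def
      using lin_dependency_combine[where A = A and c = d and d = c and f = "\<lambda>_. 0" and g = "\<lambda>_. 0"
          and k = "- l * s" and v = v] c d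
      by (simp add: conf_def lin_dependency_def)
    moreover have "(d' a > 0 \<longrightarrow> a \<in> I - J) \<and> (d' a < 0 \<longrightarrow> a \<in> J - I)" if a: "a \<in> A" for a
    proof -
      have "(d a > 0 \<longrightarrow> a \<in> I - J) \<and> (d a < 0 \<longrightarrow> a \<in> J - I)" using d a by (auto simp: conf_def)
      moreover have "d' a > 0 \<longrightarrow> d a > 0" "d' a < 0 \<longrightarrow> d a < 0"
        using sign[OF a] zero[OF a] by (force simp: zero_le_mult_iff)+
      ultimately show ?thesis by blast
    qed
    ultimately have "conf d'" unfolding conf_def lin_dependency_def by blast
    then show False using dmin less by fastforce
  qed
  then have "OM_circuit A ({a \<in> A. d a > 0}, {a \<in> A. d a < 0})"
    using d unfolding OM_circuit_def conf_def by auto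
  moreover have "{a \<in> A. d a > 0} \<subseteq> I - J" "{a \<in> A. d a < 0} \<subseteq> J - I"
    using d by (auto simp: conf_def)
  ultimately show ?thesis unfolding OM_separated_def by force
qed

lemma finite_acyclic_sink:
  assumes "finite r" "acyclic r" "r \<noteq> {}"
  obtains x y where "(x, y) \<in> r" "\<And>z. (y, z) \<notin> r"
proof -
  have wf: "wf (r\<inverse>)" using assms by (simp add: finite_acyclic_wf_converse)
  obtain y0 where "y0 \<in> Range r" using assms(3) by auto
  then obtain y where "y \<in> Range r" "\<And>z. (z, y) \<in> r\<inverse> \<Longrightarrow> z \<notin> Range r"
    using wfE_min[OF wf] by metis
  then show thesis using that by blast
qed

text \<open>For the direction not covered by \<open>conformal_circuit\<close>, direct the elements
  of a circuit by the signs of their coefficients. If this digraph is acyclic, some vertex is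
  entered but never left; at that vertex no term of the dependency is positive and one is negative,
  so they cannot sum to zero.\<close>

lemma OM_separated_iff:
  assumes "finite A" "I \<subseteq> A" "J \<subseteq> A"
  shows "OM_separated A I J \<longleftrightarrow> sep fst snd I J"
proof
  assume "OM_separated A I J"
  then show "sep fst snd I J" using conformal_circuit[OF assms] by blast
next
  assume ac: "sep fst snd I J"
  show "OM_separated A I J" unfolding OM_separated_def
  proof
    assume "\<exists>X. OM_circuit A X \<and> fst X \<subseteq> I - J \<and> snd X \<subseteq> J - I"
    then obtain X where X: "OM_circuit A X" "fst X \<subseteq> I - J" "snd X \<subseteq> J - I" by blast
    then obtain c where c: "lin_dependency A c" "fst X = {a \<in> A. c a > 0}" "snd X = {a \<in> A. c a < 0}"
      unfolding OM_circuit_def by (elim exE conjE)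
    note c = c(1) X(2,3)[unfolded c(2,3)]
    define r where "r = {a \<in> A. c a > 0} \<union> {a \<in> A. c a < 0}\<inverse>"
    have r: "(x, y) \<in> r \<longleftrightarrow> ((x, y) \<in> A \<and> c (x, y) > 0) \<or> ((y, x) \<in> A \<and> c (y, x) < 0)" for x y
      by (auto simp: r_def)
    have "r \<subseteq> darcs fst snd I J"
      using c(2,3) by (force simp: r darcs_def)
    then have "acyclic r" using ac acyclic_subset by blast
    moreover have "finite r" using assms(1) by (simp add: r_def)
    moreover have "r \<noteq> {}"
    proof -
      obtain a where "a \<in> A" "c a \<noteq> 0" using c(1) by (auto simp: lin_dependency_def support_def)
      then have "(fst a, snd a) \<in> r \<or> (snd a, fst a) \<in> r" by (cases a) (auto simp: r)
      then show ?thesis by auto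
    qed
    ultimately obtain x y where xy: "(x, y) \<in> r" "\<And>z. (y, z) \<notin> r" 
      using finite_acyclic_sink by metis
    have le: "c a * arc_vec a y \<le> 0" if "a \<in> A" for a
      using that xy(2)[of "fst a"] xy(2)[of "snd a"]
      by (cases a) (auto simp: r arc_vec_def not_less)
    have "x \<noteq> y" using xy by auto
    then obtain b where b: "b \<in> A" "c b * arc_vec b y < 0"
      using xy(1) by (auto simp: r arc_vec_def)
    have "(\<Sum>a\<in>A. c a * arc_vec a y) < (\<Sum>a\<in>A. 0)"
      by (rule sum_strict_mono_ex1) (use assms(1) le b in auto)
    then show False using c(1) by (simp add: lin_dependency_def)
  qed
qed

lemma OM_pure_iff:
  assumes "finite A"
  shows "OM_pure A \<longleftrightarrow> mpure A fst snd"
proof -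
  have "OM_separated_collection A S \<longleftrightarrow> sepcoll A fst snd S" for S
  proof -
    have "(\<forall>I\<in>S. I \<subseteq> A) \<longleftrightarrow> S \<subseteq> Pow A" by auto
    moreover have "(\<forall>I\<in>S. \<forall>J\<in>S. OM_separated A I J) \<longleftrightarrow> (\<forall>I\<in>S. \<forall>J\<in>S. sep fst snd I J)"
      if "S \<subseteq> Pow A"
      by (intro ball_cong refl OM_separated_iff[OF assms]) (use that in auto)
    ultimately show ?thesis unfolding OM_separated_collection_def sepcoll_def by blast
  qed
  then have "OM_separated_collection A = sepcoll A fst snd" by blast
  then show ?thesis unfolding OM_pure_def mpure_def by (simp add: max_card_sepcoll[OF assms])
qed

section \<open>The excluded minors\<close>

text \<open>An executable form of \<open>indep\<close>: a loop is rejected, any other first edge is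
  contracted. It allows the forests of the two excluded minors to be counted by evaluation.\<close>

fun forest_check :: "('v \<times> 'v) list \<Rightarrow> bool" where
  "forest_check [] = True"
| "forest_check ((x, y) # es) =
     (x \<noteq> y \<and> forest_check (map (\<lambda>(a, b). (merge x y a, merge x y b)) es))"

lemma indep_forest_check:
  "distinct es \<Longrightarrow> indep t h (set es) \<longleftrightarrow> forest_check (map (\<lambda>a. (t a, h a)) es)"
proof (induction es arbitrary: t h)
  case Nil
  then show ?case by (simp add: indep_def acyclic_def)
next
  case (Cons e es)
  then show ?case by (simp add: indep_insert o_def case_prod_beta)
qed

lemma subsets_eq_subseqs:
  "{F. F \<subseteq> set xs \<and> Q F} = set (map set (filter (\<lambda>ys. Q (set ys)) (subseqs xs)))"
proof -
  have "F \<subseteq> set xs \<longleftrightarrow> (\<exists>ys\<in>set (subseqs xs). F = set ys)" for F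
    using subseqs_powset[of xs] by (metis (no_types, lifting) Pow_iff imageE imageI)
  then show ?thesis by auto
qed

lemma card_subsets_subseqs:
  assumes "distinct xs"
  shows "card {F. F \<subseteq> set xs \<and> Q F} = length (filter (\<lambda>ys. Q (set ys)) (subseqs xs))"
proof -
  have "distinct (map set (filter (\<lambda>ys. Q (set ys)) (subseqs xs)))"
    using distinct_set_subseqs[OF assms] by (rule distinct_map_filter)
  then show ?thesis unfolding subsets_eq_subseqs by (metis distinct_card length_map)
qed

lemma nind_forest_check:
  assumes "distinct xs"
  shows "nind (set xs) fst snd = length (filter forest_check (subseqs xs))"
proof -
  have "indep fst snd (set ys) = forest_check ys" if "ys \<in> set (subseqs xs)" for ys
    using indep_forest_check[of ys fst snd] subseqs_distinctD[OF that assms] by simp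
  then have "filter (\<lambda>ys. indep fst snd (set ys)) (subseqs xs) = filter forest_check (subseqs xs)"
    by (intro filter_cong) auto
  then show ?thesis unfolding nind_def card_subsets_subseqs[OF assms] by simp
qed

text \<open>A maximal collection containing \<open>S0\<close> consists of orientations separated
  from all of \<open>S0\<close>, hence satisfying \<open>Q\<close>; there are too few of
  these.\<close>

lemma not_mpure:
  assumes "finite A" "sepcoll A t h S0"
    and "\<And>I. I \<subseteq> A \<Longrightarrow> (\<And>J. J \<in> S0 \<Longrightarrow> sep t h I J) \<Longrightarrow> Q I"
    and "card {I. I \<subseteq> A \<and> Q I} < nind A t h"
  shows "\<not> mpure A t h"
proof
  assume m: "mpure A t h"
  obtain T where T: "S0 \<subseteq> T" "maximal_by_inclusion (sepcoll A t h) T"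
    using sepcoll_extend[OF assms(1,2)] by blast
  then have sT: "T \<subseteq> Pow A" "\<forall>I\<in>T. \<forall>J\<in>T. sep t h I J"
    by (simp_all add: maximal_by_inclusion_def sepcoll_def)
  have "Q I" if "I \<in> T" for I
    by (rule assms(3)) (use sT T(1) that in blast)+
  then have "T \<subseteq> {I. I \<subseteq> A \<and> Q I}" using sT by auto
  then have "card T \<le> card {I. I \<subseteq> A \<and> Q I}" using assms(1) by (intro card_mono) auto
  then show False using m T(2) assms(4) by (simp add: mpure_def)
qed

lemma acyclic_potential:
  fixes f :: "'v \<Rightarrow> nat"
  assumes "\<And>x y. (x, y) \<in> Q \<Longrightarrow> f x < f y"
  shows "acyclic Q"
proof -
  have "(x, y) \<in> Q\<^sup>+ \<Longrightarrow> f x < f y" for x y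
    by (induction rule: trancl_induct) (use assms less_trans in blast)+
  then show ?thesis unfolding acyclic_def by blast
qed

lemma cycle3_not_acyclic: "acyclic Q \<Longrightarrow> (a, b) \<in> Q \<Longrightarrow> (b, c) \<in> Q \<Longrightarrow> (c, a) \<in> Q \<Longrightarrow> False"
  unfolding acyclic_def by (meson trancl.intros)

lemma cycle4_not_acyclic:
  "acyclic Q \<Longrightarrow> (a, b) \<in> Q \<Longrightarrow> (b, c) \<in> Q \<Longrightarrow> (c, d) \<in> Q \<Longrightarrow> (d, a) \<in> Q \<Longrightarrow> False"
  unfolding acyclic_def by (meson trancl.intros)

lemma sepcollI_list:
  assumes "\<And>I. I \<in> set Is \<Longrightarrow> I \<subseteq> A"
    and "sorted_wrt (\<lambda>I J. sep t h I J) Is"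
  shows "sepcoll A t h (set Is)"
proof -
  have "sep t h I J" if IJ: "I \<in> set Is" "J \<in> set Is" for I J
  proof -
    obtain i j where ij: "i < length Is" "j < length Is" "I = Is ! i" "J = Is ! j"
      using IJ unfolding in_set_conv_nth by blast
    have less: "sep t h (Is ! i) (Is ! j)" if "i < j" "j < length Is" for i j
      using assms(2) that by (simp add: sorted_wrt_iff_nth_less)
    consider "i < j" | "j < i" | "i = j" by linarith
    then show ?thesis
    proof cases
      case 1
      then show ?thesis using less ij by simp
    next
      case 2
      then show ?thesis using less[of j i] ij acyclic_darcs_sym by metis
    next
      case 3
      then show ?thesis using ij by (simp add: acyclic_def)
    qed
  qed
  then show ?thesis using assms(1) by (auto simp: sepcoll_def)
qed

lemma darcs_mem:
  "(x, y) \<in> darcs fst snd I J \<longleftrightarrow> (x, y) \<in> I \<and> (x, y) \<notin> J \<or> (y, x) \<in> J \<and> (y, x) \<notin> I"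
  by (force simp: darcs_def)

text \<open>In \<open>K\<^sub>4\<close> with centre 0 and outer triangle 1, 2, 3, the three inner triangles are all directed
  counterclockwise by some member of the collection, but the outer triangle clockwise.\<close>

lemma not_mpure_K4: "\<not> mpure (set [(0, 1), (0, 2), (0, 3), (1, 2), (1, 3), (2, 3 :: nat)]) fst snd"
proof (rule not_mpure)
  let ?xs = "[(0, 1), (0, 2), (0, 3), (1, 2), (1, 3), (2, 3 :: nat)] :: (nat \<times> nat) list"
  let ?D1 = "{(0, 1), (1, 2)} :: (nat \<times> nat) set"
  let ?D2 = "{(0, 2), (2, 3), (1, 2), (1, 3)} :: (nat \<times> nat) set"
  let ?D3 = "{(0, 3), (2, 3)} :: (nat \<times> nat) set"
  let ?D4 = "{(0, 1), (0, 2), (0, 3), (1, 3)} :: (nat \<times> nat) set"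
  let ?Q = "\<lambda>I. \<not> ((0, 2) \<in> I \<and> (1, 2) \<notin> I \<and> (0, 1) \<notin> I) \<and> \<not> ((0, 3) \<in> I \<and> (2, 3) \<notin> I \<and> (0, 2) \<notin> I) \<and>
     \<not> ((0, 1) \<in> I \<and> (1, 3) \<in> I \<and> (0, 3) \<notin> I) \<and> \<not> ((1, 2) \<in> I \<and> (2, 3) \<in> I \<and> (1, 3) \<notin> (I :: (nat \<times> nat) set))"
  show "finite (set ?xs)" by simp
  \<comment> \<open>Entry \<open>v\<close> of each list is the rank of vertex \<open>v\<close> in a
    topological order of the arcs on which the two orientations differ.\<close>
  have 12: "sep fst snd ?D1 ?D2"
    by (rule acyclic_potential[where f = "(!) [2, 3, 1, 0]"]) (auto simp: darcs_mem)
  have 13: "sep fst snd ?D1 ?D3"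
    by (subst acyclic_darcs_sym, rule acyclic_potential[where f = "(!) [2, 1, 0, 3]"]) (auto simp: darcs_mem)
  have 14: "sep fst snd ?D1 ?D4"
    by (rule acyclic_potential[where f = "(!) [3, 1, 2, 0]"]) (auto simp: darcs_mem)
  have 23: "sep fst snd ?D2 ?D3"
    by (rule acyclic_potential[where f = "(!) [2, 0, 3, 1]"]) (auto simp: darcs_mem)
  have 24: "sep fst snd ?D2 ?D4"
    by (rule acyclic_potential[where f = "(!) [3, 0, 1, 2]"]) (auto simp: darcs_mem)
  have 34: "sep fst snd ?D3 ?D4"
    by (rule acyclic_potential[where f = "(!) [3, 2, 0, 1]"]) (auto simp: darcs_mem)
  show "sepcoll (set ?xs) fst snd (set [?D1, ?D2, ?D3, ?D4])"
    by (rule sepcollI_list) (use 12 13 14 23 24 34 in auto)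
  show "?Q I" if "I \<subseteq> set ?xs" and "\<And>J. J \<in> set [?D1, ?D2, ?D3, ?D4] \<Longrightarrow> sep fst snd I J" for I
  proof -
    have a: "sep fst snd I ?D1" "sep fst snd I ?D2"
      "sep fst snd I ?D3" "sep fst snd I ?D4" using that(2) by simp_all
    show ?thesis
      using cycle3_not_acyclic[OF a(1), of 0 2 1] cycle3_not_acyclic[OF a(2), of 0 3 2]
        cycle3_not_acyclic[OF a(3), of 0 1 3] cycle3_not_acyclic[OF a(4), of 1 2 3]
      unfolding darcs_mem by simp blast
  qed
  have "card {I. I \<subseteq> set ?xs \<and> ?Q I} = length (filter (\<lambda>ys. ?Q (set ys)) (subseqs ?xs))"
    by (rule card_subsets_subseqs) simp
  \<comment> \<open>Each forbidden directed triangle fixes three edges and excludes 8 orientations.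
    Two of them always disagree on their common edge, so 64 - 32 orientations remain, against 1 + 6
    + 15 + 16 = 38 forests.\<close>
  also have "\<dots> = 32" by (simp add: Let_def)
  also have "(32 :: nat) < length (filter forest_check (subseqs ?xs))" by (simp add: Let_def merge_def)
  also have "\<dots> = nind (set ?xs) fst snd" by (rule nind_forest_check[symmetric]) simp
  finally show "card {I. I \<subseteq> set ?xs \<and> ?Q I} < nind (set ?xs) fst snd" .
qed

text \<open>Each two of the three paths of \<open>K\<^sub>2\<^sub>,\<^sub>3\<close> form a cycle that is directed by some member of the
  collection, along the first path and against the second one, in a cyclic fashion.\<close>

lemma not_mpure_K23: "\<not> mpure (set [(0, 2), (0, 3), (0, 4), (1, 2), (1, 3), (1, 4 :: nat)]) fst snd"
proof (rule not_mpure)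
  let ?xs = "[(0, 2), (0, 3), (0, 4), (1, 2), (1, 3), (1, 4 :: nat)] :: (nat \<times> nat) list"
  let ?D1 = "{(0, 2), (1, 3)} :: (nat \<times> nat) set"
  let ?D2 = "{(0, 3), (1, 4)} :: (nat \<times> nat) set"
  let ?D3 = "{(0, 4), (1, 2)} :: (nat \<times> nat) set"
  let ?Q = "\<lambda>I. \<not> ((0, 2) \<notin> I \<and> (1, 2) \<in> I \<and> (0, 3) \<in> I \<and> (1, 3) \<notin> I) \<and>
     \<not> ((0, 3) \<notin> I \<and> (1, 3) \<in> I \<and> (0, 4) \<in> I \<and> (1, 4) \<notin> I) \<and>
     \<not> ((0, 4) \<notin> I \<and> (1, 4) \<in> I \<and> (0, 2) \<in> I \<and> (1, 2) \<notin> (I :: (nat \<times> nat) set))"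
  show "finite (set ?xs)" by simp
  have 12: "sep fst snd ?D1 ?D2"
    by (rule acyclic_potential[where f = "(!) [3, 1, 4, 2, 0]"]) (auto simp: darcs_mem)
  have 13: "sep fst snd ?D1 ?D3"
    by (subst acyclic_darcs_sym, rule acyclic_potential[where f = "(!) [3, 1, 2, 0, 4]"]) (auto simp: darcs_mem)
  have 23: "sep fst snd ?D2 ?D3"
    by (rule acyclic_potential[where f = "(!) [3, 1, 0, 4, 2]"]) (auto simp: darcs_mem)
  show "sepcoll (set ?xs) fst snd (set [?D1, ?D2, ?D3])"
    by (rule sepcollI_list) (use 12 13 23 in auto)
  show "?Q I" if "I \<subseteq> set ?xs" and "\<And>J. J \<in> set [?D1, ?D2, ?D3] \<Longrightarrow> sep fst snd I J" for I
  proof -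
    have a: "sep fst snd I ?D1" "sep fst snd I ?D2"
      "sep fst snd I ?D3" using that(2) by simp_all
    show ?thesis
      using cycle4_not_acyclic[OF a(1), of 1 2 0 3] cycle4_not_acyclic[OF a(2), of 1 3 0 4]
        cycle4_not_acyclic[OF a(3), of 1 4 0 2]
      unfolding darcs_mem by simp blast
  qed
  have "card {I. I \<subseteq> set ?xs \<and> ?Q I} = length (filter (\<lambda>ys. ?Q (set ys)) (subseqs ?xs))"
    by (rule card_subsets_subseqs) simp
  \<comment> \<open>Each forbidden directed 4-cycle fixes four edges and excludes 4 orientations.
    Two of them always run oppositely along their common path, so 64 - 12 orientations remain. There
    are 54 forests, as 3 + 6 + 1 edge sets contain a 4-cycle.\<close>
  also have "\<dots> = 52" by (simp add: Let_def)
  also have "(52 :: nat) < length (filter forest_check (subseqs ?xs))" by (simp add: Let_def merge_def)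
  also have "\<dots> = nind (set ?xs) fst snd" by (rule nind_forest_check[symmetric]) simp
  finally show "card {I. I \<subseteq> set ?xs \<and> ?Q I} < nind (set ?xs) fst snd" .
qed

text \<open>The elements with both ends in one fibre of \<open>f\<close> are contracted one after
  another, including those that have become loops. Merging two vertices of a fibre does not affect
  \<open>f\<close>; at the end, connectedness of the fibres makes \<open>f\<close> injective on the
  vertices, and only a relabelling remains.\<close>

lemma mpure_fibres:
  assumes "finite A" "mpure A t h" "t ` A \<union> h ` A \<subseteq> W"
    and "\<And>z w. z \<in> W \<Longrightarrow> w \<in> W \<Longrightarrow> f z = f w \<Longrightarrow>
      (z, w) \<in> {(x, y). \<exists>a\<in>A. f (t a) = f (h a) \<and> {x, y} = {t a, h a}}\<^sup>*"
  shows "mpure {a\<in>A. f (t a) \<noteq> f (h a)} (f \<circ> t) (f \<circ> h)"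
  using assms
proof (induction "card {a\<in>A. f (t a) = f (h a)}" arbitrary: A t h W)
  case 0
  then have no: "f (t a) \<noteq> f (h a)" if "a \<in> A" for a using that by auto
  then have empty: "{(x, y). \<exists>a\<in>A. f (t a) = f (h a) \<and> {x, y} = {t a, h a}} = {}" by auto
  have "inj_on f W"
  proof (rule inj_onI)
    fix x y assume "x \<in> W" "y \<in> W" "f x = f y"
    from 0(5)[OF this] show "x = y" unfolding empty by simp
  qed
  then have "inj_on f (t ` A \<union> h ` A)" using 0(4) by (rule inj_on_subset)
  from mpure_vertices[OF this] have "mpure A (f \<circ> t) (f \<circ> h)" using 0(3) by simp
  moreover have all: "{a\<in>A. f (t a) \<noteq> f (h a)} = A" using no by auto
  ultimately show ?case unfolding all by blast
next
  case (Suc n)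
  then obtain e where e: "e \<in> A" "f (t e) = f (h e)"
    by (metis (mono_tags, lifting) Zero_not_Suc all_not_in_conv card.empty mem_Collect_eq)
  define B where "B = A - {e}"
  have A: "A = insert e B" "e \<notin> B" "finite B" using e Suc.prems(1) by (auto simp: B_def)
  let ?m = "merge (t e) (h e)"
  have fm: "f (?m z) = f z" for z using e by (simp add: merge_def)
  then have fm': "f \<circ> (?m \<circ> t) = f \<circ> t" "f \<circ> (?m \<circ> h) = f \<circ> h" by auto
  have "mpure {a\<in>B. f ((?m \<circ> t) a) \<noteq> f ((?m \<circ> h) a)} (f \<circ> (?m \<circ> t)) (f \<circ> (?m \<circ> h))"
  proof (rule Suc.hyps(1))
    have "{a\<in>A. f (t a) = f (h a)} = insert e {a\<in>B. f (t a) = f (h a)}" using A e by auto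
    then show "n = card {a\<in>B. f ((?m \<circ> t) a) = f ((?m \<circ> h) a)}"
      using Suc.hyps(2) A(2,3) by (simp add: fm)
    show "finite B" by (rule A(3))
    show "mpure B (?m \<circ> t) (?m \<circ> h)" using mpure_contract[OF A(3,2)] Suc.prems(2) A(1) by simp
    show "(?m \<circ> t) ` B \<union> (?m \<circ> h) ` B \<subseteq> ?m ` W" using Suc.prems(3) A(1) by auto
    fix z' w' assume "z' \<in> ?m ` W" "w' \<in> ?m ` W" "f z' = f w'"
    then obtain z w where zw: "z \<in> W" "w \<in> W" "z' = ?m z" "w' = ?m w" "f z = f w" by (auto simp: fm)
    have "(z, w) \<in> {(x, y). \<exists>a\<in>A. f (t a) = f (h a) \<and> {x, y} = {t a, h a}}\<^sup>*"
      using Suc.prems(4) zw by blast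
    then have "(?m z, ?m w) \<in> {(x, y). \<exists>a\<in>B. f ((?m \<circ> t) a) = f ((?m \<circ> h) a) \<and>
        {x, y} = {(?m \<circ> t) a, (?m \<circ> h) a}}\<^sup>*" (is "_ \<in> ?R\<^sup>*")
    proof (induction rule: rtrancl_induct)
      case (step x y)
      then obtain a where a: "a \<in> A" "f (t a) = f (h a)" "{x, y} = {t a, h a}" by blast
      show ?case
      proof (cases "a = e")
        case True
        then have "?m x = ?m y" using a(3) by (auto simp: doubleton_eq_iff merge_def)
        then show ?thesis using step.IH by simp
      next
        case False
        then have "(?m x, ?m y) \<in> ?R" using a A(1) by (auto simp: fm doubleton_eq_iff)
        then show ?thesis using step.IH by (rule rtrancl.rtrancl_into_rtrancl[rotated])
      qed
    qed simp
    then show "(z', w') \<in> ?R\<^sup>*" using zw by simp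
  qed
  moreover have "{a\<in>B. f ((?m \<circ> t) a) \<noteq> f ((?m \<circ> h) a)} = {a\<in>A. f (t a) \<noteq> f (h a)}"
    using A(1) e by (auto simp: fm)
  ultimately show ?case unfolding fm' by simp
qed

text \<open>Keep the elements inside the union of the branch sets, contract the branch sets as
  fibres of \<open>f\<close>, and then retain one element \<open>p e\<close> for each edge
  \<open>e\<close> of the minor.\<close>

lemma mpure_minor:
  fixes VH :: "nat set"
  assumes G: "simple_graph V E" and pure: "graph_pure V E" and minor: "has_minor V E VH EH"
    and H: "\<And>i j. (i, j) \<in> HE \<Longrightarrow> i < j \<and> {i, j} \<in> EH \<and> i \<in> VH \<and> j \<in> VH"
  shows "mpure HE fst snd"
proof -
  obtain B where B: "\<And>x. x \<in> VH \<Longrightarrow> B x \<noteq> {} \<and> B x \<subseteq> V \<and> connected_in E (B x)"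
    "\<And>x y. x \<in> VH \<Longrightarrow> y \<in> VH \<Longrightarrow> x \<noteq> y \<Longrightarrow> B x \<inter> B y = {}"
    "\<And>x y. {x, y} \<in> EH \<Longrightarrow> \<exists>u\<in>B x. \<exists>v\<in>B y. {u, v} \<in> E"
    using minor unfolding has_minor_def by metis
  define U where "U = (\<Union>x\<in>VH. B x)"
  define f where "f z = (THE x. x \<in> VH \<and> z \<in> B x)" for z
  have f: "f z = x" if "x \<in> VH" "z \<in> B x" for x z
    unfolding f_def using that B(2) by (intro the_equality) blast+
  have "finite V" using G by (simp add: simple_graph_def)
  then obtain g :: "'a \<Rightarrow> nat" where g: "inj_on g V" using finite_imp_inj_to_nat_seg by blast
  have edge: "u \<in> V" "v \<in> V" "u \<noteq> v" if "{u, v} \<in> E" for u v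
    using G that by (auto simp: simple_graph_def)
  \<comment> \<open>Comparing \<open>f\<close> first makes arcs between branch sets run from the
    smaller index to the larger, as in \<open>HE\<close>; \<open>g\<close> breaks ties, such as
    inside a branch set.\<close>
  define D where "D = {(u, v). {u, v} \<in> E \<and> (f u < f v \<or> f u = f v \<and> g u < g v)}"
  have D: "total_orientation V E D" unfolding total_orientation_def
  proof (intro conjI allI impI)
    fix u v assume uv: "{u, v} \<in> E"
    then have "g u \<noteq> g v" using edge[OF uv] g by (auto simp: inj_on_def)
    then show "((u, v) \<in> D) = ((v, u) \<notin> D)" using uv by (auto simp: D_def insert_commute)
  qed (auto simp: D_def)
  have finD: "finite D" by (rule finite_orientation[OF G D])
  have mD: "mpure D fst snd" using graph_pure_iff[OF G D] pure by simp
  define A where "A = {a\<in>D. fst a \<in> U \<and> snd a \<in> U}"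
  have "mpure A fst snd" by (rule mpure_subset[OF finD mD]) (auto simp: A_def)
  moreover have finA: "finite A" using finD by (simp add: A_def)
  moreover have "(z, w) \<in> {(x, y). \<exists>a\<in>A. f (fst a) = f (snd a) \<and> {x, y} = {fst a, snd a}}\<^sup>*" (is "_ \<in> ?R\<^sup>*")
    if zw: "z \<in> U" "w \<in> U" "f z = f w" for z w
  proof -
    obtain x where x: "x \<in> VH" "z \<in> B x" using zw by (auto simp: U_def)
    then have "w \<in> B x" using zw f by (auto simp: U_def)
    then have "(z, w) \<in> {(p, q). {p, q} \<in> E \<and> p \<in> B x \<and> q \<in> B x}\<^sup>*"
      using B(1)[OF x(1)] x(2) unfolding connected_in_def by blast
    moreover have "{(p, q). {p, q} \<in> E \<and> p \<in> B x \<and> q \<in> B x} \<subseteq> ?R"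
    proof clarify
      fix p q assume pq: "{p, q} \<in> E" "p \<in> B x" "q \<in> B x"
      have fpq: "f p = f q" "p \<in> U" "q \<in> U" using f pq x by (auto simp: U_def)
      have "(p, q) \<in> D \<or> (q, p) \<in> D" using orientation_cases[OF G D D, of p q] pq(1) by blast
      then show "\<exists>a\<in>A. f (fst a) = f (snd a) \<and> {p, q} = {fst a, snd a}"
        using fpq by (force simp: A_def)
    qed
    ultimately show ?thesis using rtrancl_mono by blast
  qed
  ultimately have m: "mpure {a\<in>A. f (fst a) \<noteq> f (snd a)} (f \<circ> fst) (f \<circ> snd)"
    by (intro mpure_fibres[where W = U]) (auto simp: A_def)
  have "\<exists>a. a \<in> A \<and> f (fst a) = fst e \<and> f (snd a) = snd e" if "e \<in> HE" for e
  proof -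
    obtain i j where e: "e = (i, j)" by fastforce
    have ij: "i < j" "{i, j} \<in> EH" "i \<in> VH" "j \<in> VH" using H that e by auto
    obtain u v where uv: "u \<in> B i" "v \<in> B j" "{u, v} \<in> E" using B(3)[OF ij(2)] by blast
    then have "f u = i" "f v = j" "u \<in> U" "v \<in> U" using f ij by (auto simp: U_def)
    then have "(u, v) \<in> A" using uv ij by (auto simp: A_def D_def)
    then show ?thesis using \<open>f u = i\<close> \<open>f v = j\<close> e by (intro exI[of _ "(u, v)"]) simp
  qed
  then obtain p where p: "\<And>e. e \<in> HE \<Longrightarrow> p e \<in> A \<and> f (fst (p e)) = fst e \<and> f (snd (p e)) = snd e"
    by metis
  have inj: "inj_on p HE" by (rule inj_onI) (metis p prod_eqI)
  have "mpure (p ` HE) (f \<circ> fst) (f \<circ> snd)"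
  proof (rule mpure_subset[OF _ m])
    show "p ` HE \<subseteq> {a\<in>A. f (fst a) \<noteq> f (snd a)}" using p H by force
  qed (use finA in simp)
  then have "mpure HE (f \<circ> fst \<circ> p) (f \<circ> snd \<circ> p)" unfolding mpure_image[OF inj] .
  moreover have "darcs (f \<circ> fst \<circ> p) (f \<circ> snd \<circ> p) I J = darcs fst snd I J" if "I \<subseteq> HE" "J \<subseteq> HE" for I J
    unfolding darcs_def using that p by (intro arg_cong2[of _ _ _ _ "(\<union>)"] image_cong) auto
  ultimately show ?thesis using mpure_cong[of HE "f \<circ> fst \<circ> p" "f \<circ> snd \<circ> p" fst snd] by simp
qed

lemma pure_no_K4:
  assumes "simple_graph V E" "graph_pure V E"
  shows "\<not> has_minor V E K4_V K4_E"
proof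
  have E: "{i, j} \<in> K4_E" if "i \<in> K4_V" "j \<in> K4_V" "i \<noteq> j" for i j
    using that unfolding K4_E_def by blast
  assume "has_minor V E K4_V K4_E"
  then have "mpure (set [(0, 1), (0, 2), (0, 3), (1, 2), (1, 3), (2, 3 :: nat)]) fst snd"
    by (rule mpure_minor[OF assms]) (auto intro!: E simp: K4_V_def)
  then show False using not_mpure_K4 by blast
qed

lemma pure_no_K23:
  assumes "simple_graph V E" "graph_pure V E"
  shows "\<not> has_minor V E K23_V K23_E"
proof
  have E: "{i, j} \<in> K23_E" if "i \<in> {0, 1}" "j \<in> {2, 3, 4}" for i j
    using that unfolding K23_E_def by blast
  assume "has_minor V E K23_V K23_E"
  then have "mpure (set [(0, 2), (0, 3), (0, 4), (1, 2), (1, 3), (1, 4 :: nat)]) fst snd"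
    by (rule mpure_minor[OF assms]) (auto intro!: E simp: K23_V_def)
  then show False using not_mpure_K23 by blast
qed

section \<open>Outerplanar graphs\<close>

text \<open>Vertices in convex position, read off as a linear order, with edges drawn as chords.
  Integer positions can be shifted and reflected freely.\<close>

definition noncross :: "'a set set \<Rightarrow> ('a \<Rightarrow> int) \<Rightarrow> bool" where
  "noncross E \<pi> \<longleftrightarrow> (\<forall>a b c d. {a, b} \<in> E \<longrightarrow> {c, d} \<in> E \<longrightarrow> \<not> (\<pi> a < \<pi> c \<and> \<pi> c < \<pi> b \<and> \<pi> b < \<pi> d))"

lemma noncrossD: "noncross E \<pi> \<Longrightarrow> {a, b} \<in> E \<Longrightarrow> {c, d} \<in> E \<Longrightarrow> \<pi> a < \<pi> c \<Longrightarrow> \<pi> c < \<pi> b \<Longrightarrow> \<pi> b < \<pi> d \<Longrightarrow> False"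
  unfolding noncross_def by blast

lemma noncross_uminus: "noncross E \<pi> \<Longrightarrow> noncross E (\<lambda>x. - \<pi> x)"
  unfolding noncross_def
proof (intro allI impI notI)
  fix a b c d assume nc: "\<forall>a b c d. {a, b} \<in> E \<longrightarrow> {c, d} \<in> E \<longrightarrow> \<not> (\<pi> a < \<pi> c \<and> \<pi> c < \<pi> b \<and> \<pi> b < \<pi> d)"
    and *: "{a, b} \<in> E" "{c, d} \<in> E" "- \<pi> a < - \<pi> c \<and> - \<pi> c < - \<pi> b \<and> - \<pi> b < - \<pi> d"
  have "{d, c} \<in> E" "{b, a} \<in> E" using * by (simp_all add: insert_commute)
  then show False using nc * by (metis neg_less_iff_less)
qed

text \<open>Whether chords cross depends only on the cyclic order, so the circle may be cut open
  just after \<open>m\<close>, which makes \<open>m\<close> the last vertex.\<close>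

lemma noncross_rotate:
  assumes "finite V" "inj_on \<pi> V" "noncross E \<pi>" "\<And>e. e \<in> E \<Longrightarrow> e \<subseteq> V" "m \<in> V"
  obtains \<rho> where "inj_on \<rho> V" "noncross E \<rho>" "\<rho> m = 0" "\<And>x. x \<in> V \<Longrightarrow> \<rho> x \<le> 0"
proof -
  \<comment> \<open>A shift exceeding the range of \<open>\<pi>\<close>: it moves the positions up
    to that of \<open>m\<close> behind all others.\<close>
  define B where "B = Max (\<pi> ` V) - Min (\<pi> ` V) + 1"
  have B: "\<pi> x < \<pi> y + B" if "x \<in> V" "y \<in> V" for x y
  proof -
    have "\<pi> x \<le> Max (\<pi> ` V)" "Min (\<pi> ` V) \<le> \<pi> y" using that assms(1) by auto
    then show ?thesis by (simp add: B_def)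
  qed
  define \<sigma> where "\<sigma> x = (if \<pi> x \<le> \<pi> m then \<pi> x + B else \<pi> x)" for x
  have inj: "inj_on \<sigma> V"
  proof (rule inj_onI)
    fix x y assume "x \<in> V" "y \<in> V" "\<sigma> x = \<sigma> y"
    then have "\<pi> x = \<pi> y" using B[of x y] B[of y x] by (auto simp: \<sigma>_def split: if_splits)
    then show "x = y" using \<open>x \<in> V\<close> \<open>y \<in> V\<close> assms(2) by (auto dest: inj_onD)
  qed
  have nc: "noncross E \<sigma>" unfolding noncross_def
  proof (intro allI impI notI)
    fix a b c d assume e: "{a, b} \<in> E" "{c, d} \<in> E" and o: "\<sigma> a < \<sigma> c \<and> \<sigma> c < \<sigma> b \<and> \<sigma> b < \<sigma> d"
    have V: "a \<in> V" "b \<in> V" "c \<in> V" "d \<in> V" using assms(4) e by auto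
    have e': "{b, a} \<in> E" "{d, c} \<in> E" using e by (simp_all add: insert_commute)
    note n = noncrossD[OF assms(3)]
    have lo: "\<pi> y \<le> \<pi> m" if "\<pi> x \<le> \<pi> m" "\<sigma> x < \<sigma> y" "x \<in> V" "y \<in> V" for x y
      using that B[of y x] by (auto simp: \<sigma>_def split: if_splits)
    have l: "\<pi> a \<le> \<pi> m \<Longrightarrow> \<pi> c \<le> \<pi> m" "\<pi> c \<le> \<pi> m \<Longrightarrow> \<pi> b \<le> \<pi> m" "\<pi> b \<le> \<pi> m \<Longrightarrow> \<pi> d \<le> \<pi> m"
      using lo o V by blast+
    have same: "\<pi> x < \<pi> y" if "\<sigma> x < \<sigma> y" "\<pi> x \<le> \<pi> m \<longleftrightarrow> \<pi> y \<le> \<pi> m" for x y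
      using that by (auto simp: \<sigma>_def split: if_splits)
    \<comment> \<open>The moved vertices form a final segment of \<open>a\<close>, \<open>c\<close>,
      \<open>b\<close>, \<open>d\<close>. Undoing the shift brings that segment to the front, and
      the chords are still interleaved, possibly with their roles or ends exchanged.\<close>
    consider "\<pi> a \<le> \<pi> m" | "\<not> \<pi> a \<le> \<pi> m" "\<pi> c \<le> \<pi> m" | "\<not> \<pi> c \<le> \<pi> m" "\<pi> b \<le> \<pi> m"
      | "\<not> \<pi> b \<le> \<pi> m" "\<pi> d \<le> \<pi> m" | "\<not> \<pi> d \<le> \<pi> m" by blast
    then show False
    proof cases
      case 1
      then have "\<pi> a < \<pi> c" "\<pi> c < \<pi> b" "\<pi> b < \<pi> d" using l same o by blast+
      then show False using n[OF e] by blast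
    next
      case 2
      then have "\<pi> c < \<pi> b" "\<pi> b < \<pi> d" "\<pi> d < \<pi> a" using l same o by (blast, blast, linarith)
      then show False using n[OF e(2) e'(1)] by blast
    next
      case 3
      then have "\<pi> b < \<pi> d" "\<pi> d < \<pi> a" "\<pi> a < \<pi> c" using l same o by (blast, linarith, blast)
      then show False using n[OF e'(1) e'(2)] by blast
    next
      case 4
      then have "\<pi> d < \<pi> a" "\<pi> a < \<pi> c" "\<pi> c < \<pi> b" using l same o by (linarith, blast, blast)
      then show False using n[OF e'(2) e(1)] by blast
    next
      case 5
      then have "\<pi> a < \<pi> c" "\<pi> c < \<pi> b" "\<pi> b < \<pi> d" using l same o by blast+
      then show False using n[OF e] by blast
    qed
  qed
  show thesis
  proof (rule that)
    show "inj_on (\<lambda>x. \<sigma> x - \<sigma> m) V" using inj by (simp add: inj_on_def)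
    show "noncross E (\<lambda>x. \<sigma> x - \<sigma> m)" using nc by (simp add: noncross_def)
    show "\<sigma> x - \<sigma> m \<le> 0" if "x \<in> V" for x using B[OF that assms(5)] by (simp add: \<sigma>_def)
  qed simp
qed

lemma noncross_glue:
  assumes "inj_on \<pi> V" "noncross {e\<in>E. e \<subseteq> V} \<pi>" "\<And>x. x \<in> V \<Longrightarrow> \<pi> x \<le> 0"
    and "inj_on \<rho> W" "noncross {e\<in>E. e \<subseteq> W} \<rho>" "\<And>x. x \<in> W \<Longrightarrow> \<rho> x \<ge> 0"
    and "\<And>x. x \<in> V \<Longrightarrow> x \<in> W \<Longrightarrow> \<pi> x = \<rho> x"
    and eq: "\<And>x y. x \<in> V \<Longrightarrow> y \<in> W \<Longrightarrow> \<pi> x = \<rho> y \<Longrightarrow> x = y"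
    and E: "\<And>e. e \<in> E \<Longrightarrow> e \<subseteq> V \<or> e \<subseteq> W"
  shows "\<exists>\<sigma>. inj_on \<sigma> (V \<union> W) \<and> noncross E \<sigma>"
proof -
  define \<sigma> where "\<sigma> x = (if x \<in> V then \<pi> x else \<rho> x)" for x
  have V: "\<sigma> x = \<pi> x" if "x \<in> V" for x using that by (simp add: \<sigma>_def)
  have W: "\<sigma> x = \<rho> x" if "x \<in> W" for x using that assms(7) by (simp add: \<sigma>_def)
  have "inj_on \<sigma> (V \<union> W)"
  proof (rule inj_onI)
    fix x y assume *: "x \<in> V \<union> W" "y \<in> V \<union> W" "\<sigma> x = \<sigma> y"
    then consider "x \<in> V" "y \<in> V" | "x \<in> V" "y \<in> W" | "x \<in> W" "y \<in> V" | "x \<in> W" "y \<in> W" by blast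
    then show "x = y"
    proof cases
      case 1 then show ?thesis using * V assms(1) by (auto dest: inj_onD)
    next
      case 2 then show ?thesis using * V[of x] W[of y] eq[of x y] by simp
    next
      case 3 then show ?thesis using * V[of y] W[of x] eq[of y x] by simp
    next
      case 4 then show ?thesis using * W assms(4) by (auto dest: inj_onD)
    qed
  qed
  moreover have "noncross E \<sigma>" unfolding noncross_def
  proof (intro allI impI notI)
    fix a b c d assume e: "{a, b} \<in> E" "{c, d} \<in> E" and o: "\<sigma> a < \<sigma> c \<and> \<sigma> c < \<sigma> b \<and> \<sigma> b < \<sigma> d"
    consider "{a, b} \<subseteq> V" "{c, d} \<subseteq> V" | "{a, b} \<subseteq> V" "{c, d} \<subseteq> W" | "{a, b} \<subseteq> W" "{c, d} \<subseteq> V"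
      | "{a, b} \<subseteq> W" "{c, d} \<subseteq> W" using E[OF e(1)] E[OF e(2)] by blast
    then show False
    proof cases
      case 1 then show False using noncrossD[OF assms(2), of a b c d] e o V by simp
    next
      case 2 then show False using assms(3)[of b] assms(6)[of c] o V[of b] W[of c] by simp
    next
      case 3 then show False using assms(3)[of c] assms(6)[of a] o V[of c] W[of a] by simp
    next
      case 4 then show False using noncrossD[OF assms(5), of a b c d] e o W by simp
    qed
  qed
  ultimately show ?thesis by blast
qed

text \<open>Two drawings that share at most \<open>m\<close> are put side by side: \<open>m\<close>
  is made the last vertex of one and, by a reflection, the first of the other.\<close>

lemma noncross_separation:
  assumes fin: "finite V" "finite W"
    and V: "inj_on \<pi> V" "noncross {e\<in>E. e \<subseteq> V} \<pi>" "V \<noteq> {}"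
    and W: "inj_on \<rho> W" "noncross {e\<in>E. e \<subseteq> W} \<rho>" "W \<noteq> {}"
    and VW: "V \<inter> W \<subseteq> {m}" and E: "\<And>e. e \<in> E \<Longrightarrow> e \<subseteq> V \<or> e \<subseteq> W"
  shows "\<exists>\<sigma>. inj_on \<sigma> (V \<union> W) \<and> noncross E \<sigma>"
proof -
  obtain p where p: "p \<in> V" "V \<inter> W = {} \<or> p = m" using V(3) VW by blast
  obtain q where q: "q \<in> W" "V \<inter> W = {} \<or> q = m" using W(3) VW by blast
  obtain \<pi>' where \<pi>': "inj_on \<pi>' V" "noncross {e\<in>E. e \<subseteq> V} \<pi>'" "\<pi>' p = 0" "\<And>x. x \<in> V \<Longrightarrow> \<pi>' x \<le> 0"
    by (rule noncross_rotate[OF fin(1) V(1,2) _ p(1)]) auto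
  obtain \<rho>' where \<rho>': "inj_on \<rho>' W" "noncross {e\<in>E. e \<subseteq> W} \<rho>'" "\<rho>' q = 0" "\<And>x. x \<in> W \<Longrightarrow> \<rho>' x \<le> 0"
    by (rule noncross_rotate[OF fin(2) W(1,2) _ q(1)]) auto
  have \<rho>2: "inj_on (\<lambda>x. - \<rho>' x) W" "noncross {e\<in>E. e \<subseteq> W} (\<lambda>x. - \<rho>' x)"
    using \<rho>'(1) noncross_uminus[OF \<rho>'(2)] by (simp_all add: inj_on_def)
  show ?thesis
  proof (cases "V \<inter> W = {}")
    case True
    \<comment> \<open>Without a common vertex, the shift by 1 keeps the position 0 from being taken
      twice.\<close>
    show ?thesis
    proof (rule noncross_glue[where \<pi> = "\<lambda>x. \<pi>' x - 1", OF _ _ _ \<rho>2 _ _ _ E])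
      show "inj_on (\<lambda>x. \<pi>' x - 1) V" "noncross {e\<in>E. e \<subseteq> V} (\<lambda>x. \<pi>' x - 1)"
        using \<pi>'(1,2) by (simp_all add: inj_on_def noncross_def)
      show "x = y" if "x \<in> V" "y \<in> W" "\<pi>' x - 1 = - \<rho>' y" for x y
        using \<pi>'(4)[of x] \<rho>'(4)[of y] that by simp
    qed (use \<pi>'(4) \<rho>'(4) True in fastforce)+
  next
    case False
    then have m: "p = m" "q = m" "\<And>x. x \<in> V \<Longrightarrow> x \<in> W \<Longrightarrow> x = m" using p q VW by auto
    show ?thesis
    proof (rule noncross_glue[OF \<pi>'(1,2,4) \<rho>2 _ _ _ E])
      show "x = y" if xy: "x \<in> V" "y \<in> W" "\<pi>' x = - \<rho>' y" for x y
      proof -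
        have "\<pi>' x = 0" "\<rho>' y = 0" using \<pi>'(4)[of x] \<rho>'(4)[of y] xy by simp_all
        then have "x = m" "y = m" using \<pi>'(1,3) \<rho>'(1,3) xy p q m by (metis inj_onD)+
        then show ?thesis by simp
      qed
      show "\<pi>' x = - \<rho>' x" if "x \<in> V" "x \<in> W" for x
        using m(3)[OF that] \<pi>'(3) \<rho>'(3) m(1,2) by simp
    qed (use \<rho>'(4) in auto)
  qed
qed

lemma has_minor_mono:
  assumes "has_minor V E VH EH" "V \<subseteq> W" "E \<subseteq> F"
  shows "has_minor W F VH EH"
proof -
  obtain B where B: "\<And>x. x \<in> VH \<Longrightarrow> B x \<noteq> {} \<and> B x \<subseteq> V \<and> connected_in E (B x)"
    "\<And>x y. x \<in> VH \<Longrightarrow> y \<in> VH \<Longrightarrow> x \<noteq> y \<Longrightarrow> B x \<inter> B y = {}"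
    "\<And>x y. {x, y} \<in> EH \<Longrightarrow> \<exists>u\<in>B x. \<exists>v\<in>B y. {u, v} \<in> E"
    using assms(1) unfolding has_minor_def by metis
  have "connected_in F S" if "connected_in E S" for S
  proof -
    have "{(x, y). {x, y} \<in> E \<and> x \<in> S \<and> y \<in> S} \<subseteq> {(x, y). {x, y} \<in> F \<and> x \<in> S \<and> y \<in> S}"
      using assms(3) by auto
    then show ?thesis using that rtrancl_mono unfolding connected_in_def by blast
  qed
  then show ?thesis unfolding has_minor_def
    by (intro exI[of _ B]) (meson B assms(2,3) order_trans subsetD)
qed

lemma has_minorI:
  fixes VH :: "nat set"
  assumes "\<And>x. x \<in> VH \<Longrightarrow> B x \<noteq> {} \<and> B x \<subseteq> V \<and> connected_in E (B x)"
    and "\<And>x y. x \<in> VH \<Longrightarrow> y \<in> VH \<Longrightarrow> x < y \<Longrightarrow> B x \<inter> B y = {}"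
    and "\<And>e. e \<in> EH \<Longrightarrow> \<exists>x y. e = {x, y} \<and> (\<exists>u\<in>B x. \<exists>v\<in>B y. {u, v} \<in> E)"
  shows "has_minor V E VH EH"
  unfolding has_minor_def
proof (intro exI[of _ B] conjI ballI impI allI)
  fix x y assume "x \<in> VH" "y \<in> VH" "x \<noteq> y"
  then show "B x \<inter> B y = {}" using assms(2)[of x y] assms(2)[of y x] by (cases x y rule: linorder_cases) auto
next
  fix x y assume "{x, y} \<in> EH"
  then obtain x' y' u v where *: "{x, y} = {x', y'}" "u \<in> B x'" "v \<in> B y'" "{u, v} \<in> E"
    using assms(3) by metis
  have "{v, u} \<in> E" using *(4) by (simp add: insert_commute)
  moreover have "x = x' \<and> y = y' \<or> x = y' \<and> y = x'" using *(1) by (auto simp: doubleton_eq_iff)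
  ultimately show "\<exists>u\<in>B x. \<exists>v\<in>B y. {u, v} \<in> E" using * by blast
qed (use assms(1) in auto)

lemma connected_in_path:
  assumes "successively (\<lambda>x y. {x, y} \<in> E) xs"
  shows "connected_in E (set xs)"
proof -
  let ?r = "\<lambda>S. {(x, y). {x, y} \<in> E \<and> x \<in> S \<and> y \<in> S}"
  have sym: "(y, x) \<in> (?r S)\<^sup>*" if "(x, y) \<in> (?r S)\<^sup>*" for x y S
  proof -
    have "sym (?r S)" by (auto simp: sym_def insert_commute)
    then show ?thesis using that by (meson sym_rtrancl symD)
  qed
  have hd: "(hd xs, z) \<in> (?r (set xs))\<^sup>*" if "z \<in> set xs" for z
    using assms that
  proof (induction xs)
    case (Cons x xs)
    show ?case
    proof (cases "z = x")
      case False
      then have z: "z \<in> set xs" using Cons by simp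
      then obtain y ys where xs: "xs = y # ys" by (cases xs) auto
      have "(y, z) \<in> (?r (set xs))\<^sup>*" using Cons z xs by simp
      moreover have "?r (set xs) \<subseteq> ?r (set (x # xs))" by auto
      ultimately have "(y, z) \<in> (?r (set (x # xs)))\<^sup>*" by (meson rtrancl_mono subsetD)
      moreover have "(x, y) \<in> ?r (set (x # xs))" using Cons xs by simp
      ultimately show ?thesis by (simp add: converse_rtrancl_into_rtrancl)
    qed simp
  qed simp
  show ?thesis unfolding connected_in_def using hd sym by (meson rtrancl_trans)
qed

definition closed_walk :: "'a set set \<Rightarrow> 'a list \<Rightarrow> bool" where
  "closed_walk E vs \<longleftrightarrow> vs \<noteq> [] \<and> distinct vs \<and> successively (\<lambda>x y. {x, y} \<in> E) vs \<and> {last vs, hd vs} \<in> E"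

lemma closed_walk_rotate: "closed_walk E (xs @ ys) \<Longrightarrow> closed_walk E (ys @ xs)"
  by (cases "xs = []"; cases "ys = []") (auto simp: closed_walk_def successively_append_iff)

lemma closed_walk_insert:
  assumes "closed_walk E (a # b # ys)" "p \<noteq> []" "distinct p" "set p \<inter> set (a # b # ys) = {}"
    "successively (\<lambda>x y. {x, y} \<in> E) p" "{a, hd p} \<in> E" "{last p, b} \<in> E"
  shows "closed_walk E (a # p @ b # ys)"
proof -
  have "successively (\<lambda>x y. {x, y} \<in> E) (p @ b # ys)"
    using assms by (auto simp: closed_walk_def successively_append_iff)
  then show ?thesis using assms by (cases p) (auto simp: closed_walk_def)
qed

text \<open>Suppose a longest cycle misses a vertex, and let \<open>B\<close> be the component of
  that vertex off the cycle. As no single vertex separates, \<open>B\<close> has two neighbours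
  \<open>a\<close>, \<open>b\<close> on the cycle. If these were consecutive, a detour through
  \<open>B\<close> would lengthen the cycle. Otherwise \<open>{a}\<close>, \<open>{b}\<close> on one
  side and the two arcs between them and \<open>B\<close> on the other are the branch sets of a
  \<open>K\<^sub>2\<^sub>,\<^sub>3\<close> minor.\<close>

lemma hamiltonian_or_minor:
  assumes G: "simple_graph V E" and V: "card V \<ge> 2"
    and nosep: "\<And>X Y m. X \<subset> V \<Longrightarrow> Y \<subset> V \<Longrightarrow> X \<union> Y = V \<Longrightarrow> X \<inter> Y \<subseteq> {m} \<Longrightarrow>
      (\<And>e. e \<in> E \<Longrightarrow> e \<subseteq> X \<or> e \<subseteq> Y) \<Longrightarrow> False"
    and K23: "\<not> has_minor V E K23_V K23_E"
  shows "\<exists>vs. closed_walk E vs \<and> set vs = V"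
proof -
  have finV: "finite V" using G by (simp add: simple_graph_def)
  have EV: "u \<in> V" "v \<in> V" "u \<noteq> v" if "{u, v} \<in> E" for u v
    using G that by (auto simp: simple_graph_def)
  have Epair: "\<exists>u v. e = {u, v}" if "e \<in> E" for e
    using G that unfolding simple_graph_def by (metis card_2_iff)
  have "E \<noteq> {}"
  proof
    assume E: "E = {}"
    obtain x where x: "x \<in> V" using V by fastforce
    show False
    proof (rule nosep[of "{x}" "V - {x}" x])
      show "{x} \<subset> V"
      proof
        show "{x} \<noteq> V" using V by auto
      qed (use x in auto)
    qed (use x E in auto)
  qed
  then obtain u v where uv: "{u, v} \<in> E" using Epair by fastforce
  have uv: "closed_walk E [u, v] \<and> length [u, v] \<ge> 2"
    using uv EV[OF uv] by (simp add: closed_walk_def insert_commute)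
  have subV: "set ys \<subseteq> V" if "closed_walk E ys" "length ys \<ge> 2" for ys
  proof
    fix y assume "y \<in> set ys"
    then obtain as bs where ys: "ys = as @ y # bs" by (meson split_list)
    then have "closed_walk E (y # bs @ as)" using closed_walk_rotate[of E as "y # bs"] that by simp
    then have "{last (y # bs @ as), y} \<in> E" by (simp add: closed_walk_def)
    then show "y \<in> V" using EV by blast
  qed
  have bound: "length ys \<le> card V" if "closed_walk E ys \<and> length ys \<ge> 2" for ys
    using that subV[of ys] card_mono[OF finV, of "set ys"] distinct_card[of ys] by (auto simp: closed_walk_def)
  have "\<exists>vs. (closed_walk E vs \<and> length vs \<ge> 2) \<and>
      (\<forall>ys. closed_walk E ys \<and> length ys \<ge> 2 \<longrightarrow> length ys \<le> length vs)"
    by (rule ex_has_greatest_nat[of _ "[u, v]" length "Suc (card V)"])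
      (use uv bound in \<open>auto intro: le_imp_less_Suc\<close>)
  then obtain vs where vs: "closed_walk E vs" "length vs \<ge> 2"
    and longest: "\<And>ys. closed_walk E ys \<Longrightarrow> length ys \<ge> 2 \<Longrightarrow> length ys \<le> length vs"
    by blast
  let ?C = "set vs"
  have CV: "?C \<subseteq> V" using subV vs by blast
  have "?C = V"
  proof (rule ccontr)
    assume "?C \<noteq> V"
    then obtain y where y: "y \<in> V" "y \<notin> ?C" using CV by auto
    define r where "r = {(p, q). {p, q} \<in> E \<and> p \<notin> ?C \<and> q \<notin> ?C}"
    have symr: "(q, p) \<in> r\<^sup>*" if "(p, q) \<in> r\<^sup>*" for p q
    proof -
      have "sym r" by (auto simp: sym_def r_def insert_commute)
      then show ?thesis using that by (meson sym_rtrancl symD)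
    qed
    define B where "B = {z. (y, z) \<in> r\<^sup>*}"
    have BV: "z \<in> V \<and> z \<notin> ?C" if "z \<in> B" for z
    proof -
      have "(y, z) \<in> r\<^sup>*" using that by (simp add: B_def)
      then show ?thesis by (induction rule: rtrancl_induct) (use y EV in \<open>auto simp: r_def\<close>)
    qed
    have yB: "y \<in> B" by (simp add: B_def)
    have Bstep: "q \<in> B" if "p \<in> B" "{p, q} \<in> E" "q \<notin> ?C" for p q
      using that BV[of p] unfolding B_def r_def by (auto intro: rtrancl.rtrancl_into_rtrancl)
    define N where "N = {a \<in> ?C. \<exists>z\<in>B. {z, a} \<in> E}"
    have "\<not> N \<subseteq> {m}" for m
    proof
      assume N: "N \<subseteq> {m}"
      show False
      proof (rule nosep[of "B \<union> N" "V - B" m])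
        have "card ?C \<ge> 2" using vs distinct_card[of vs] by (simp add: closed_walk_def)
        then have "\<not> ?C \<subseteq> {m}" using card_mono[of "{m}" ?C] by auto
        then obtain c where "c \<in> ?C" "c \<noteq> m" by auto
        then have "c \<in> V" "c \<notin> B \<union> N" using CV BV N by auto
        then show "B \<union> N \<subset> V" using BV CV by (auto simp: N_def)
        show "V - B \<subset> V" using y yB by auto
        show "B \<union> N \<union> (V - B) = V" using BV CV by (auto simp: N_def)
        show "(B \<union> N) \<inter> (V - B) \<subseteq> {m}" using N by auto
        fix e assume e: "e \<in> E"
        then obtain p q where pq: "e = {p, q}" using Epair by blast
        have 1: "e \<subseteq> B \<union> N" if "p \<in> B" "e = {p, q}" for p q
          using Bstep[of p q] that e by (auto simp: N_def)
        show "e \<subseteq> B \<union> N \<or> e \<subseteq> V - B"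
          using 1[of p q] 1[of q p] pq EV[of p q] e by (auto simp: insert_commute)
      qed
    qed
    then obtain a b where ab: "a \<in> N" "b \<in> N" "a \<noteq> b" by blast
    obtain za zb where z: "za \<in> B" "{za, a} \<in> E" "zb \<in> B" "{zb, b} \<in> E" using ab by (auto simp: N_def)
    \<comment> \<open>Stated for arbitrary ends because \<open>a\<close> may immediately precede
      \<open>b\<close> on the cycle, or \<open>b\<close> may immediately precede
      \<open>a\<close>.\<close>
    have no: False if "closed_walk E (a # b # ys)" "set (a # b # ys) = ?C" "za \<in> B" "{za, a} \<in> E" "zb \<in> B" "{zb, b} \<in> E"
      for a b ys za zb
    proof -
      have "(za, y) \<in> r\<^sup>*" "(y, zb) \<in> r\<^sup>*" using that symr by (auto simp: B_def)
      then have "(za, zb) \<in> r\<^sup>*" by (rule rtrancl_trans)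
      then obtain p where p: "p \<noteq> []" "hd p = za" "last p = zb" "distinct p"
        "successively (\<lambda>x y. (x, y) \<in> r) p" using rtrancl_distinct_path by metis
      have "set p \<subseteq> B" using p(1,2,5) that(3)
      proof (induction p arbitrary: za)
        case (Cons x xs)
        show ?case
        proof (cases xs)
          case (Cons x' xs')
          then have "(x, x') \<in> r" using Cons.prems by simp
          then have "x' \<in> B" using Bstep[of x x'] Cons.prems by (simp add: r_def)
          then show ?thesis using Cons.IH[of x'] Cons Cons.prems by simp
        qed (use Cons.prems in simp)
      qed simp
      then have "set p \<inter> set (a # b # ys) = {}" using BV that(2) by blast
      moreover have "successively (\<lambda>x y. {x, y} \<in> E) p"
        using p(5) by (rule successively_mono) (auto simp: r_def)
      ultimately have "closed_walk E (a # p @ b # ys)"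
        using closed_walk_insert[OF that(1) p(1,4)] that(4,6) p(2,3) by (simp add: insert_commute)
      then have "length (a # p @ b # ys) \<le> length vs" using p(1) by (intro longest) (cases p; simp)+
      moreover have "length vs = length (a # b # ys)"
        using vs(1) that(1,2) distinct_card[of vs] distinct_card[of "a # b # ys"]
        by (simp add: closed_walk_def)
      ultimately show False using p(1) by (cases p) auto
    qed
    have "a \<in> ?C" "b \<in> ?C" using ab by (auto simp: N_def)
    then obtain us ws where "vs = us @ a # ws" by (meson split_list)
    then have w1: "closed_walk E (a # ws @ us)" "set (a # ws @ us) = ?C"
      using closed_walk_rotate[of E us "a # ws"] vs by auto
    then have "b \<in> set (ws @ us)" using \<open>b \<in> ?C\<close> ab(3) by auto
    then obtain xs ys where "ws @ us = xs @ b # ys" by (meson split_list)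
    then have w: "closed_walk E (a # xs @ b # ys)" "set (a # xs @ b # ys) = ?C" using w1 by auto
    have "xs \<noteq> []"
    proof
      assume "xs = []"
      then show False using no[of a b ys za zb] w z by simp
    qed
    moreover have "ys \<noteq> []"
    proof
      assume "ys = []"
      then have "closed_walk E (b # a # xs)" "set (b # a # xs) = ?C"
        using closed_walk_rotate[of E "a # xs" "[b]"] w by auto
      then show False using no[of b a xs zb za] z by blast
    qed
    moreover define F where "F = (\<lambda>i :: nat. if i = 0 then {a} else if i = 1 then {b} else
      if i = 2 then set xs else if i = 3 then set ys else B)"
    have F: "F 0 = {a}" "F 1 = {b}" "F 2 = set xs" "F 3 = set ys" "F 4 = B" by (simp_all add: F_def)
    have wD: "distinct (a # xs @ b # ys)" "successively (\<lambda>x y. {x, y} \<in> E) (a # xs @ b # ys)"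
      "{last (a # xs @ b # ys), a} \<in> E" using w(1) by (simp_all add: closed_walk_def)
    have conB: "connected_in E B"
    proof -
      let ?rB = "{(p, q). {p, q} \<in> E \<and> p \<in> B \<and> q \<in> B}"
      have "(y, z) \<in> ?rB\<^sup>*" if "z \<in> B" for z
      proof -
        have "(y, z) \<in> r\<^sup>*" using that by (simp add: B_def)
        then show ?thesis
        proof (induction rule: rtrancl_induct)
          case (step p q)
          have "p \<in> B" using step by (simp add: B_def)
          then have "(p, q) \<in> ?rB" using Bstep[of p q] step(2) by (simp add: r_def)
          then show ?case using step.IH by (rule rtrancl.rtrancl_into_rtrancl[rotated])
        qed simp
      qed
      moreover have "sym ?rB" by (auto simp: sym_def insert_commute)
      then have "(z, y) \<in> ?rB\<^sup>*" if "(y, z) \<in> ?rB\<^sup>*" for z using that by (meson sym_rtrancl symD)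
      ultimately show ?thesis unfolding connected_in_def by (meson rtrancl_trans)
    qed
    have "has_minor V E K23_V K23_E"
    proof (rule has_minorI[where B = F])
      fix i assume "i \<in> K23_V"
      moreover have "connected_in E {c}" for c by (simp add: connected_in_def)
      moreover have "connected_in E (set xs)" "connected_in E (set ys)"
        using wD(2) by (auto intro!: connected_in_path simp: successively_append_iff successively_Cons)
      ultimately show "F i \<noteq> {} \<and> F i \<subseteq> V \<and> connected_in E (F i)"
        using \<open>xs \<noteq> []\<close> \<open>ys \<noteq> []\<close> w(2) CV yB BV conB by (auto simp: K23_V_def F_def)
    next
      fix i j assume "i \<in> K23_V" "j \<in> K23_V" "i < j"
      moreover have "B \<inter> set (a # xs @ b # ys) = {}" using BV w(2) by blast
      ultimately show "F i \<inter> F j = {}" using wD(1) by (auto simp: K23_V_def F_def)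
    next
      fix e assume "e \<in> K23_E"
      then obtain i j where ij: "e = {i, j}" "i = 0 \<or> i = 1" "j = 2 \<or> j = 3 \<or> j = 4"
        unfolding K23_E_def by auto
      have 02: "{a, hd xs} \<in> E" "{b, last xs} \<in> E" "{a, last ys} \<in> E" "{b, hd ys} \<in> E"
        using wD(2,3) \<open>xs \<noteq> []\<close> \<open>ys \<noteq> []\<close>
        by (auto simp: successively_append_iff successively_Cons insert_commute)
      have m: "hd xs \<in> set xs" "last xs \<in> set xs" "hd ys \<in> set ys" "last ys \<in> set ys"
        using \<open>xs \<noteq> []\<close> \<open>ys \<noteq> []\<close> by auto
      have "\<exists>u\<in>F i. \<exists>v\<in>F j. {u, v} \<in> E"
        using ij(2,3) 02 m z F by (elim disjE) (auto simp: insert_commute intro: bexI[of _ za] bexI[of _ zb])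
      then show "\<exists>x y. e = {x, y} \<and> (\<exists>u\<in>F x. \<exists>v\<in>F y. {u, v} \<in> E)" using ij(1) by blast
    qed
    then show False using K23 by simp
  qed
  then show ?thesis using vs by blast
qed

text \<open>Crossing chords \<open>{a, b}\<close> and \<open>{c, d}\<close> allow the Hamiltonian
  cycle to be cut into four paths containing \<open>a\<close>, \<open>c\<close>, \<open>b\<close>,
  \<open>d\<close> in this order. Neighbouring paths are joined by the cycle and opposite ones by
  the chords, which gives a \<open>K\<^sub>4\<close> minor.\<close>

lemma hamiltonian_noncross:
  assumes w: "closed_walk E vs" and K4: "\<not> has_minor (set vs) E K4_V K4_E"
    and sub: "\<And>e. e \<in> E \<Longrightarrow> e \<subseteq> set vs"
  shows "\<exists>\<pi>. inj_on \<pi> (set vs) \<and> noncross E \<pi>"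
proof -
  have dist: "distinct vs" using w by (simp add: closed_walk_def)
  define pos where "pos x = (THE i. i < length vs \<and> vs ! i = x)" for x
  have pos: "pos x < length vs \<and> vs ! pos x = x" if "x \<in> set vs" for x
    unfolding pos_def by (rule theI'[OF distinct_Ex1[OF dist that]])
  have inj: "inj_on (\<lambda>x. int (pos x)) (set vs)"
    by (rule inj_onI) (metis pos of_nat_eq_iff)
  have "noncross E (\<lambda>x. int (pos x))" unfolding noncross_def
  proof (intro allI impI notI)
    fix a b c d
    assume e: "{a, b} \<in> E" "{c, d} \<in> E"
      and o: "int (pos a) < int (pos c) \<and> int (pos c) < int (pos b) \<and> int (pos b) < int (pos d)"
    have mem: "a \<in> set vs" "b \<in> set vs" "c \<in> set vs" "d \<in> set vs" using sub e by auto
    define w0 where "w0 = take (pos c) vs"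
    define w1 where "w1 = take (pos b - pos c) (drop (pos c) vs)"
    define w2 where "w2 = take (pos d - pos b) (drop (pos b) vs)"
    define w3 where "w3 = drop (pos d) vs"
    have "drop (pos b) vs = w2 @ w3"
      using append_take_drop_id[of "pos d - pos b" "drop (pos b) vs"] o by (simp add: w2_def w3_def)
    moreover have "drop (pos c) vs = w1 @ drop (pos b) vs"
      using append_take_drop_id[of "pos b - pos c" "drop (pos c) vs"] o by (simp add: w1_def)
    ultimately have vs: "vs = w0 @ w1 @ w2 @ w3"
      using append_take_drop_id[of "pos c" vs] by (simp add: w0_def)
    have len: "pos d < length vs" using pos mem by blast
    have "a \<in> set w0"
      unfolding w0_def in_set_conv_nth using pos[OF mem(1)] o len by (intro exI[of _ "pos a"]) auto
    moreover have "c \<in> set w1"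
      unfolding w1_def in_set_conv_nth using pos[OF mem(3)] o len by (intro exI[of _ 0]) auto
    moreover have "b \<in> set w2"
      unfolding w2_def in_set_conv_nth using pos[OF mem(2)] o len by (intro exI[of _ 0]) auto
    moreover have "d \<in> set w3"
      unfolding w3_def in_set_conv_nth using pos[OF mem(4)] o len by (intro exI[of _ 0]) auto
    ultimately have m: "a \<in> set w0" "c \<in> set w1" "b \<in> set w2" "d \<in> set w3" .
    then have ne: "w0 \<noteq> []" "w1 \<noteq> []" "w2 \<noteq> []" "w3 \<noteq> []" by auto
    have suc: "successively (\<lambda>x y. {x, y} \<in> E) (w0 @ w1 @ w2 @ w3)" "{last w3, hd w0} \<in> E"
      using w ne unfolding closed_walk_def vs by simp_all
    have con: "connected_in E (set w0)" "connected_in E (set w1)" "connected_in E (set w2)" "connected_in E (set w3)"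
      using suc(1) by (auto intro!: connected_in_path simp: successively_append_iff)
    have link: "{last w0, hd w1} \<in> E" "{last w1, hd w2} \<in> E" "{last w2, hd w3} \<in> E" "{hd w0, last w3} \<in> E"
      using suc ne by (auto simp: successively_append_iff insert_commute)
    define F where "F = (\<lambda>i :: nat. if i = 0 then set w0 else if i = 1 then set w1 else
      if i = 2 then set w2 else set w3)"
    have F: "F 0 = set w0" "F 1 = set w1" "F 2 = set w2" "F 3 = set w3" by (simp_all add: F_def)
    have "has_minor (set vs) E K4_V K4_E"
    proof (rule has_minorI[where B = F])
      fix i assume "i \<in> K4_V"
      then show "F i \<noteq> {} \<and> F i \<subseteq> set vs \<and> connected_in E (F i)"
        using ne con by (auto simp: K4_V_def F_def vs)
    next
      fix i j assume "i \<in> K4_V" "j \<in> K4_V" "i < j"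
      then show "F i \<inter> F j = {}" using dist unfolding vs by (auto simp: K4_V_def F_def)
    next
      fix e' assume "e' \<in> K4_E"
      then obtain i j where ij: "e' = {i, j}" "i \<in> K4_V" "j \<in> K4_V" "i < j"
        unfolding K4_E_def by (smt (verit) insert_commute linorder_neqE_nat mem_Collect_eq)
      then have "(i, j) \<in> {(0, 1), (0, 2), (0, 3), (1, 2), (1, 3), (2, 3)}"
        by (auto simp: K4_V_def)
      moreover have "\<exists>u\<in>F 0. \<exists>v\<in>F 1. {u, v} \<in> E" "\<exists>u\<in>F 1. \<exists>v\<in>F 2. {u, v} \<in> E"
        "\<exists>u\<in>F 2. \<exists>v\<in>F 3. {u, v} \<in> E" "\<exists>u\<in>F 0. \<exists>v\<in>F 3. {u, v} \<in> E"
        "\<exists>u\<in>F 0. \<exists>v\<in>F 2. {u, v} \<in> E" "\<exists>u\<in>F 1. \<exists>v\<in>F 3. {u, v} \<in> E"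
        unfolding F using link ne m e by (meson hd_in_set last_in_set)+
      ultimately show "\<exists>x y. e' = {x, y} \<and> (\<exists>u\<in>F x. \<exists>v\<in>F y. {u, v} \<in> E)"
        using ij(1) by blast
    qed
    then show False using K4 by simp
  qed
  then show ?thesis using inj by blast
qed

text \<open>A separation along at most one vertex reduces the problem to two smaller drawings.
  Otherwise there is at most one vertex, or excluding \<open>K\<^sub>2\<^sub>,\<^sub>3\<close>
  yields a Hamiltonian cycle, along which excluding \<open>K\<^sub>4\<close> rules out
  crossings.\<close>

lemma outerplanar_noncross:
  assumes "simple_graph V E" "outerplanar V E"
  shows "\<exists>\<pi>. inj_on \<pi> V \<and> noncross E \<pi>"
  using assms
proof (induction "card V" arbitrary: V E rule: less_induct)
  case less
  have finV: "finite V" and EV: "\<And>e. e \<in> E \<Longrightarrow> e \<subseteq> V" and card2: "\<And>e. e \<in> E \<Longrightarrow> card e = 2"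
    using less.prems(1) by (auto simp: simple_graph_def)
  have sub: "\<exists>\<pi>. inj_on \<pi> X \<and> noncross {e\<in>E. e \<subseteq> X} \<pi>" if "X \<subset> V" for X
  proof (rule less.hyps)
    show "card X < card V" using that finV by (simp add: psubset_card_mono)
    show "simple_graph X {e\<in>E. e \<subseteq> X}"
      using less.prems(1) that finite_subset by (auto simp: simple_graph_def)
    show "outerplanar X {e\<in>E. e \<subseteq> X}"
      using less.prems(2) has_minor_mono[of X "{e\<in>E. e \<subseteq> X}" _ _ V E] that
      unfolding outerplanar_def by blast
  qed
  show ?case
  proof (cases "\<exists>X Y m. X \<subset> V \<and> Y \<subset> V \<and> X \<union> Y = V \<and> X \<inter> Y \<subseteq> {m} \<and> (\<forall>e\<in>E. e \<subseteq> X \<or> e \<subseteq> Y)")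
    case True
    then obtain X Y m where XY: "X \<subset> V" "Y \<subset> V" "X \<union> Y = V" "X \<inter> Y \<subseteq> {m}"
      "\<forall>e\<in>E. e \<subseteq> X \<or> e \<subseteq> Y" by (elim exE conjE)
    have fin: "finite X" "finite Y" and ne: "X \<noteq> {}" "Y \<noteq> {}"
      using XY finV by (auto intro: finite_subset)
    obtain \<pi> where \<pi>: "inj_on \<pi> X" "noncross {e\<in>E. e \<subseteq> X} \<pi>" using sub[OF XY(1)] by blast
    obtain \<rho> where \<rho>: "inj_on \<rho> Y" "noncross {e\<in>E. e \<subseteq> Y} \<rho>" using sub[OF XY(2)] by blast
    show ?thesis using noncross_separation[OF fin(1,2) \<pi> ne(1) \<rho> ne(2) XY(4)] XY(3,5) by simp
  next
    case False
    then have nosep: "\<not> (X \<subset> V \<and> Y \<subset> V \<and> X \<union> Y = V \<and> X \<inter> Y \<subseteq> {m} \<and> (\<forall>e\<in>E. e \<subseteq> X \<or> e \<subseteq> Y))"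
      for X Y m by - (rule notI, erule notE, intro exI, assumption)
    show ?thesis
    proof (cases "card V \<ge> 2")
      case True
      have "\<exists>vs. closed_walk E vs \<and> set vs = V"
      proof (rule hamiltonian_or_minor[OF less.prems(1) True])
        show False if "X \<subset> V" "Y \<subset> V" "X \<union> Y = V" "X \<inter> Y \<subseteq> {m}"
          "\<And>e. e \<in> E \<Longrightarrow> e \<subseteq> X \<or> e \<subseteq> Y" for X Y m
          using nosep[of X Y m] that by simp
        show "\<not> has_minor V E K23_V K23_E" using less.prems(2) by (simp add: outerplanar_def)
      qed
      then obtain vs where vs: "closed_walk E vs" "set vs = V" by blast
      show ?thesis
        using hamiltonian_noncross[OF vs(1)] less.prems(2) EV unfolding vs(2) outerplanar_def by blast
    next
      case False
      have "e \<notin> E" for e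
        using card_mono[OF finV EV[of e]] card2[of e] False by linarith
      then have "E = {}" by blast
      then have "noncross E \<pi>" for \<pi> by (simp add: noncross_def)
      moreover obtain f :: "'a \<Rightarrow> nat" where "inj_on f V" using finite_imp_inj_to_nat_seg[OF finV] by blast
      then have "inj_on (\<lambda>x. int (f x)) V" by (simp add: inj_on_def)
      ultimately show ?thesis by blast
    qed
  qed
qed

lemma outerplanar_pure:
  assumes G: "simple_graph V E" and op: "outerplanar V E"
  shows "graph_pure V E"
proof -
  have finV: "finite V" using G by (simp add: simple_graph_def)
  obtain \<rho> where \<rho>: "inj_on \<rho> V" "noncross E \<rho>" using outerplanar_noncross[OF assms] by blast
  define \<pi> where "\<pi> x = nat (\<rho> x - Min (\<rho> ` V))" for x
  have less: "\<pi> x < \<pi> y \<longleftrightarrow> \<rho> x < \<rho> y" if "x \<in> V" "y \<in> V" for x y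
  proof -
    have "Min (\<rho> ` V) \<le> \<rho> x" "Min (\<rho> ` V) \<le> \<rho> y" using finV that by auto
    then show ?thesis by (auto simp: \<pi>_def)
  qed
  have inj: "inj_on \<pi> V"
    using \<rho>(1) less by (intro inj_onI) (metis inj_onD less_irrefl linorder_cases)
  have edge: "u \<in> V" "v \<in> V" "u \<noteq> v" if "{u, v} \<in> E" for u v
    using G that by (auto simp: simple_graph_def)
  define D where "D = {(u, v). {u, v} \<in> E \<and> \<pi> u < \<pi> v}"
  have D: "total_orientation V E D" unfolding total_orientation_def
  proof (intro conjI allI impI)
    fix u v assume uv: "{u, v} \<in> E"
    then have "\<pi> u \<noteq> \<pi> v" using edge[OF uv] inj by (auto simp: inj_on_def)
    then show "((u, v) \<in> D) = ((v, u) \<notin> D)" using uv by (auto simp: D_def insert_commute)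
  qed (auto simp: D_def)
  define p where "p = map_prod \<pi> \<pi>"
  have DV: "D \<subseteq> V \<times> V" using edge by (auto simp: D_def)
  \<comment> \<open>\<open>Suc\<close> makes \<open>n\<close> positive even for an empty graph,
    since a polygon needs a side. Positions that carry no vertex only contribute elements that are
    deleted again.\<close>
  define n where "n = Suc (Max (insert 0 (\<pi> ` V)))"
  have n: "\<pi> x \<le> n" if "x \<in> V" for x
    unfolding n_def by (rule le_SucI, rule Max_ge) (use finV that in auto)
  have "\<exists>A. tri 0 n A \<and> {(a, b)\<in>p ` D. 0 \<le> a \<and> a < b \<and> b \<le> n} \<subseteq> A"
  proof (rule noncrossing_tri)
    fix a b c d assume "(a, b) \<in> p ` D" "(c, d) \<in> p ` D"
    then obtain a' b' c' d' where *: "(a', b') \<in> D" "(c', d') \<in> D" "a = \<pi> a'" "b = \<pi> b'" "c = \<pi> c'" "d = \<pi> d'"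
      by (auto simp: p_def)
    then have E: "{a', b'} \<in> E" "{c', d'} \<in> E" by (auto simp: D_def)
    show "\<not> (a < c \<and> c < b \<and> b < d)"
      using noncrossD[OF \<rho>(2) E] edge[OF E(1)] edge[OF E(2)] less * by auto
  qed (simp add: n_def)
  then obtain A where A: "tri 0 n A" "{(a, b)\<in>p ` D. 0 \<le> a \<and> a < b \<and> b \<le> n} \<subseteq> A" by blast
  have "p ` D \<subseteq> {(a, b)\<in>p ` D. 0 \<le> a \<and> a < b \<and> b \<le> n}"
    using n DV by (fastforce simp: p_def D_def)
  then have "p ` D \<subseteq> A" using A(2) by (rule order_trans)
  then have "mpure (p ` D) fst snd"
    using mpure_subset[OF _ mpure_tri[OF A(1)]] tri_bounds[OF A(1)] by blast
  moreover have "inj_on p D"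
    unfolding p_def by (rule inj_on_subset[OF map_prod_inj_on[OF inj inj] DV])
  ultimately have "mpure D (fst \<circ> p) (snd \<circ> p)" using mpure_image by blast
  moreover have "fst \<circ> p = \<pi> \<circ> fst" "snd \<circ> p = \<pi> \<circ> snd" by (auto simp: p_def)
  ultimately have "mpure D (\<pi> \<circ> fst) (\<pi> \<circ> snd)" by simp
  moreover have "inj_on \<pi> (fst ` D \<union> snd ` D)" by (rule inj_on_subset[OF inj]) (use DV in auto)
  ultimately show ?thesis using mpure_vertices[of \<pi> fst D snd] graph_pure_iff[OF G D] by simp
qed

theorem theorem5p5:
  fixes V :: "'a set" and E :: "'a set set"
  assumes "simple_graph V E"
  shows "(graph_pure V E \<longleftrightarrow> outerplanar V E) \<and>
         (\<forall>D. total_orientation V E D \<longrightarrow> (OM_pure D \<longleftrightarrow> outerplanar V E))"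
proof -
  have pure: "graph_pure V E \<longleftrightarrow> outerplanar V E"
    using outerplanar_pure[OF assms] pure_no_K4[OF assms] pure_no_K23[OF assms]
    unfolding outerplanar_def by blast
  moreover have "OM_pure D \<longleftrightarrow> outerplanar V E" if D: "total_orientation V E D" for D
    using OM_pure_iff[OF finite_orientation[OF assms D]] graph_pure_iff[OF assms D] pure by simp
  ultimately show ?thesis by blast
qed

end
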